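(* Let $q=p^r$ be a power of a prime $p$ with $r\ge 1$, let $n\ge 1$, let $V=\mathbb F_q^n$ be the natural $GL_n(q)$-module, let $I=(n_1,\dots,n_\ell)$ be a composition of $n$ with associated standard parabolic subgroup $P_I\subseteq GL_n(q)$, and put $m_i=n_1+\cdots+n_i$ for $1\le i\le \ell$. Let $k$ be an integer with $1\le k\le q-2$. Then the Hilbert series in $t,s$ of the bi-graded vector space $\big(S^\bullet(V)\otimes\wedge^\bullet(V)\otimes\mathrm{Det}^k\big)^{P_I}$, namely $\sum_{i,j}t^is^j\dim_{\mathbb F_q}\big(S^i(V)\otimes\wedge^j(V)\otimes\mathrm{Det}^k\big)^{P_I}$, is equal to $$t^{(q-2-k)\frac{q^n-1}{q-1}}\cdot\frac{\prod_{i=0}^{n-1}(s+t^{q^i})}{\prod_{i=1}^{\ell}\prod_{j=1}^{n_i}\big(1-t^{q^{m_i}-q^{m_i-j}}\big)}.$$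
   Context: $GL_n(q)$ acts naturally on the symmetric algebra $S^\bullet(V)$ and the exterior algebra $\wedge^\bullet(V)$ of $V$ (over $\mathbb F_q$), and diagonally on tensor products. $\mathrm{Det}$ is the one-dimensional $GL_n(q)$-module over $\mathbb F_q$ on which $g$ acts by $\det(g)$. A composition $I=(n_1,\dots,n_\ell)$ of $n$ is a sequence of positive integers with sum $n$. $P_I$ is the subgroup of $GL_n(q)$ of block upper triangular matrices with invertible diagonal blocks of sizes $n_1,\dots,n_\ell$ (in this order); matrices act on $V$ with basis $x_1,\dots,x_n$ by $g\cdot x_j=\sum_k g_{kj}x_k$. *)

theory Defs
  imports
    "HOL-Library.Poly_Mapping"
    "HOL-Computational_Algebra.Formal_Power_Series"
    "HOL-Computational_Algebra.Primes"
    "Jordan_Normal_Form.Determinant"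
begin

section \<open>Vector spaces with a distinguished basis\<close>

text \<open>
  A vector space over \<open>'a\<close> with basis indexed by \<open>'b\<close> is represented by the finitely supported
  functions \<open>'b \<Rightarrow>\<^sub>0 'a\<close>; the basis vector with index \<open>b\<close> is \<open>Poly_Mapping.single b 1\<close>.
\<close>

definition scale :: "'a::semiring_0 \<Rightarrow> ('b \<Rightarrow>\<^sub>0 'a) \<Rightarrow> ('b \<Rightarrow>\<^sub>0 'a)" where
  "scale c u = Poly_Mapping.map ((*) c) u"

lemma lookup_scale [simp]: "Poly_Mapping.lookup (scale c u) b = c * Poly_Mapping.lookup u b"
  by (simp add: scale_def Poly_Mapping.map.rep_eq when_def)

lemma vector_space_scale: "vector_space (scale :: 'a::field \<Rightarrow> ('b \<Rightarrow>\<^sub>0 'a) \<Rightarrow> _)"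
  by unfold_locales (auto intro!: poly_mapping_eqI simp: lookup_add algebra_simps)

text \<open>The linear map with prescribed values \<open>f b\<close> on the basis vectors.\<close>

definition linear_extend ::
    "('b \<Rightarrow> ('c \<Rightarrow>\<^sub>0 'a)) \<Rightarrow> ('b \<Rightarrow>\<^sub>0 'a::comm_semiring_1) \<Rightarrow> ('c \<Rightarrow>\<^sub>0 'a)" where
  "linear_extend f u = (\<Sum>b\<in>Poly_Mapping.keys u. scale (Poly_Mapping.lookup u b) (f b))"

lemma linear_extend_single [simp]: "linear_extend f (Poly_Mapping.single b 1) = f b"
  by (auto intro!: poly_mapping_eqI simp: linear_extend_def)

definition tensor ::
    "('b \<Rightarrow>\<^sub>0 'a) \<Rightarrow> ('c \<Rightarrow>\<^sub>0 'a::comm_semiring_1) \<Rightarrow> (('b \<times> 'c) \<Rightarrow>\<^sub>0 'a)" where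
  "tensor u v = (\<Sum>b\<in>Poly_Mapping.keys u. \<Sum>c\<in>Poly_Mapping.keys v.
     Poly_Mapping.single (b, c) (Poly_Mapping.lookup u b * Poly_Mapping.lookup v c))"

lemma lookup_tensor:
  "Poly_Mapping.lookup (tensor u v) (b, c) = Poly_Mapping.lookup u b * Poly_Mapping.lookup v c"
proof -
  have "Poly_Mapping.lookup (tensor u v) (b, c)
      = (\<Sum>b'\<in>Poly_Mapping.keys u. if b' = b then
          (\<Sum>c'\<in>Poly_Mapping.keys v. if c' = c then
             Poly_Mapping.lookup u b * Poly_Mapping.lookup v c else 0) else 0)"
    unfolding tensor_def lookup_sum
    by (intro sum.cong refl) (auto simp: lookup_single when_def intro!: sum.cong sum.neutral)
  also have "\<dots> = Poly_Mapping.lookup u b * Poly_Mapping.lookup v c"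
    by (simp add: sum.delta in_keys_iff)
  finally show ?thesis .
qed

section \<open>The symmetric and the exterior algebra of the natural module\<close>

text \<open>
  Indices are zero-based: the basis vector \<open>x\<^sub>j\<close> of \<open>V\<close> has index \<open>j - 1\<close>, an element of \<open>{..<n}\<close>.

  The symmetric algebra of \<open>V\<close> is the polynomial ring on \<open>x\<^sub>1, \<dots>, x\<^sub>n\<close>. Its monomials are the
  exponent vectors \<open>nat \<Rightarrow>\<^sub>0 nat\<close> and its multiplication is the convolution product of the library.
\<close>

type_synonym 'a sym_alg = "(nat \<Rightarrow>\<^sub>0 nat) \<Rightarrow>\<^sub>0 'a"

definition sym_gen :: "nat \<Rightarrow> 'a::comm_semiring_1 sym_alg" where
  "sym_gen j = Poly_Mapping.single (Poly_Mapping.single j 1) 1"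

definition sym_act :: "'a::comm_semiring_1 mat \<Rightarrow> 'a sym_alg \<Rightarrow> 'a sym_alg" where
  "sym_act g = linear_extend (\<lambda>m. \<Prod>j\<in>Poly_Mapping.keys m.
     (\<Sum>k<dim_row g. scale (g $$ (k, j)) (sym_gen k)) ^ Poly_Mapping.lookup m j)"

definition monomial_degree :: "(nat \<Rightarrow>\<^sub>0 nat) \<Rightarrow> nat" where
  "monomial_degree m = (\<Sum>j\<in>Poly_Mapping.keys m. Poly_Mapping.lookup m j)"

text \<open>
  The exterior algebra of \<open>V\<close> has as basis the products \<open>x\<^sub>J\<close> of the \<open>x\<^sub>j\<close>, \<open>j \<in> J\<close>, in increasing
  order. One has \<open>x\<^sub>J \<and> x\<^sub>K = 0\<close> if \<open>J\<close> and \<open>K\<close> meet, and otherwise \<open>x\<^sub>J \<and> x\<^sub>K = \<plusminus> x\<^bsub>J \<union> K\<^esub>\<close>, the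
  sign being given by the number of transpositions needed to sort the factors.
\<close>

type_synonym 'a ext_alg = "nat set \<Rightarrow>\<^sub>0 'a"

definition ext_gen :: "nat \<Rightarrow> 'a::comm_ring_1 ext_alg" where
  "ext_gen j = Poly_Mapping.single {j} 1"

definition ext_one :: "'a::comm_ring_1 ext_alg" where
  "ext_one = Poly_Mapping.single {} 1"

definition ext_basis_mult :: "nat set \<Rightarrow> nat set \<Rightarrow> 'a::comm_ring_1 ext_alg" where
  "ext_basis_mult J K = (if J \<inter> K = {}
     then Poly_Mapping.single (J \<union> K) ((- 1) ^ card {(a, b). a \<in> J \<and> b \<in> K \<and> b < a}) else 0)"

definition wedge :: "'a::comm_ring_1 ext_alg \<Rightarrow> 'a ext_alg \<Rightarrow> 'a ext_alg" where
  "wedge u v = (\<Sum>J\<in>Poly_Mapping.keys u. \<Sum>K\<in>Poly_Mapping.keys v.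
     scale (Poly_Mapping.lookup u J * Poly_Mapping.lookup v K) (ext_basis_mult J K))"

definition ext_act :: "'a::comm_ring_1 mat \<Rightarrow> 'a ext_alg \<Rightarrow> 'a ext_alg" where
  "ext_act g = linear_extend (\<lambda>J.
     foldr wedge (map (\<lambda>j. \<Sum>k<dim_row g. scale (g $$ (k, j)) (ext_gen k)) (sorted_list_of_set J))
       ext_one)"

lemma wedge_single:
  "wedge (Poly_Mapping.single J 1) (Poly_Mapping.single K 1)
    = (ext_basis_mult J K :: 'a::comm_ring_1 ext_alg)"
  by (rule poly_mapping_eqI) (simp add: wedge_def)

lemma wedge_gen:
  "wedge (ext_gen i) (ext_gen j) =
    (if i < j then Poly_Mapping.single {i, j} 1
     else if j < i then Poly_Mapping.single {i, j} (- 1) else (0 :: 'a::comm_ring_1 ext_alg))"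
proof -
  have "{(a, b). a = i \<and> b = j \<and> b < a} = (if j < i then {(i, j)} else {})"
    by auto
  then show ?thesis
    by (auto simp: wedge_single ext_gen_def ext_basis_mult_def insert_commute)
qed

lemma foldr_wedge_gen:
  "sorted_wrt (<) js \<Longrightarrow>
    foldr wedge (map ext_gen js) ext_one
      = (Poly_Mapping.single (set js) 1 :: 'a::comm_ring_1 ext_alg)"
proof (induction js)
  case (Cons j js)
  have "{(a, b). a \<in> {j} \<and> b \<in> set js \<and> b < a} = {}" "j \<notin> set js"
    using Cons.prems by auto
  then have "ext_basis_mult {j} (set js) = (Poly_Mapping.single (set (j # js)) 1 :: 'a ext_alg)"
    unfolding ext_basis_mult_def by (simp only:) simp
  moreover have "foldr wedge (map ext_gen js) ext_one
      = (Poly_Mapping.single (set js) 1 :: 'a ext_alg)"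
    using Cons by simp
  ultimately show ?case
    by (simp add: wedge_single [of "{j}", folded ext_gen_def])
qed (simp add: ext_one_def)

section \<open>The bigraded module \<open>S(V) \<otimes> \<Lambda>(V) \<otimes> Det\<^sup>k\<close>\<close>

text \<open>
  \<open>Det\<^sup>k\<close> is one-dimensional, so tensoring with it leaves the underlying vector space unchanged and
  multiplies the action of \<open>g\<close> by \<open>det g ^ k\<close>.
\<close>

type_synonym 'a sym_ext = "((nat \<Rightarrow>\<^sub>0 nat) \<times> nat set) \<Rightarrow>\<^sub>0 'a"

definition sym_ext_det_act ::
    "nat \<Rightarrow> 'a::comm_ring_1 mat \<Rightarrow> 'a sym_ext \<Rightarrow> 'a sym_ext" where
  "sym_ext_det_act k g u = scale (det g ^ k) (linear_extend
     (\<lambda>(m, J). tensor (sym_act g (Poly_Mapping.single m 1)) (ext_act g (Poly_Mapping.single J 1))) u)"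

definition sym_ext_component :: "nat \<Rightarrow> nat \<Rightarrow> nat \<Rightarrow> 'a::comm_ring_1 sym_ext set" where
  "sym_ext_component n i j = {u. \<forall>(m, J) \<in> Poly_Mapping.keys u.
     Poly_Mapping.keys m \<subseteq> {..<n} \<and> monomial_degree m = i \<and> J \<subseteq> {..<n} \<and> card J = j}"

definition sym_ext_det_invariants ::
    "nat \<Rightarrow> 'a::comm_ring_1 mat set \<Rightarrow> nat \<Rightarrow> nat \<Rightarrow> nat \<Rightarrow> 'a sym_ext set" where
  "sym_ext_det_invariants n G k i j =
     {u \<in> sym_ext_component n i j. \<forall>g\<in>G. sym_ext_det_act k g u = u}"

text \<open>
  Bivariate power series are series in \<open>s\<close> whose coefficients are series in \<open>t\<close>.
\<close>

definition hs_s :: "rat fps fps" where "hs_s = fps_X"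

definition hs_t :: "rat fps fps" where "hs_t = fps_const fps_X"

definition hilbert_series :: "nat \<Rightarrow> 'a::field mat set \<Rightarrow> nat \<Rightarrow> rat fps fps" where
  "hilbert_series n G k = Abs_fps (\<lambda>j. Abs_fps (\<lambda>i.
     of_nat (vector_space.dim scale (sym_ext_det_invariants n G k i j))))"

text \<open>
  Division of nested power series is the genuine one whenever the denominator has a nonzero constant
  term.
\<close>

lemma fps_fps_divide_mult:
  fixes f g :: "rat fps fps"
  assumes "fps_nth (fps_nth g 0) 0 \<noteq> 0"
  shows "f / g * g = f"
proof -
  have "fps_nth g 0 * inverse (fps_nth g 0) = 1"
    using assms by (simp add: inverse_mult_eq_1')
  then have "g * inverse g = 1"
    by (simp add: fps_inverse_def fps_right_inverse)
  moreover have "fps_nth g 0 \<noteq> 0"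
    using assms by auto
  ultimately show ?thesis
    by (simp add: fps_divide_unit mult.assoc mult.commute [of "inverse g"])
qed

section \<open>Standard parabolic subgroups\<close>

definition is_composition :: "nat list \<Rightarrow> nat \<Rightarrow> bool" where
  "is_composition I n \<longleftrightarrow> (\<forall>a \<in> set I. 0 < a) \<and> sum_list I = n"

definition partial_sum :: "nat list \<Rightarrow> nat \<Rightarrow> nat" where
  "partial_sum I i = sum_list (take i I)"

definition GL :: "nat \<Rightarrow> 'a::semiring_1 mat set" where
  "GL n = {g \<in> carrier_mat n n. invertible_mat g}"

definition diag_block :: "nat list \<Rightarrow> nat \<Rightarrow> 'a mat \<Rightarrow> 'a mat" where
  "diag_block I i g =
     mat (I ! i) (I ! i) (\<lambda>(a, b). g $$ (partial_sum I i + a, partial_sum I i + b))"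

text \<open>
  An entry lies strictly below the diagonal blocks iff some block boundary \<open>partial_sum I i\<close> separates
  its column (before the boundary) from its row (at or after the boundary).
\<close>

definition parabolic :: "nat list \<Rightarrow> 'a::semiring_1 mat set" where
  "parabolic I = {g \<in> GL (sum_list I).
     (\<forall>i \<le> length I. \<forall>a < sum_list I. \<forall>b < sum_list I.
        b < partial_sum I i \<longrightarrow> partial_sum I i \<le> a \<longrightarrow> g $$ (a, b) = 0) \<and>
     (\<forall>i < length I. invertible_mat (diag_block I i g))}"

end

theory Submission
  imports Defs
begin

text \<open>
  Let \<open>A\<close> be the Moore matrix \<open>(x\<^sub>j\<^bsup>q\<^sup>a\<^esup>)\<close> over the polynomial ring, and \<open>L = det A\<close>. Since \<open>g\<close> acts on
  the entries of \<open>A\<close> by right multiplication with \<open>g\<close>, the endomorphism \<open>\<Lambda>(A)\<close> of \<open>S(V) \<otimes> \<Lambda>(V)\<close>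
  turns invariants of \<open>S(V) \<otimes> \<Lambda>(V) \<otimes> Det\<^sup>k\<close> into tuples of polynomials \<open>f\<^sub>T\<close>, \<open>T \<subseteq> {0, \<dots>, n - 1}\<close>,
  that are semi-invariant for \<open>det\<^bsup>-k\<^esup>\<close>, and it is injective. By Jacobi's theorem on complementary
  minors every tuple of multiples of \<open>L\<close> is in the image.

  The semi-invariants are determined by their leading monomials for the lexicographic order in which
  variables of larger index are larger; indices start at 0. Let \<open>e\<close> be the leading exponent of a
  semi-invariant. Invariance under \<open>x\<^sub>j \<mapsto> x\<^sub>j + v\<close> makes it a
  polynomial in the orbit product of \<open>x\<^sub>j\<close> with coefficients free of \<open>x\<^sub>j\<close>, so \<open>q\<^sup>j\<close> divides \<open>e\<^sub>j\<close>; the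
  torus gives \<open>e\<^sub>j \<equiv> -k\<close> modulo \<open>q - 1\<close>; and comparing with the image under the exchange of two
  adjacent variables in one block gives \<open>q e\<^sub>j \<le> e\<^bsub>j+1\<^esub>\<close>. The exponents that satisfy these conditions are
  exactly the leading exponents of the products of \<open>L\<^bsup>q-1-k\<^esup>\<close> with the Dickson polynomials
  \<open>c\<^bsub>m,b\<^esub>\<close> of degree \<open>q\<^sup>m - q\<^sup>b\<close>, where \<open>m\<close> is the end of the block of \<open>b\<close>. All these products are
  semi-invariant and, because \<open>k \<le> q - 2\<close>, multiples of \<open>L\<close>.
\<close>

text \<open>The obstacle is that a group element moves the polynomials and the exterior generators
  at once. The map \<Lambda>(A) sends the generator x_j to the sum of x_j^(q^a) y_a, where the new
  generators y_a are fixed by the group, so that only the coefficients still carry an action. Its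
  image is hard to describe, but it contains L times everything, and the leading exponents leave
  room only for multiples of L^(q-1-k) with q-1-k at least 1; hence every tuple of semi-invariants
  comes from an invariant.

  A polynomial placed at y_T comes from polynomial degree lower by the sum of q^a over a in T. As L
  has degree the sum of all q^a, one factor L is traded for the sum over the complement of T. This
  is the origin of the exponent q-2-k and of the product of the factors s + t^(q^a).

  The conditions on leading exponents use only diagonal matrices, transvections and adjacent
  exchanges, whereas the explicit elements have to be invariant under the whole group. The two sides
  meet in a triangular matrix of coefficients, which yields spanning and independence
  together.\<close>

abbreviation lookup where "lookup \<equiv> Poly_Mapping.lookup"
abbreviation keys where "keys \<equiv> Poly_Mapping.keys"
abbreviation single where "single \<equiv> Poly_Mapping.single"

section \<open>Linear maps between spaces with a distinguished basis\<close>

lemma scale_add_right: "scale c (u + v) = scale c u + scale c (v :: 'b \<Rightarrow>\<^sub>0 'a::semiring_0)"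
  by (rule poly_mapping_eqI) (simp add: lookup_add distrib_left)

lemma scale_add_left: "scale (c + d) u = scale c u + scale d (u :: 'b \<Rightarrow>\<^sub>0 'a::semiring_0)"
  by (rule poly_mapping_eqI) (simp add: lookup_add distrib_right)

lemma scale_scale [simp]: "scale c (scale d u) = scale (c * d) (u :: 'b \<Rightarrow>\<^sub>0 'a::semiring_0)"
  by (rule poly_mapping_eqI) (simp add: mult.assoc)

lemma scale_one [simp]: "scale 1 u = (u :: 'b \<Rightarrow>\<^sub>0 'a::semiring_1)"
  by (rule poly_mapping_eqI) simp

lemma scale_zero [simp]: "scale c 0 = (0 :: 'b \<Rightarrow>\<^sub>0 'a::semiring_0)"
  "scale 0 u = (0 :: 'b \<Rightarrow>\<^sub>0 'a::semiring_0)"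
  by (rule poly_mapping_eqI, simp)+

lemma scale_minus_one: "scale (- 1) u = - (u :: 'b \<Rightarrow>\<^sub>0 'a::ring_1)"
  by (rule poly_mapping_eqI) simp

lemma scale_sum: "scale c (sum f X) = (\<Sum>x\<in>X. scale c (f x :: 'b \<Rightarrow>\<^sub>0 'a::semiring_0))"
  by (induction X rule: infinite_finite_induct) (simp_all add: scale_add_right)

lemma scale_single [simp]: "scale c (single b d) = single b (c * d :: 'a::semiring_0)"
  by (rule poly_mapping_eqI) (simp add: lookup_single when_def)

lemma keys_scale: "keys (scale c u) \<subseteq> keys (u :: 'b \<Rightarrow>\<^sub>0 'a::semiring_0)"
  by (auto simp: in_keys_iff)

lemma keys_sum_subset: "keys (sum f X) \<subseteq> (\<Union>x\<in>X. keys (f x :: 'b \<Rightarrow>\<^sub>0 'a::comm_monoid_add))"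
proof (induction X rule: infinite_finite_induct)
  case (insert x X)
  then show ?case using keys_add [of "f x" "sum f X"] by auto
qed simp_all

lemma poly_mapping_expand:
  "(u :: 'b \<Rightarrow>\<^sub>0 'a::semiring_1) = (\<Sum>b\<in>keys u. scale (lookup u b) (single b 1))"
  by (rule poly_mapping_eqI)
    (auto simp: lookup_sum lookup_single when_def in_keys_iff sum.delta')

text \<open>The scalars form only a commutative semiring, because the same notion serves for spaces
  over the field and for the exterior algebra as a free module over the polynomial ring.\<close>

definition linear_map :: "(('b \<Rightarrow>\<^sub>0 'a::comm_semiring_1) \<Rightarrow> ('c \<Rightarrow>\<^sub>0 'a)) \<Rightarrow> bool" where
  "linear_map F \<longleftrightarrow> (\<forall>u v. F (u + v) = F u + F v) \<and> (\<forall>c u. F (scale c u) = scale c (F u))"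

lemma linear_map_add: "linear_map F \<Longrightarrow> F (u + v) = F u + F v"
  and linear_map_scale: "linear_map F \<Longrightarrow> F (scale c u) = scale c (F u)"
  by (auto simp: linear_map_def)

lemma linear_map_zero: "linear_map F \<Longrightarrow> F 0 = 0"
  using linear_map_scale [of F 0 0] by simp

lemma linear_map_sum: "linear_map F \<Longrightarrow> F (sum f X) = (\<Sum>x\<in>X. F (f x))"
  by (induction X rule: infinite_finite_induct) (simp_all add: linear_map_add linear_map_zero)

lemma linear_map_uminus:
  fixes F :: "('b \<Rightarrow>\<^sub>0 'a::comm_ring_1) \<Rightarrow> ('c \<Rightarrow>\<^sub>0 'a)"
  shows "linear_map F \<Longrightarrow> F (- u) = - F u"
  using linear_map_scale [of F "- 1" u] by (simp add: scale_minus_one)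

lemma linear_map_diff:
  fixes F :: "('b \<Rightarrow>\<^sub>0 'a::comm_ring_1) \<Rightarrow> ('c \<Rightarrow>\<^sub>0 'a)"
  shows "linear_map F \<Longrightarrow> F (u - v) = F u - F v"
  using linear_map_add [of F u "- v"] by (simp add: linear_map_uminus)

lemma linear_map_compose: "linear_map F \<Longrightarrow> linear_map G \<Longrightarrow> linear_map (\<lambda>u. F (G u))"
  by (simp add: linear_map_def)

lemma linear_map_id: "linear_map (\<lambda>u. u)"
  by (simp add: linear_map_def)

lemma linear_map_scale_fun: "linear_map F \<Longrightarrow> linear_map (\<lambda>u. scale c (F u))"
  by (simp add: linear_map_def scale_add_right mult.commute)

lemma linear_map_expand:
  assumes "linear_map F"
  shows "F u = (\<Sum>b\<in>keys u. scale (lookup u b) (F (single b 1)))"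
  by (subst poly_mapping_expand [of u])
    (simp only: linear_map_sum [OF assms] linear_map_scale [OF assms])

lemma linear_map_eqI:
  assumes "linear_map F" "linear_map G" "\<And>b. b \<in> keys u \<Longrightarrow> F (single b 1) = G (single b 1)"
  shows "F u = G u"
  unfolding linear_map_expand [OF assms(1), of u] linear_map_expand [OF assms(2), of u]
  using assms(3) by simp

lemma linear_extend_superset:
  assumes "finite B" "keys u \<subseteq> B"
  shows "linear_extend f u = (\<Sum>b\<in>B. scale (lookup u b) (f b))"
  unfolding linear_extend_def using assms
  by (intro sum.mono_neutral_left) (auto simp: in_keys_iff)

lemma linear_map_linear_extend: "linear_map (linear_extend f)"
proof -
  have "linear_extend f (u + v) = linear_extend f u + linear_extend f v" for u v
  proof -
    have "keys (u + v) \<subseteq> keys u \<union> keys v" by (rule keys_add)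
    then show ?thesis
      by (simp add: linear_extend_superset [of "keys u \<union> keys v"] lookup_add scale_add_left
          sum.distrib)
  qed
  moreover have "linear_extend f (scale c u) = scale c (linear_extend f u)" for c u
    by (simp add: linear_extend_superset [OF finite_keys keys_scale] linear_extend_def [of f u]
      scale_sum)
  ultimately show ?thesis by (simp add: linear_map_def)
qed

lemma linear_extend_single' [simp]: "linear_extend f (single b c) = scale c (f b)"
  using linear_map_scale [OF linear_map_linear_extend, of f c "single b 1"] by simp

lemma linear_map_linear_extend_fun:
  assumes "\<And>b. linear_map (\<lambda>v. f b v)"
  shows "linear_map (\<lambda>v. linear_extend (\<lambda>b. f b v) u)"
  using assms by (auto simp: linear_map_def linear_extend_def scale_add_right sum.distrib
      scale_sum mult.commute)

lemma keys_linear_extend: "keys (linear_extend f u) \<subseteq> (\<Union>b\<in>keys u. keys (f b))"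
  unfolding linear_extend_def
  by (rule order.trans [OF keys_sum_subset]) (use keys_scale in fast)

section \<open>The exterior algebra\<close>

lemma wedge_linear_extend:
  "wedge u v = linear_extend (\<lambda>J. linear_extend (\<lambda>K. ext_basis_mult J K) v) u"
  by (simp add: wedge_def linear_extend_def scale_sum)

lemma linear_map_wedge_left: "linear_map (\<lambda>u. wedge u v)"
  unfolding wedge_linear_extend by (rule linear_map_linear_extend)

lemma linear_map_wedge_right: "linear_map (\<lambda>v. wedge u v)"
  unfolding wedge_linear_extend
  by (intro linear_map_linear_extend_fun linear_map_linear_extend)

lemmas wedge_simps =
  linear_map_add [OF linear_map_wedge_left] linear_map_add [OF linear_map_wedge_right]
  linear_map_scale [OF linear_map_wedge_left] linear_map_scale [OF linear_map_wedge_right]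
  linear_map_zero [OF linear_map_wedge_left] linear_map_zero [OF linear_map_wedge_right]
  linear_map_uminus [OF linear_map_wedge_left] linear_map_uminus [OF linear_map_wedge_right]

section \<open>Signs and associativity of the wedge product\<close>

definition inversions :: "nat set \<Rightarrow> nat set \<Rightarrow> nat" where
  "inversions J K = card {(a, b). a \<in> J \<and> b \<in> K \<and> b < a}"

lemma ext_basis_mult_inversions:
  "ext_basis_mult J K = (if J \<inter> K = {} then single (J \<union> K) ((- 1) ^ inversions J K) else 0)"
  by (simp add: ext_basis_mult_def inversions_def)

lemma finite_inversions:
  "finite J \<Longrightarrow> finite K \<Longrightarrow> finite {(a, b). a \<in> J \<and> b \<in> K \<and> b < (a :: nat)}"
  by (rule finite_subset [of _ "J \<times> K"]) auto

lemma inversions_Un_left: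
  assumes "finite J" "finite J'" "finite K" "J \<inter> J' = {}"
  shows "inversions (J \<union> J') K = inversions J K + inversions J' K"
proof -
  have "{(a, b). a \<in> J \<union> J' \<and> b \<in> K \<and> b < a}
      = {(a, b). a \<in> J \<and> b \<in> K \<and> b < a} \<union> {(a, b). a \<in> J' \<and> b \<in> K \<and> b < a}" by auto
  then show ?thesis unfolding inversions_def
    using assms by (subst card_Un_disjoint [symmetric]) (auto simp: finite_inversions)
qed

lemma inversions_Un_right:
  assumes "finite J" "finite K" "finite K'" "K \<inter> K' = {}"
  shows "inversions J (K \<union> K') = inversions J K + inversions J K'"
proof -
  have "{(a, b). a \<in> J \<and> b \<in> K \<union> K' \<and> b < a}
      = {(a, b). a \<in> J \<and> b \<in> K \<and> b < a} \<union> {(a, b). a \<in> J \<and> b \<in> K' \<and> b < a}" by auto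
  then show ?thesis unfolding inversions_def
    using assms by (subst card_Un_disjoint [symmetric]) (auto simp: finite_inversions)
qed

lemma inversions_singleton: "inversions {k} K = card {b \<in> K. b < k}"
proof -
  have "{(a, b). a \<in> {k} \<and> b \<in> K \<and> b < a} = Pair k ` {b \<in> K. b < k}" by auto
  then show ?thesis by (simp add: inversions_def card_image inj_on_def)
qed

text \<open>If two of the sets meet, both sides vanish. Otherwise \<open>inversions\<close> is
  additive in each argument, and on both sides the sign has exponent
  \<open>inversions J K + inversions J M + inversions K M\<close>.\<close>

lemma wedge_basis_assoc:
  assumes "finite J" "finite K" "finite M"
  shows "wedge (wedge (single J 1) (single K 1)) (single M 1)
    = (wedge (single J 1) (wedge (single K 1) (single M 1)) :: 'a::comm_ring_1 ext_alg)"
proof -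
  have s: "wedge (single X c) v = scale c (wedge (single X 1) v)"
    "wedge v (single X c) = scale c (wedge v (single X 1))" for X :: "nat set" and c :: 'a and v
    using linear_map_scale [OF linear_map_wedge_left, of c "single X 1" v]
      linear_map_scale [OF linear_map_wedge_right, of v c "single X 1"] by simp_all
  consider "J \<inter> K = {}" "J \<inter> M = {}" "K \<inter> M = {}" | "J \<inter> K \<noteq> {}" | "J \<inter> K = {}" "J \<inter> M \<noteq> {}"
    | "J \<inter> K = {}" "J \<inter> M = {}" "K \<inter> M \<noteq> {}" by blast
  then show ?thesis
  proof cases
    case 1
    then have "(J \<union> K) \<inter> M = {}" "J \<inter> (K \<union> M) = {}" by auto
    with 1 show ?thesis
      by (simp add: wedge_single ext_basis_mult_inversions s [where c = "(- 1) ^ i"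
        for i] inversions_Un_left
          inversions_Un_right assms power_add Un_assoc mult_ac)
  next
    case 2
    then have "J \<inter> (K \<union> M) \<noteq> {}" by auto
    with 2 show ?thesis
      by (simp add: wedge_single ext_basis_mult_inversions wedge_simps s [where c = "(- 1) ^ i"
        for i])
  next
    case 3
    then have "J \<inter> (K \<union> M) \<noteq> {}" "(J \<union> K) \<inter> M \<noteq> {}" by auto
    with 3 show ?thesis
      by (simp add: wedge_single ext_basis_mult_inversions wedge_simps s [where c = "(- 1) ^ i"
        for i])
  next
    case 4
    then have "(J \<union> K) \<inter> M \<noteq> {}" by auto
    with 4 show ?thesis
      by (simp add: wedge_single ext_basis_mult_inversions wedge_simps s [where c = "(- 1) ^ i"
        for i])
  qed
qed

text \<open>Additivity of \<open>inversions\<close>, and with it associativity, is available for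
  finite index sets: \<open>card\<close> of an infinite set is 0. The type of the exterior algebra
  admits infinite index sets, so finiteness is carried along.\<close>

definition ext_finite :: "'a::comm_ring_1 ext_alg \<Rightarrow> bool" where
  "ext_finite u \<longleftrightarrow> (\<forall>J\<in>keys u. finite J)"

lemma ext_finite_single [simp]: "finite J \<Longrightarrow> ext_finite (single J c)"
  by (simp add: ext_finite_def)

lemma ext_finite_scale [simp]: "ext_finite u \<Longrightarrow> ext_finite (scale c u)"
  using keys_scale [of c u] by (auto simp: ext_finite_def)

lemma ext_finite_sum: "(\<And>x. x \<in> X \<Longrightarrow> ext_finite (f x)) \<Longrightarrow> ext_finite (sum f X)"
  unfolding ext_finite_def by (auto dest!: subsetD [OF keys_sum_subset])

lemma ext_finite_one [simp]: "ext_finite ext_one"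
  by (simp add: ext_one_def)

lemma ext_finite_gen [simp]: "ext_finite (ext_gen k)"
  by (simp add: ext_gen_def)

lemma keys_wedge: "keys (wedge u v) \<subseteq> {J \<union> K |J K. J \<in> keys u \<and> K \<in> keys v \<and> J \<inter> K = {}}"
proof -
  have "keys (wedge u v) \<subseteq> (\<Union>J\<in>keys u. \<Union>K\<in>keys v. keys (ext_basis_mult J K :: 'a ext_alg))"
    unfolding wedge_linear_extend
    by (rule order.trans [OF keys_linear_extend]) (intro UN_mono order.refl keys_linear_extend)
  also have "\<dots> \<subseteq> {J \<union> K |J K. J \<in> keys u \<and> K \<in> keys v \<and> J \<inter> K = {}}"
    unfolding ext_basis_mult_inversions by (intro UN_least) (auto split: if_splits)
  finally show ?thesis .
qed

lemma ext_finite_wedge [simp]: "ext_finite u \<Longrightarrow> ext_finite v \<Longrightarrow> ext_finite (wedge u v)"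
  unfolding ext_finite_def by (auto dest!: subsetD [OF keys_wedge])

lemma wedge_assoc:
  assumes "ext_finite u" "ext_finite v" "ext_finite w"
  shows "wedge (wedge u v) w = wedge u (wedge v w)"
proof -
  note lin = linear_map_wedge_left linear_map_wedge_right
  have 1: "wedge (wedge (single J 1) (single K 1)) w = wedge (single J 1) (wedge (single K 1) w)"
    if "finite J" "finite K" for J K
    by (rule linear_map_eqI [of "\<lambda>w. wedge (wedge (single J 1) (single K 1)) w"])
      (use that assms in \<open>auto simp: ext_finite_def wedge_basis_assoc intro!: lin linear_map_compose
        [of "\<lambda>v. wedge (single J 1) v"]\<close>)
  have 2: "wedge (wedge (single J 1) v) w = wedge (single J 1) (wedge v w)" if "finite J" for J
    by (rule linear_map_eqI [of "\<lambda>v. wedge (wedge (single J 1) v) w"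
          "\<lambda>v. wedge (single J 1) (wedge v w)"])
      (use that assms 1 in \<open>auto simp: ext_finite_def intro!:
        linear_map_compose [OF linear_map_wedge_left linear_map_wedge_right]
        linear_map_compose [OF linear_map_wedge_right linear_map_wedge_left]\<close>)
  show ?thesis
    by (rule linear_map_eqI [of "\<lambda>u. wedge (wedge u v) w" "\<lambda>u. wedge u (wedge v w)"])
      (use assms 2 in \<open>auto simp: ext_finite_def intro!: linear_map_wedge_left
        linear_map_compose [OF linear_map_wedge_left linear_map_wedge_left]\<close>)
qed

lemma wedge_one_left: "wedge ext_one u = u"
proof (rule linear_map_eqI [OF linear_map_wedge_right linear_map_id])
  fix J show "wedge ext_one (single J 1) = (single J 1 :: 'a ext_alg)"
    by (simp add: ext_one_def wedge_single ext_basis_mult_inversions inversions_def)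
qed

lemma wedge_gen_single_less:
  assumes "\<forall>l\<in>K. k < l"
  shows "wedge (ext_gen k) (single K 1) = (single (insert k K) 1 :: 'a::comm_ring_1 ext_alg)"
proof -
  have "{b \<in> K. b < k} = {}" "k \<notin> K" using assms by auto
  then show ?thesis
    by (simp del: Collect_empty_eq add: ext_gen_def wedge_single ext_basis_mult_inversions
      inversions_singleton)
qed

section \<open>Products of elements of degree one\<close>

definition ext_vector :: "nat \<Rightarrow> (nat \<Rightarrow> 'a) \<Rightarrow> 'a::comm_ring_1 ext_alg" where
  "ext_vector n c = (\<Sum>k<n. scale (c k) (ext_gen k))"

lemma ext_finite_vector [simp]: "ext_finite (ext_vector n c)"
  by (auto simp: ext_vector_def intro: ext_finite_sum)

lemma wedge_gen_anticomm: "wedge (ext_gen i) (ext_gen j) = - wedge (ext_gen j) (ext_gen i)"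
  by (auto simp: wedge_gen single_uminus insert_commute)

lemma wedge_gen_vector: "wedge (ext_gen j) (ext_vector n c) = - wedge (ext_vector n c) (ext_gen j)"
  unfolding ext_vector_def linear_map_sum [OF linear_map_wedge_left]
    linear_map_sum [OF linear_map_wedge_right]
  by (simp add: wedge_simps wedge_gen_anticomm [of j] sum_negf flip: scale_minus_one)
    (simp add: scale_sum)

text \<open>In characteristic 2 the vanishing of squares does not follow from anticommutativity, so
  it is proved directly: when one generator is added, the mixed terms cancel by
  \<open>wedge_gen_vector\<close>. Anticommutativity of arbitrary vectors then follows by
  polarisation.\<close>

lemma wedge_vector_self: "wedge (ext_vector n c) (ext_vector n c) = 0"
proof (induction n)
  case (Suc n)
  have "ext_vector (Suc n) c = ext_vector n c + scale (c n) (ext_gen n)"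
    by (simp add: ext_vector_def)
  then show ?case
    by (simp add: wedge_simps Suc wedge_gen wedge_gen_vector scale_add_right)
      (simp flip: scale_minus_one scale_add_left)
qed (simp add: ext_vector_def wedge_simps)

lemma wedge_vector_anticomm: "wedge (ext_vector n c) (ext_vector n d)
  = - wedge (ext_vector n d) (ext_vector n c)"
proof -
  have s: "ext_vector n (\<lambda>k. c k + d k) = ext_vector n c + ext_vector n d"
    by (simp add: ext_vector_def scale_add_left sum.distrib)
  show ?thesis
    using wedge_vector_self [of n "\<lambda>k. c k + d k"]
    by (simp add: s wedge_simps wedge_vector_self eq_neg_iff_add_eq_0 add.commute)
qed

section \<open>The algebra endomorphism induced by a matrix\<close>

lemma linear_map_ext_act: "linear_map (ext_act g)"
  unfolding ext_act_def by (rule linear_map_linear_extend)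

lemmas ext_act_simps = linear_map_add [OF linear_map_ext_act] linear_map_scale [OF
  linear_map_ext_act]
  linear_map_zero [OF linear_map_ext_act] linear_map_uminus [OF linear_map_ext_act]

abbreviation ext_col :: "'a::comm_ring_1 mat \<Rightarrow> nat \<Rightarrow> 'a ext_alg" where
  "ext_col g j \<equiv> ext_vector (dim_row g) (\<lambda>k. g $$ (k, j))"

lemma ext_act_single: "ext_act g (single J 1)
  = foldr wedge (map (ext_col g) (sorted_list_of_set J)) ext_one"
  by (simp add: ext_act_def ext_vector_def)

lemma ext_act_one [simp]: "ext_act g ext_one = ext_one"
  by (simp add: ext_one_def ext_act_single)

text \<open>Since \<open>ext_act\<close> runs through the sorted list of an index set, its natural
  recursion splits off the least element. The inductions on index sets use
  \<open>finite_linorder_min_induct\<close> accordingly.\<close>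

lemma ext_act_insert:
  assumes "finite K" "\<forall>l\<in>K. k < l"
  shows "ext_act g (single (insert k K) 1) = wedge (ext_col g k) (ext_act g (single K 1))"
proof -
  have "sorted_list_of_set (insert k K) = k # sorted_list_of_set K"
    using assms by (subst sorted_list_of_set_insert) (auto simp: insort_is_Cons less_imp_le)
  then show ?thesis by (simp add: ext_act_single)
qed

lemma ext_finite_ext_act_single: "finite J \<Longrightarrow> ext_finite (ext_act g (single J 1))"
proof (induction J rule: finite_linorder_min_induct)
  case empty
  then show ?case by (simp add: ext_act_single)
next
  case (insert b A)
  then show ?case by (simp add: ext_act_insert)
qed

lemma ext_finite_ext_act [simp]: "ext_finite u \<Longrightarrow> ext_finite (ext_act g u)"
  unfolding linear_map_expand [OF linear_map_ext_act, of g u]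
  by (intro ext_finite_sum ext_finite_scale ext_finite_ext_act_single) (simp add: ext_finite_def)

text \<open>The generator \<open>j\<close> is compared with the least element \<open>k\<close> of
  the index set. If it is smaller, the recursion applies. If it is equal, both sides are 0, since
  the column \<open>k\<close> squares to 0. If it is larger, it is moved past \<open>k\<close> at
  the cost of a sign, and the columns \<open>j\<close> and \<open>k\<close> anticommute in the same
  way.\<close>

lemma ext_act_gen_wedge_single:
  assumes "finite K"
  shows "ext_act g (wedge (ext_gen j) (single K 1)) = wedge (ext_col g j) (ext_act g (single K 1))"
  using assms
proof (induction K arbitrary: j rule: finite_linorder_min_induct)
  case empty
  have "wedge (ext_gen j) (single {} 1) = (single {j} 1 :: 'a ext_alg)"
    using wedge_gen_single_less [of "{}" j] by simp
  then show ?case using ext_act_insert [of "{}" j g] by simp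
next
  case (insert k K)
  have x: "single (insert k K) 1 = (wedge (ext_gen k) (single K 1) :: 'a ext_alg)"
    using insert.hyps by (simp add: wedge_gen_single_less)
  have k: "ext_act g (single (insert k K) 1) = wedge (ext_col g k) (ext_act g (single K 1))"
    using insert.hyps by (simp add: ext_act_insert)
  have fin: "ext_finite (ext_act g (single K 1))" using insert.hyps by simp
  consider "j < k" | "j = k" | "k < j" by linarith
  then show ?case
  proof cases
    case 1
    then have "\<forall>l\<in>insert k K. j < l" using insert.hyps by auto
    then show ?thesis
      using insert.hyps by (subst wedge_gen_single_less) (auto intro!: ext_act_insert)
  next
    case 2
    have "wedge (ext_gen k) (single (insert k K) 1) = (0 :: 'a ext_alg)"
      by (simp add: ext_gen_def wedge_single ext_basis_mult_inversions)
    moreover have "wedge (ext_col g k) (wedge (ext_col g k) (ext_act g (single K 1))) = 0"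
      using fin by (simp add: wedge_vector_self wedge_simps flip: wedge_assoc)
    ultimately show ?thesis using 2 k by (simp add: ext_act_simps)
  next
    case 3
    define u :: "'a ext_alg" where "u = wedge (ext_gen j) (single K 1)"
    have 1: "wedge (ext_gen j) (single (insert k K) 1) = - wedge (ext_gen k) u"
      unfolding x u_def using insert.hyps
      by (simp add: wedge_gen_anticomm [of j k] wedge_simps flip: wedge_assoc)
    \<comment> \<open>The product \<open>u\<close> is 0 or a multiple of a basis vector all of whose
      indices exceed \<open>k\<close>, so that \<open>k\<close> can be split off again.\<close>
    have 2: "ext_act g (wedge (ext_gen k) u) = wedge (ext_col g k) (ext_act g u)"
    proof (cases "j \<in> K")
      case True
      then have "u = 0" by (simp add: u_def ext_gen_def wedge_single ext_basis_mult_inversions)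
      then show ?thesis by (simp add: wedge_simps ext_act_simps)
    next
      case False
      define c :: 'a where "c = (- 1) ^ inversions {j} K"
      have u: "u = scale c (single (insert j K) 1)"
        using False by (simp add: u_def ext_gen_def wedge_single ext_basis_mult_inversions c_def)
      have "\<forall>l\<in>insert j K. k < l" using insert.hyps 3 by auto
      then show ?thesis
        unfolding u wedge_simps ext_act_simps using insert.hyps
        by (simp add: wedge_gen_single_less ext_act_insert del: scale_single)
    qed
    have "ext_act g (wedge (ext_gen j) (single (insert k K) 1))
        = - wedge (ext_col g k) (wedge (ext_col g j) (ext_act g (single K 1)))"
      unfolding 1 ext_act_simps 2 by (simp add: u_def insert.IH)
    also have "\<dots> = wedge (ext_col g j) (wedge (ext_col g k) (ext_act g (single K 1)))"
      using fin wedge_vector_anticomm [of "dim_row g" "\<lambda>l. g $$ (l, k)" "\<lambda>l. g $$ (l, j)"]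
      by (simp add: wedge_simps flip: wedge_assoc)
    finally show ?thesis by (simp add: k)
  qed
qed

text \<open>Associativity carries multiplicativity from one generator on the left to an increasing
  product of generators. Thus \<open>ext_act g\<close> is determined as an algebra homomorphism by
  the columns of \<open>g\<close>.\<close>

lemma ext_act_wedge:
  assumes "ext_finite u" "ext_finite v"
  shows "ext_act g (wedge u v) = wedge (ext_act g u) (ext_act g v)"
proof -
  have gen: "ext_act g (wedge (ext_gen k) v) = wedge (ext_col g k) (ext_act g v)"
    if "ext_finite v" for k v
    by (rule linear_map_eqI [of "\<lambda>v. ext_act g (wedge (ext_gen k) v)"
          "\<lambda>v. wedge (ext_col g k) (ext_act g v)"])
      (use that in \<open>auto intro!: linear_map_compose [OF linear_map_ext_act linear_map_wedge_right]
        linear_map_compose [OF linear_map_wedge_right linear_map_ext_act] ext_act_gen_wedge_single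
        simp: ext_finite_def\<close>)
  have basis: "ext_act g (wedge (single J 1) v) = wedge (ext_act g (single J 1)) (ext_act g v)"
    if "finite J" for J
    using that
  proof (induction J rule: finite_linorder_min_induct)
    case empty
    then show ?case by (simp add: wedge_one_left flip: ext_one_def)
  next
    case (insert k K)
    have x: "single (insert k K) 1 = (wedge (ext_gen k) (single K 1) :: 'a ext_alg)"
      using insert.hyps by (simp add: wedge_gen_single_less)
    have "ext_act g (wedge (single (insert k K) 1) v)
      = ext_act g (wedge (ext_gen k) (wedge (single K 1) v))"
      unfolding x using insert.hyps assms by (simp add: wedge_assoc)
    also have "\<dots> = wedge (ext_act g (single (insert k K) 1)) (ext_act g v)"
      using insert assms by (simp add: gen ext_act_insert wedge_assoc)
    finally show ?case .
  qed
  show ?thesis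
    by (rule linear_map_eqI [of "\<lambda>u. ext_act g (wedge u v)"
      "\<lambda>u. wedge (ext_act g u) (ext_act g v)"])
      (use assms basis in \<open>auto intro!: linear_map_compose [OF linear_map_ext_act
        linear_map_wedge_left]
        linear_map_compose [OF linear_map_wedge_left linear_map_ext_act] simp: ext_finite_def\<close>)
qed

section \<open>Functoriality in the matrix\<close>

definition ext_in :: "nat \<Rightarrow> 'a::comm_ring_1 ext_alg \<Rightarrow> bool" where
  "ext_in n u \<longleftrightarrow> keys u \<subseteq> Pow {..<n}"

lemma scale_sum_left: "scale (sum f X) u = (\<Sum>x\<in>X. scale (f x) (u :: 'b \<Rightarrow>\<^sub>0 'a::semiring_0))"
  by (induction X rule: infinite_finite_induct) (simp_all add: scale_add_left)

lemma ext_in_keys: "ext_in n u \<Longrightarrow> J \<in> keys u \<Longrightarrow> J \<subseteq> {..<n}"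
  unfolding ext_in_def by blast

lemma ext_in_finite: "ext_in n u \<Longrightarrow> ext_finite u"
  unfolding ext_finite_def by (blast dest: ext_in_keys intro: finite_subset)

lemma ext_in_single [simp]: "J \<subseteq> {..<n} \<Longrightarrow> ext_in n (single J c)"
  by (simp add: ext_in_def)

lemma ext_in_scale: "ext_in n u \<Longrightarrow> ext_in n (scale c u)"
  unfolding ext_in_def by (rule order.trans [OF keys_scale])

lemma ext_in_sum: "(\<And>x. x \<in> X \<Longrightarrow> ext_in n (f x)) \<Longrightarrow> ext_in n (sum f X)"
  unfolding ext_in_def by (rule order.trans [OF keys_sum_subset]) (rule UN_least)

lemma ext_in_diff: "ext_in n u \<Longrightarrow> ext_in n v \<Longrightarrow> ext_in n (u - v)"
  unfolding ext_in_def by (rule order.trans [OF keys_diff]) (rule Un_least)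

lemma ext_in_wedge: "ext_in n u \<Longrightarrow> ext_in n v \<Longrightarrow> ext_in n (wedge u v)"
  unfolding ext_in_def by (rule order.trans [OF keys_wedge]) blast

lemma ext_in_vector: "ext_in n (ext_vector n c)"
  unfolding ext_vector_def by (intro ext_in_sum ext_in_scale) (simp add: ext_gen_def)

lemma ext_in_ext_act:
  assumes "g \<in> carrier_mat n n" "ext_in n u"
  shows "ext_in n (ext_act g u)"
proof -
  have "ext_in n (ext_act g (single J 1))" if "J \<subseteq> {..<n}" for J
  proof -
    have "finite J" using that finite_subset by blast
    then show ?thesis using that
    proof (induction J rule: finite_linorder_min_induct)
      case empty
      then show ?case by (simp flip: ext_one_def) (simp add: ext_one_def)
    next
      case (insert k K)
      then show ?case using assms(1) by (auto simp: ext_act_insert intro: ext_in_wedge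
        ext_in_vector)
    qed
  qed
  then show ?thesis
    unfolding linear_map_expand [OF linear_map_ext_act, of g u]
    using ext_in_keys [OF assms(2)] by (intro ext_in_sum ext_in_scale) blast
qed

lemma ext_act_gen: "ext_act g (ext_gen k) = ext_col g k"
proof -
  have "ext_act g (single (insert k {}) 1) = wedge (ext_col g k) (ext_act g (single {} 1))"
    by (rule ext_act_insert) auto
  moreover have "wedge (ext_col g k) ext_one = ext_col g k"
  proof (rule linear_map_eqI [OF linear_map_wedge_left linear_map_id])
    fix J show "wedge (single J 1) ext_one = (single J 1 :: 'a ext_alg)"
      by (simp add: ext_one_def wedge_single ext_basis_mult_inversions inversions_def)
  qed
  ultimately show ?thesis by (simp add: ext_gen_def flip: ext_one_def)
qed

text \<open>Both sides respect wedge products, so they only have to be compared on a generator,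
  where the claim is the formula for a column of \<open>A * B\<close>. Index sets must lie below
  \<open>n\<close>, because entries outside the dimensions of a matrix are unspecified.\<close>

lemma ext_act_mult:
  assumes A: "A \<in> carrier_mat n n" and B: "B \<in> carrier_mat n n" and u: "ext_in n u"
  shows "ext_act (A * B) u = ext_act A (ext_act B u)"
proof -
  have col: "ext_col (A * B) k = ext_act A (ext_col B k)" if "k < n" for k
  proof -
    have "ext_act A (ext_col B k) = (\<Sum>m<n. scale (B $$ (m, k)) (ext_col A m))"
      using A B by (simp add: ext_vector_def [of n
        "\<lambda>l. B $$ (l, k)"] linear_map_sum [OF linear_map_ext_act]
          ext_act_simps ext_act_gen)
    also have "\<dots> = (\<Sum>m<n. \<Sum>l<n. scale (A $$ (l, m) * B $$ (m, k)) (ext_gen l))"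
      using A by (simp add: ext_vector_def scale_sum mult.commute)
    also have "\<dots> = (\<Sum>l<n. scale (\<Sum>m<n. A $$ (l, m) * B $$ (m, k)) (ext_gen l))"
      by (subst sum.swap) (simp add: scale_sum_left)
    also have "\<dots> = ext_col (A * B) k"
      using A B that by (auto simp: ext_vector_def scalar_prod_def intro!: sum.cong
          arg_cong2 [where f = scale] simp flip: lessThan_atLeast0)
    finally show ?thesis by simp
  qed
  have "ext_act (A * B) (single J 1) = ext_act A (ext_act B (single J 1))" if "J \<subseteq> {..<n}" for J
  proof -
    have "finite J" using that finite_subset by blast
    then show ?thesis using that
    proof (induction J rule: finite_linorder_min_induct)
      case empty
      then show ?case by (simp flip: ext_one_def)
    next
      case (insert k K)
      then have "ext_act (A * B) (single (insert k K) 1)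
          = wedge (ext_act A (ext_col B k)) (ext_act A (ext_act B (single K 1)))"
        using col [of k] by (simp add: ext_act_insert)
      also have "\<dots> = ext_act A (ext_act B (single (insert k K) 1))"
        using insert.hyps by (subst ext_act_wedge [symmetric]) (auto simp: ext_act_insert)
      finally show ?case .
    qed
  qed
  note basis = this
  show ?thesis
    by (rule linear_map_eqI [of "ext_act (A * B)" "\<lambda>u. ext_act A (ext_act B u)"])
      (use basis ext_in_keys [OF u] linear_map_compose [OF linear_map_ext_act linear_map_ext_act,
        of A B]
        in \<open>simp_all add: linear_map_ext_act\<close>)
qed

text \<open>Used with \<open>c = det A\<close>, the scalar to which a matrix and its adjugate
  multiply.\<close>

lemma lookup_ext_act_smult_one:
  assumes "ext_in n u"
  shows "lookup (ext_act (c \<cdot>\<^sub>m 1\<^sub>m n) u) J = c ^ card J * lookup u J"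
proof -
  have "ext_act (c \<cdot>\<^sub>m 1\<^sub>m n) (single K 1) = single K (c ^ card K)" if "K \<subseteq> {..<n}" for K
  proof -
    have "finite K" using that finite_subset by blast
    then show ?thesis using that
    proof (induction K rule: finite_linorder_min_induct)
      case empty
      then show ?case by (simp flip: ext_one_def)
    next
      case (insert k K)
      have "ext_col (c \<cdot>\<^sub>m 1\<^sub>m n) k = (\<Sum>l<n. if l = k then scale c (ext_gen k) else 0)"
        using insert.prems unfolding ext_vector_def by (intro sum.cong) auto
      also have "\<dots> = scale c (ext_gen k)"
        using insert.prems by simp
      finally have 1: "ext_col (c \<cdot>\<^sub>m 1\<^sub>m n) k = scale c (ext_gen k)" .
      have 2: "single K (c ^ card K) = scale (c ^ card K) (single K 1)" by simp
      have "ext_act (c \<cdot>\<^sub>m 1\<^sub>m n) (single (insert k K) 1) =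
          scale (c ^ card K) (scale c (single (insert k K) 1))"
        using insert by (simp add: ext_act_insert 1 [simplified] 2 wedge_simps
          wedge_gen_single_less del: scale_single)
      moreover have "k \<notin> K" using insert.hyps by auto
      ultimately show ?case using insert.hyps by (simp add: mult.commute)
    qed
  qed
  then have "ext_act (c \<cdot>\<^sub>m 1\<^sub>m n) u = (\<Sum>K\<in>keys u. single K (lookup u K * c ^ card K))"
    using ext_in_keys [OF assms] unfolding linear_map_expand [OF linear_map_ext_act, of _ u]
    by (intro sum.cong) simp_all
  then show ?thesis
    by (auto simp: lookup_sum lookup_single when_def in_keys_iff sum.delta' mult.commute)
qed

section \<open>Coefficients as minors, and the top degree\<close>

lemma lookup_wedge_gen:
  assumes "finite M"
  shows "lookup (wedge (ext_gen k) u) M =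
    (if k \<in> M then (- 1) ^ card {b \<in> M. b < k} * lookup u (M - {k}) else 0)"
proof -
  have b: "lookup (ext_basis_mult {k} K) M
      = (if k \<in> M \<and> K = M - {k} then (- 1) ^ card {b \<in> M. b < k} else 0 :: 'a)" for K
  proof (cases "k \<in> M \<and> K = M - {k}")
    case True
    then have "{b \<in> K. b < k} = {b \<in> M. b < k}" "insert k K = M" "k \<notin> K" by auto
    then show ?thesis
      using True by (simp add: ext_basis_mult_inversions inversions_singleton del: Collect_empty_eq)
  next
    case False
    then show ?thesis
      by (auto simp: ext_basis_mult_inversions lookup_single when_def)
  qed
  have "lookup (wedge (ext_gen k) u) M = (\<Sum>K\<in>keys u. lookup u K * lookup (ext_basis_mult {k} K) M)"
    unfolding linear_map_expand [OF linear_map_wedge_right, of "ext_gen k" u]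
    by (simp add: lookup_sum ext_gen_def wedge_single)
  also have "\<dots> = (\<Sum>K\<in>keys u. if K = M - {k} then
      (if k \<in> M then (- 1) ^ card {b \<in> M. b < k} * lookup u (M - {k}) else 0) else 0)"
    by (intro sum.cong) (auto simp: b)
  also have "\<dots> = (if k \<in> M then (- 1) ^ card {b \<in> M. b < k} * lookup u (M - {k}) else 0)"
    by (auto simp: in_keys_iff)
  finally show ?thesis .
qed

lemma lookup_wedge_vector:
  assumes "M \<subseteq> {..<n}"
  shows "lookup (wedge (ext_vector n c) u) M
    = (\<Sum>k\<in>M. c k * ((- 1) ^ card {b \<in> M. b < k} * lookup u (M - {k})))"
proof -
  have "finite M" using assms finite_subset by blast
  then have "lookup (wedge (ext_vector n c) u) M = (\<Sum>k<n. if k \<in> M then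
      c k * ((- 1) ^ card {b \<in> M. b < k} * lookup u (M - {k})) else 0)"
    unfolding ext_vector_def linear_map_sum [OF linear_map_wedge_left] lookup_sum
    by (intro sum.cong) (simp_all add: wedge_simps lookup_wedge_gen)
  also have "\<dots> = (\<Sum>k\<in>M. c k * ((- 1) ^ card {b \<in> M. b < k} * lookup u (M - {k})))"
    using assms by (simp add: sum.If_cases Int_absorb1)
  finally show ?thesis .
qed

text \<open>Splitting off the first vector is the Laplace expansion along column 0: the smaller
  minors are the coefficients of the remaining product at \<open>K\<close> with one element
  removed.\<close>

lemma lookup_foldr_wedge_det:
  assumes "K \<subseteq> {..<n}" "card K = length js"
  shows "lookup (foldr wedge (map (\<lambda>j. ext_vector n (c j)) js) ext_one) K =
    det (mat (length js) (length js) (\<lambda>(i, l). c (js ! l) (sorted_list_of_set K ! i)))"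
  using assms
proof (induction js arbitrary: K)
  case Nil
  then have "K = {}" using finite_subset by fastforce
  then show ?case by (simp add: ext_one_def det_dim_zero)
next
  case (Cons j js)
  define r where "r = length js"
  define xs where "xs = sorted_list_of_set K"
  define M where "M = mat (Suc r) (Suc r) (\<lambda>(i, l). c ((j # js) ! l) (xs ! i))"
  have fin: "finite K" using Cons.prems finite_subset by blast
  have xs: "set xs = K" "distinct xs" "sorted xs" "length xs = Suc r"
    using fin Cons.prems by (simp_all add: xs_def r_def)
  have bij: "bij_betw ((!) xs) {..<Suc r} K"
    using bij_betw_nth [OF xs(2), of "{..<Suc r}" K] xs by simp
  have less: "xs ! a < xs ! b \<longleftrightarrow> a < b" if "a < Suc r" "b < Suc r" for a b
    using that xs strict_sorted_iff [of xs]
    by (metis sorted_wrt_nth_less linorder_neqE_nat order_less_asym order_less_irrefl)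
  \<comment> \<open>The sign of the wedge product counts the elements of \<open>K\<close> below
    \<open>xs ! i\<close>. There are \<open>i\<close> of them, which is the exponent of the cofactor
    in row \<open>i\<close> and column 0.\<close>
  have less_card: "card {b \<in> K. b < xs ! i} = i" if i: "i < Suc r" for i
  proof -
    have "K = (!) xs ` {..<Suc r}" using bij by (simp add: bij_betw_def)
    then have "{b \<in> K. b < xs ! i} = {b \<in> (!) xs ` {..<Suc r}. b < xs ! i}" by (rule arg_cong)
    also have "\<dots> = (!) xs ` {a. a < Suc r \<and> xs ! a < xs ! i}" by blast
    also have "{a. a < Suc r \<and> xs ! a < xs ! i} = {..<i}" using i less [OF _ i] by fastforce
    finally have "{b \<in> K. b < xs ! i} = (!) xs ` {..<i}" .
    moreover have "inj_on ((!) xs) {..<i}"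
      by (rule inj_on_subset [OF bij_betw_imp_inj_on [OF bij]]) (use i in auto)
    ultimately show ?thesis by (simp add: card_image)
  qed
  have tm: "c j (xs ! i) * ((- 1) ^ card {b \<in> K. b < xs ! i} *
      lookup (foldr wedge (map (\<lambda>j. ext_vector n (c j)) js) ext_one) (K - {xs ! i}))
      = M $$ (i, 0) * cofactor M i 0" if i: "i < Suc r" for i
  proof -
    have ys: "sorted_list_of_set (K - {xs ! i}) = take i xs @ drop (Suc i) xs"
    proof -
      have "sorted_list_of_set (K - {xs ! i}) = remove1 (xs ! i) xs"
        unfolding xs_def by (rule sorted_list_of_set_remove [OF fin])
      also have "\<dots> = take i xs @ drop (Suc i) xs"
      proof -
        have "xs = take i xs @ xs ! i # drop (Suc i) xs" using i xs by (simp add: id_take_nth_drop)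
        moreover have "xs ! i \<notin> set (take i xs)"
          using i xs by (auto simp: in_set_conv_nth nth_eq_iff_index_eq)
        ultimately show ?thesis by (metis remove1_append remove1.simps(2))
      qed
      finally show ?thesis .
    qed
    have "lookup (foldr wedge (map (\<lambda>j. ext_vector n (c j)) js) ext_one) (K - {xs ! i})
        = det (mat r r (\<lambda>(i', l). c (js ! l) (sorted_list_of_set (K - {xs ! i}) ! i')))"
      unfolding r_def using Cons.prems xs i by (intro Cons.IH) auto
    also have "mat r r (\<lambda>(i', l). c (js ! l) (sorted_list_of_set (K - {xs ! i}) ! i'))
      = mat_delete M i 0"
      unfolding ys using i xs by (intro eq_matI) (auto simp: mat_delete_def M_def nth_append)
    finally show ?thesis using i by (simp add: less_card cofactor_def M_def)
  qed
  have "lookup (foldr wedge (map (\<lambda>j. ext_vector n (c j)) (j # js)) ext_one) K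
      = (\<Sum>k\<in>K. c j k * ((- 1) ^ card {b \<in> K. b < k} *
          lookup (foldr wedge (map (\<lambda>j. ext_vector n (c j)) js) ext_one) (K - {k})))"
    using Cons.prems by (simp add: lookup_wedge_vector)
  also have "\<dots> = (\<Sum>i<Suc r. M $$ (i, 0) * cofactor M i 0)"
    by (subst sum.reindex_bij_betw [OF bij, symmetric]) (simp add: tm del: sum.lessThan_Suc)
  also have "\<dots> = det M"
    by (rule laplace_expansion_column [symmetric]) (auto simp: M_def)
  finally show ?case by (simp add: M_def r_def xs_def)
qed

lemma keys_ext_vector: "keys (ext_vector n c) \<subseteq> (\<lambda>k. {k}) ` {..<n}"
  unfolding ext_vector_def
  by (rule order.trans [OF keys_sum_subset]) (use keys_scale
    in \<open>fastforce simp: ext_gen_def split: if_splits\<close>)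

lemma card_keys_ext_act_single:
  assumes "finite J" "K \<in> keys (ext_act g (single J 1))"
  shows "card K = card J"
  using assms
proof (induction J arbitrary: K rule: finite_linorder_min_induct)
  case empty
  then show ?case by (simp flip: ext_one_def) (simp add: ext_one_def)
next
  case (insert k J)
  have "K \<in> keys (wedge (ext_col g k) (ext_act g (single J 1)))"
    using insert by (simp add: ext_act_insert)
  note subsetD [OF keys_wedge this]
  then obtain L M where LM: "K = L \<union> M" "L \<in> keys (ext_col g k)" "M \<in> keys (ext_act g (single J 1))"
      "L \<inter> M = {}"
    by blast
  obtain l where l: "L = {l}" using LM(2) keys_ext_vector by blast
  have "finite M"
    using ext_finite_ext_act_single [OF insert.hyps(1)] LM(3) by (auto simp: ext_finite_def)
  moreover have "k \<notin> J" using insert.hyps by auto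
  ultimately show ?case using insert.IH [OF LM(3)] LM insert.hyps l by simp
qed

lemma ext_act_top:
  assumes "g \<in> carrier_mat n n"
  shows "ext_act g (single {..<n} 1) = single {..<n} (det g)"
proof (rule poly_mapping_eqI)
  fix K
  have l: "sorted_list_of_set {..<n} = [0..<n]"
    by (simp add: lessThan_atLeast0 sorted_list_of_set_range)
  have "lookup (ext_act g (single {..<n} 1)) {..<n} = det g"
  proof -
    have "mat n n (\<lambda>(i, l). g $$ ([0..<n] ! i, [0..<n] ! l)) = g"
      using assms by (intro eq_matI) auto
    then show ?thesis
      using assms lookup_foldr_wedge_det [of "{..<n}" n "[0..<n]" "\<lambda>j k. g $$ (k, j)"]
      by (simp add: ext_act_single l)
  qed
  moreover have "lookup (ext_act g (single {..<n} 1)) K = 0" if "K \<noteq> {..<n}"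
  proof (rule ccontr)
    assume "lookup (ext_act g (single {..<n} 1)) K \<noteq> 0"
    then have K: "K \<in> keys (ext_act g (single {..<n} 1))" by (simp add: in_keys_iff)
    then have "card K = n" using card_keys_ext_act_single by fastforce
    moreover have "K \<subseteq> {..<n}"
      using ext_in_ext_act [OF assms, of "single {..<n} 1"] K by (auto dest: ext_in_keys)
    ultimately show False using that card_subset_eq [of "{..<n}" K] by simp
  qed
  ultimately show "lookup (ext_act g (single {..<n} 1)) K = lookup (single {..<n} (det g)) K"
    by (auto simp: lookup_single when_def)
qed

text \<open>The exterior degree is preserved, so only the top basis vector contributes, and there
  the map is multiplication by the determinant.\<close>

lemma lookup_ext_act_top:
  assumes "g \<in> carrier_mat n n" "ext_in n u"
  shows "lookup (ext_act g u) {..<n} = det g * lookup u {..<n}"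
proof -
  have b: "lookup (ext_act g (single J 1)) {..<n} = (if J = {..<n} then det g else 0)"
    if "J \<subseteq> {..<n}" for J
  proof (cases "J = {..<n}")
    case True
    then show ?thesis using ext_act_top [OF assms(1)] by simp
  next
    case False
    have "{..<n} \<notin> keys (ext_act g (single J 1))"
    proof
      assume "{..<n} \<in> keys (ext_act g (single J 1))"
      then have "card {..<n} = card J"
        using that by (intro card_keys_ext_act_single) (auto intro: finite_subset)
      then show False using False that card_subset_eq [of "{..<n}" J] by (metis finite_lessThan)
    qed
    then show ?thesis using False by (simp add: in_keys_iff)
  qed
  have "lookup (ext_act g u) {..<n} = (\<Sum>J\<in>keys u. lookup u J * (if J = {..<n} then det g else 0))"
    unfolding linear_map_expand [OF linear_map_ext_act, of g u] lookup_sum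
    using ext_in_keys [OF assms(2)] by (intro sum.cong) (simp_all add: b)
  also have "\<dots> = (\<Sum>J\<in>keys u. if J = {..<n} then det g * lookup u {..<n} else 0)"
    by (intro sum.cong) simp_all
  also have "\<dots> = det g * lookup u {..<n}"
    by (auto simp: in_keys_iff)
  finally show ?thesis .
qed

text \<open>Over a domain a matrix with nonzero determinant need not be invertible, but composing
  with its adjugate gives the scalar matrix of \<open>det A\<close>, which multiplies the
  coefficient at \<open>J\<close> by \<open>det A ^ card J\<close>.\<close>

lemma ext_act_inj:
  fixes A :: "'a::idom mat"
  assumes A: "A \<in> carrier_mat n n" "det A \<noteq> 0" and u: "ext_in n u" "ext_act A u = 0"
  shows "u = 0"
proof (rule poly_mapping_eqI)
  fix J
  have "ext_act (adj_mat A * A) u = 0"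
    using ext_act_mult [OF adj_mat(1) [OF A(1)] A(1) u(1)] u(2) by (simp add: ext_act_simps)
  then have "det A ^ card J * lookup u J = 0"
    using lookup_ext_act_smult_one [OF u(1), of "det A" J] by (simp add: adj_mat [OF A(1)])
  then show "lookup u J = lookup 0 J" using A(2) by simp
qed

section \<open>The pairing into the top degree and complementary minors\<close>

abbreviation ext_sign :: "nat \<Rightarrow> nat set \<Rightarrow> 'a::comm_ring_1" where
  "ext_sign n J \<equiv> (- 1) ^ inversions J ({..<n} - J)"

text \<open>Complementary basis vectors are dual up to sign under the pairing into the top degree,
  so wedging with one of them reads off the coefficient at the other.\<close>

lemma wedge_top_left:
  assumes "T \<subseteq> {..<n}"
  shows "lookup (wedge (single T 1) v) {..<n} = ext_sign n T * lookup v ({..<n} - T)"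
proof -
  have b: "lookup (ext_basis_mult T K) {..<n} = (if K = {..<n} - T then ext_sign n T else 0 :: 'a)"
    for K
    using assms by (auto simp: ext_basis_mult_inversions lookup_single when_def)
  have "lookup (wedge (single T 1) v) {..<n}
      = (\<Sum>K\<in>keys v. if K = {..<n} - T then ext_sign n T * lookup v ({..<n} - T) else 0)"
    unfolding linear_map_expand [OF linear_map_wedge_right, of _ v] lookup_sum
    by (intro sum.cong) (auto simp: wedge_single b)
  then show ?thesis by (auto simp: in_keys_iff)
qed

lemma wedge_top_right:
  assumes "J \<subseteq> {..<n}"
  shows "lookup (wedge v (single ({..<n} - J) 1)) {..<n} = ext_sign n J * lookup v J"
proof -
  have b: "lookup (ext_basis_mult K ({..<n} - J)) {..<n} = (if K
    = J then ext_sign n J else 0 :: 'a)" for K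
    using assms by (auto simp: ext_basis_mult_inversions lookup_single when_def)
  have "lookup (wedge v (single ({..<n} - J) 1)) {..<n}
      = (\<Sum>K\<in>keys v. if K = J then ext_sign n J * lookup v J else 0)"
    unfolding linear_map_expand [OF linear_map_wedge_left, of v] lookup_sum
    by (intro sum.cong) (auto simp: wedge_single b)
  then show ?thesis by (auto simp: in_keys_iff)
qed

text \<open>
  The coefficients of \<open>w\<close> are complementary minors of \<open>A\<close>; since \<open>ext_act A\<close> multiplies the pairing
  \<open>(u, v) \<mapsto> lookup (wedge u v) {..<n}\<close> by \<open>det A\<close>, they define its adjoint up to that factor.
\<close>

lemma ext_act_adjoint:
  fixes A :: "'a::idom mat"
  assumes A: "A \<in> carrier_mat n n" "det A \<noteq> 0" and T: "T \<subseteq> {..<n}"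
  defines "w \<equiv> (\<Sum>J\<in>Pow {..<n}. single J (ext_sign n J * ext_sign n T *
    lookup (ext_act A (single ({..<n} - J) 1)) ({..<n} - T)))"
  shows "ext_act A w = single T (det A)"
proof -
  have w_in: "ext_in n w" unfolding w_def by (intro ext_in_sum) simp
  have lookup_w: "lookup w J = ext_sign n J * ext_sign n T *
      lookup (ext_act A (single ({..<n} - J) 1)) ({..<n} - T)" if "J \<subseteq> {..<n}" for J
    using that by (simp add: w_def lookup_sum lookup_single when_def sum.delta')
  have sq: "ext_sign n J * (ext_sign n J * c) = (c :: 'a)" for J c
    by (simp flip: mult.assoc power_add) 
  \<comment> \<open>The coefficients of \<open>w\<close> are chosen to make this adjunction hold on
    basis vectors.\<close>
  have pair_w: "lookup (wedge w v) {..<n} = lookup (wedge (single T 1) (ext_act A v)) {..<n}"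
    if "ext_in n v" for v
  proof -
    have b: "lookup (wedge w (single K 1)) {..<n}
      = lookup (wedge (single T 1) (ext_act A (single K 1))) {..<n}"
      if "K \<subseteq> {..<n}" for K
    proof -
      have K: "{..<n} - ({..<n} - K) = K" using that by auto
      show ?thesis
        using wedge_top_right [of "{..<n} - K" n w] wedge_top_left [OF T, of
          "ext_act A (single K 1)"]
        by (simp add: K lookup_w mult.assoc sq)
    qed
    show ?thesis
      unfolding linear_map_expand [OF linear_map_wedge_right, of w v]
        linear_map_expand [OF linear_map_compose [OF linear_map_wedge_right linear_map_ext_act], of
          _ A v] lookup_sum
      using ext_in_keys [OF that] by (intro sum.cong) (simp_all add: b)
  qed
  \<comment> \<open>The error \<open>d\<close> is first shown to pair to 0 with the image of
    \<open>ext_act A\<close>. By the adjugate this image contains a nonzero multiple of every basis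
    vector, so all coefficients of \<open>d\<close> vanish.\<close>
  define d where "d = ext_act A w - single T (det A)"
  have d_in: "ext_in n d"
    unfolding d_def using A T by (intro ext_in_diff ext_in_ext_act w_in) auto
  have d_pair: "lookup (wedge d (ext_act A v)) {..<n} = 0" if v: "ext_in n v" for v
  proof -
    have "wedge (ext_act A w) (ext_act A v) = ext_act A (wedge w v)"
      by (intro ext_act_wedge [symmetric] ext_in_finite [OF w_in] ext_in_finite [OF v])
    then have "lookup (wedge (ext_act A w) (ext_act A v)) {..<n}
      = det A * lookup (wedge w v) {..<n}"
      using lookup_ext_act_top [OF A(1) ext_in_wedge [OF w_in v]] by simp
    moreover have "lookup (wedge (single T (det A)) (ext_act A v)) {..<n}
        = det A * lookup (wedge (single T 1) (ext_act A v)) {..<n}"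
      using linear_map_scale [OF linear_map_wedge_left, of "det A" "single T 1" "ext_act A v"]
        by simp
    ultimately show ?thesis
      unfolding d_def linear_map_diff [OF linear_map_wedge_left]
      by (simp add: lookup_minus pair_w [OF v])
  qed
  have "lookup d J = 0" if J: "J \<subseteq> {..<n}" for J
  proof -
    define K where "K = {..<n} - J"
    have K: "ext_in n (single K (1 :: 'a))" by (simp add: K_def)
    have "ext_act A (ext_act (adj_mat A) (single K 1)) = single K (det A ^ card K)"
    proof (rule poly_mapping_eqI)
      fix M
      show "lookup (ext_act A (ext_act (adj_mat A) (single K 1))) M
        = lookup (single K (det A ^ card K)) M"
        using lookup_ext_act_smult_one [OF K, of "det A" M]
        unfolding ext_act_mult [OF A(1) adj_mat(1) [OF A(1)] K, symmetric]
        by (simp add: adj_mat [OF A(1)] lookup_single when_def)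
    qed
    then have "lookup (wedge d (single K (det A ^ card K))) {..<n} = 0"
      using d_pair [OF ext_in_ext_act [OF adj_mat(1) [OF A(1)] K]] by simp
    then have "det A ^ card K * (ext_sign n J * lookup d J) = 0"
      using linear_map_scale [OF linear_map_wedge_right, of d "det A ^ card K" "single K 1"]
        wedge_top_right [OF J, of d] by (simp add: K_def)
    then show ?thesis using A(2) by simp
  qed
  moreover have "lookup d J = 0" if "\<not> J \<subseteq> {..<n}" for J
    using that ext_in_keys [OF d_in, of J] by (auto simp: in_keys_iff)
  ultimately have "d = 0" by (intro poly_mapping_eqI) (metis lookup_zero)
  then show ?thesis by (simp add: d_def)
qed

section \<open>Change of the coefficient ring\<close>

abbreviation map_coeffs :: "('a::zero \<Rightarrow> 'c::zero) \<Rightarrow> ('b \<Rightarrow>\<^sub>0 'a) \<Rightarrow> ('b \<Rightarrow>\<^sub>0 'c)" where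
  "map_coeffs \<equiv> Poly_Mapping.map"

context comm_ring_hom
begin

lemma lookup_map_coeffs: "lookup (map_coeffs hom u) b = hom (lookup u b)"
  by (simp add: Poly_Mapping.map.rep_eq when_def)

lemma map_coeffs_add: "map_coeffs hom (u + v) = map_coeffs hom u + map_coeffs hom v"
  by (rule poly_mapping_eqI) (simp add: lookup_map_coeffs lookup_add hom_add)

lemma map_coeffs_scale: "map_coeffs hom (scale c u) = scale (hom c) (map_coeffs hom u)"
  by (rule poly_mapping_eqI) (simp add: lookup_map_coeffs hom_mult)

lemma map_coeffs_single: "map_coeffs hom (single b c) = single b (hom c)"
  by (rule poly_mapping_eqI) (simp add: lookup_map_coeffs lookup_single when_def)

lemma map_coeffs_zero: "map_coeffs hom 0 = 0"
  by (rule poly_mapping_eqI) (simp add: lookup_map_coeffs)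

lemma map_coeffs_sum: "map_coeffs hom (sum f X) = (\<Sum>x\<in>X. map_coeffs hom (f x))"
  by (induction X rule: infinite_finite_induct) (simp_all add: map_coeffs_zero map_coeffs_add)

lemma map_coeffs_expand: "map_coeffs hom u = (\<Sum>b\<in>keys u. scale (hom (lookup u b)) (single b 1))"
  by (subst poly_mapping_expand [of u]) (simp add: map_coeffs_sum map_coeffs_scale map_coeffs_single
      del: scale_single)

lemma map_coeffs_wedge: "map_coeffs hom (wedge u v) = wedge (map_coeffs hom u) (map_coeffs hom v)"
proof -
  have b: "map_coeffs hom (ext_basis_mult J K) = ext_basis_mult J K" for J K
    by (simp add: ext_basis_mult_inversions map_coeffs_single map_coeffs_zero hom_power hom_uminus)
  have "map_coeffs hom (wedge u v) = (\<Sum>J\<in>keys u. \<Sum>K\<in>keys v.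
      scale (hom (lookup u J) * hom (lookup v K)) (ext_basis_mult J K))"
    by (simp add: wedge_def map_coeffs_sum map_coeffs_scale b hom_mult)
  also have "\<dots> = wedge (map_coeffs hom u) (map_coeffs hom v)"
    unfolding map_coeffs_expand linear_map_sum [OF linear_map_wedge_left]
      linear_map_sum [OF linear_map_wedge_right]
    by (subst sum.swap) (simp add: wedge_simps wedge_single scale_sum mult.commute del:
      scale_single)
  finally show ?thesis .
qed

text \<open>The homomorphism occurs in two roles: as the embedding of the field into the
  polynomials, and as the action of a group element on polynomial coefficients. Both commute with
  \<open>ext_act\<close> once the matrix entries are transported as well.\<close>

lemma map_coeffs_ext_act:
  assumes A: "A \<in> carrier_mat n n" and u: "ext_in n u"
  shows "map_coeffs hom (ext_act A u) = ext_act (map_mat hom A) (map_coeffs hom u)"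
proof -
  have col: "map_coeffs hom (ext_col A j) = ext_col (map_mat hom A) j" if "j < n" for j
    using that A unfolding ext_vector_def
    by (auto simp: map_coeffs_sum map_coeffs_scale ext_gen_def map_coeffs_single simp del:
      scale_single
        intro!: sum.cong)
  have b: "map_coeffs hom (ext_act A (single J 1)) = ext_act (map_mat hom A) (single J 1)"
    if "J \<subseteq> {..<n}" for J
  proof -
    have "finite J" using that finite_subset by blast
    then show ?thesis using that
    proof (induction J rule: finite_linorder_min_induct)
      case empty
      then show ?case by (simp add: ext_one_def ext_act_single map_coeffs_single)
    next
      case (insert k K)
      then show ?case using col [of k] by (simp add: ext_act_insert map_coeffs_wedge)
    qed
  qed
  have "map_coeffs hom (ext_act A u) = (\<Sum>J\<in>keys u. scale (hom (lookup u J)) (ext_act (map_mat hom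
    A) (single J 1)))"
    unfolding linear_map_expand [OF linear_map_ext_act, of A u]
    using ext_in_keys [OF u] by (simp add: map_coeffs_sum map_coeffs_scale b)
  also have "\<dots> = ext_act (map_mat hom A) (map_coeffs hom u)"
    unfolding map_coeffs_expand by (simp add: linear_map_sum [OF linear_map_ext_act] ext_act_simps
        del: scale_single)
  finally show ?thesis .
qed

lemma ext_in_map_coeffs: "ext_in n u \<Longrightarrow> ext_in n (map_coeffs hom u)"
  unfolding ext_in_def by (rule order.trans) (auto simp: in_keys_iff lookup_map_coeffs)

end

section \<open>Leading monomials\<close>

definition mono_less :: "(nat \<Rightarrow>\<^sub>0 nat) \<Rightarrow> (nat \<Rightarrow>\<^sub>0 nat) \<Rightarrow> bool" (infix \<open>\<prec>\<close> 50) where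
  "a \<prec> b \<longleftrightarrow> (\<exists>i. lookup a i < lookup b i \<and> (\<forall>j>i. lookup a j = lookup b j))"

lemma mono_less_irrefl [simp]: "\<not> a \<prec> a"
  by (simp add: mono_less_def)

lemma mono_less_trans: "a \<prec> b \<Longrightarrow> b \<prec> c \<Longrightarrow> a \<prec> c"
proof -
  assume "a \<prec> b" "b \<prec> c"
  then obtain i j where i: "lookup a i < lookup b i" "\<forall>k>i. lookup a k = lookup b k"
    and j: "lookup b j < lookup c j" "\<forall>k>j. lookup b k = lookup c k"
    by (auto simp: mono_less_def)
  show "a \<prec> c"
    unfolding mono_less_def
  proof (intro exI [of _ "max i j"] conjI allI impI)
    show "lookup a (max i j) < lookup c (max i j)"
      using i j by (cases i j rule: linorder_cases) (auto simp: max_def)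
    show "lookup a k = lookup c k" if "max i j < k" for k
      using that i j by simp
  qed
qed

lemma mono_less_total: "a \<noteq> b \<Longrightarrow> a \<prec> b \<or> b \<prec> a"
proof -
  assume "a \<noteq> b"
  define D where "D = {i. lookup a i \<noteq> lookup b i}"
  have "D \<subseteq> keys a \<union> keys b" by (auto simp: D_def in_keys_iff)
  then have fin: "finite D" by (rule finite_subset) simp
  have "D \<noteq> {}" using \<open>a \<noteq> b\<close> poly_mapping_eqI [of a b] unfolding D_def by blast
  with fin have "Max D \<in> D" by simp
  moreover have "lookup a k = lookup b k" if "Max D < k" for k
    using that fin Max_ge [of D k] unfolding D_def by (metis (mono_tags) leD mem_Collect_eq)
  moreover have "lookup a (Max D) < lookup b (Max D) \<or> lookup b (Max D) < lookup a (Max D)"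
    using \<open>Max D \<in> D\<close> unfolding D_def by (simp add: neq_iff)
  ultimately show ?thesis
    unfolding mono_less_def by metis
qed

lemma mono_less_add_mono: "a \<prec> b \<Longrightarrow> a + c \<prec> b + c"
  by (auto simp: mono_less_def lookup_add)

lemma mono_less_add_strict: "a \<prec> b \<Longrightarrow> c \<prec> d \<Longrightarrow> a + c \<prec> b + d"
  using mono_less_trans [of "a + c" "b + c" "b + d"] mono_less_add_mono [of a b c]
    mono_less_add_mono [of c d b]
  by (simp add: add.commute)

text \<open>A relation, so that the zero polynomial simply has no leading exponent; the leading
  coefficient may be any nonzero scalar.\<close>

definition is_lead :: "'a::zero sym_alg \<Rightarrow> (nat \<Rightarrow>\<^sub>0 nat) \<Rightarrow> bool" where
  "is_lead f a \<longleftrightarrow> a \<in> keys f \<and> (\<forall>b\<in>keys f. b \<noteq> a \<longrightarrow> b \<prec> a)"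

lemma is_lead_nonzero: "is_lead f a \<Longrightarrow> f \<noteq> 0"
  by (auto simp: is_lead_def)

lemma is_lead_lookup: "is_lead f a \<Longrightarrow> lookup f a \<noteq> 0"
  by (auto simp: is_lead_def in_keys_iff)

lemma is_lead_greater: "is_lead f a \<Longrightarrow> a \<prec> b \<Longrightarrow> lookup f b = 0"
  unfolding is_lead_def by (metis in_keys_iff mono_less_irrefl mono_less_trans)

lemma is_lead_unique: "is_lead f a \<Longrightarrow> is_lead f b \<Longrightarrow> a = b"
  unfolding is_lead_def by (metis mono_less_irrefl mono_less_trans)

lemma mono_less_max:
  assumes "finite A" "A \<noteq> {}"
  shows "\<exists>a\<in>A. \<forall>b\<in>A. b \<noteq> a \<longrightarrow> b \<prec> a"
  using assms
proof (induction A rule: finite_ne_induct)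
  case (insert x A)
  then obtain a where a: "a \<in> A" "\<forall>b\<in>A. b \<noteq> a \<longrightarrow> b \<prec> a" by blast
  show ?case
  proof (cases "x \<prec> a")
    case True
    then show ?thesis using a by blast
  next
    case False
    moreover have "x \<noteq> a" using insert.hyps a by blast
    ultimately have "a \<prec> x" using mono_less_total by blast
    then have "b \<prec> x" if "b \<in> A" for b using a(2) mono_less_trans [of b a x] that
      by (cases "b = a") auto
    then show ?thesis by blast
  qed
qed simp

lemma is_lead_exists: "f \<noteq> 0 \<Longrightarrow> \<exists>a. is_lead f a"
  using mono_less_max [of "keys f"] unfolding is_lead_def by (metis finite_keys keys_eq_empty)

lemma lookup_times:
  fixes f g :: "('b::comm_monoid_add) \<Rightarrow>\<^sub>0 'a::comm_semiring_1"
  shows "lookup (f * g) c = (\<Sum>(a, b)\<in>{(a, b). a \<in> keys f \<and> b \<in> keys g \<and>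
    a + b = c}. lookup f a * lookup g b)"
proof -
  have f: "f = (\<Sum>a\<in>keys f. single a (lookup f a))" for f :: "'b \<Rightarrow>\<^sub>0 'a"
    by (rule poly_mapping_eqI) (auto simp: lookup_sum lookup_single when_def in_keys_iff sum.delta')
  have "f * g = (\<Sum>a\<in>keys f. \<Sum>b\<in>keys g. single (a + b) (lookup f a * lookup g b))"
    by (subst f, subst (2) f) (simp add: sum_product mult_single)
  also have "\<dots> = (\<Sum>(a, b)\<in>keys f \<times> keys g. single (a + b) (lookup f a * lookup g b))"
    by (simp add: sum.cartesian_product)
  finally have "lookup (f * g) c = (\<Sum>(a, b)\<in>keys f \<times> keys g. if a + b
    = c then lookup f a * lookup g b else 0)"
    by (simp add: lookup_sum lookup_single when_def case_prod_unfold)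
  also have "\<dots> = (\<Sum>(a, b)\<in>{(a, b). a \<in> keys f \<and> b \<in> keys g \<and> a + b = c}. lookup f a * lookup g b)"
    by (rule sum.mono_neutral_cong_right) (auto split: if_splits)
  finally show ?thesis .
qed

lemma is_lead_mult:
  fixes f g :: "'a::idom sym_alg"
  assumes f: "is_lead f a" and g: "is_lead g b"
  shows "is_lead (f * g) (a + b)"
proof -
  have less: "c + d \<prec> a + b" if "c \<in> keys f" "d \<in> keys g" "c \<noteq> a \<or> d \<noteq> b" for c d
    using that f g mono_less_add_strict mono_less_add_mono [of c a b] mono_less_add_mono [of d b a]
    unfolding is_lead_def by (metis add.commute)
  have "{(c, d). c \<in> keys f \<and> d \<in> keys g \<and> c + d = a + b} = {(a, b)}"
    using f g less unfolding is_lead_def by (auto; metis mono_less_irrefl)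
  then have "lookup (f * g) (a + b) = lookup f a * lookup g b"
    by (simp add: lookup_times)
  moreover have "c \<prec> a + b" if c: "c \<in> keys (f * g)" "c \<noteq> a + b" for c
  proof -
    obtain u v where "u \<in> keys f" "v \<in> keys g" "c = u + v"
      using keys_mult [of f g] c(1) by blast
    then show ?thesis using less [of u v] c(2) by auto
  qed
  ultimately show ?thesis
    using is_lead_lookup [OF f] is_lead_lookup [OF g] by (simp add: is_lead_def in_keys_iff)
qed

lemma is_lead_single: "c \<noteq> 0 \<Longrightarrow> is_lead (single a c) a"
  by (simp add: is_lead_def)

lemma is_lead_one: "is_lead (1 :: 'a::idom sym_alg) 0"
  using is_lead_single [of "1 :: 'a" 0] by simp

definition mono_scale :: "nat \<Rightarrow> (nat \<Rightarrow>\<^sub>0 nat) \<Rightarrow> (nat \<Rightarrow>\<^sub>0 nat)" where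
  "mono_scale i a = Poly_Mapping.map ((*) i) a"

lemma lookup_mono_scale [simp]: "lookup (mono_scale i a) j = i * lookup a j"
  by (simp add: mono_scale_def Poly_Mapping.map.rep_eq when_def)

lemma is_lead_power:
  fixes f :: "'a::idom sym_alg"
  assumes "is_lead f a"
  shows "is_lead (f ^ i) (mono_scale i a)"
proof (induction i)
  case 0
  have "mono_scale 0 a = 0" by (rule poly_mapping_eqI) simp
  then show ?case by (simp add: is_lead_one)
next
  case (Suc i)
  have "mono_scale (Suc i) a = a + mono_scale i a" by (rule poly_mapping_eqI) (simp add: lookup_add)
  then show ?case using is_lead_mult [OF assms Suc] by simp
qed

lemma is_lead_prod:
  fixes f :: "'b \<Rightarrow> 'a::idom sym_alg"
  assumes "\<And>x. x \<in> X \<Longrightarrow> is_lead (f x) (a x)"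
  shows "is_lead (prod f X) (sum a X)"
  using assms by (induction X rule: infinite_finite_induct) (simp_all add: is_lead_one is_lead_mult)

lemma is_lead_add:
  fixes f g :: "'a::comm_monoid_add sym_alg"
  assumes "is_lead f a" "\<And>b. b \<in> keys g \<Longrightarrow> b \<prec> a"
  shows "is_lead (f + g) a"
proof -
  have "lookup g a = 0" using assms(2) [of a] by (auto simp: in_keys_iff)
  then have "a \<in> keys (f + g)" using assms(1) by (simp add: is_lead_def in_keys_iff lookup_add)
  moreover have "b \<prec> a" if "b \<in> keys (f + g)" "b \<noteq> a" for b
    using that assms keys_add [of f g] unfolding is_lead_def by blast
  ultimately show ?thesis by (simp add: is_lead_def)
qed

lemma is_lead_keys_less: "is_lead g b \<Longrightarrow> b \<prec> a \<Longrightarrow> c \<in> keys g \<Longrightarrow> c \<prec> a"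
  unfolding is_lead_def by (metis mono_less_trans)

lemma is_lead_uminus: "is_lead (- f :: 'a::idom sym_alg) a \<longleftrightarrow> is_lead f a"
  by (simp add: is_lead_def)

text \<open>Distinct leading exponents cannot cancel, so the largest of them survives. The
  comparison with the other summands is kept in the conclusion because a bound is later drawn from a
  summand that need not be the largest.\<close>

lemma is_lead_sum:
  fixes t :: "'b \<Rightarrow> 'a::comm_monoid_add sym_alg"
  assumes "finite B" "B \<noteq> {}" "\<And>b. b \<in> B \<Longrightarrow> is_lead (t b) (l b)" "inj_on l B"
  shows "\<exists>b\<in>B. is_lead (sum t B) (l b) \<and> (\<forall>c\<in>B. c \<noteq> b \<longrightarrow> l c \<prec> l b)"
proof -
  obtain b where b: "b \<in> B" "\<forall>c\<in>l ` B. c \<noteq> l b \<longrightarrow> c \<prec> l b"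
    using mono_less_max [of "l ` B"] assms(1,2) by blast
  have less: "l c \<prec> l b" if "c \<in> B" "c \<noteq> b" for c
    using b that assms(4) by (meson image_eqI inj_onD)
  have "c \<prec> l b" if c: "c \<in> keys (sum t (B - {b}))" for c
  proof -
    obtain d where "d \<in> B - {b}" "c \<in> keys (t d)"
      using subsetD [OF keys_sum_subset c] by blast
    then show ?thesis using is_lead_keys_less [OF assms(3) [of d] less [of d]] by blast
  qed
  then have "is_lead (t b + sum t (B - {b})) (l b)"
    by (rule is_lead_add [OF assms(3) [OF b(1)]])
  then have "is_lead (sum t B) (l b)"
    using assms(1) b(1) by (simp add: sum.remove)
  with b(1) less show ?thesis by blast
qed

section \<open>Homogeneous polynomials and polynomials in a set of variables\<close>

lemma monomial_degree_superset:
  "finite X \<Longrightarrow> keys m \<subseteq> X \<Longrightarrow> monomial_degree m = (\<Sum>j\<in>X. lookup m j)"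
  unfolding monomial_degree_def by (intro sum.mono_neutral_left) (auto simp: in_keys_iff)

lemma monomial_degree_add: "monomial_degree (a + b) = monomial_degree a + monomial_degree b"
  using keys_add [of a b]
  by (simp add: monomial_degree_superset [of "keys a \<union> keys b"] lookup_add sum.distrib)

lemma monomial_degree_single [simp]: "monomial_degree (single j i) = i"
  by (simp add: monomial_degree_def)

lemma monomial_degree_zero [simp]: "monomial_degree 0 = 0"
  by (simp add: monomial_degree_def)

definition homog :: "nat \<Rightarrow> 'a::zero sym_alg \<Rightarrow> bool" where
  "homog d f \<longleftrightarrow> (\<forall>m\<in>keys f. monomial_degree m = d)"

definition vars_in :: "nat set \<Rightarrow> 'a::zero sym_alg \<Rightarrow> bool" where
  "vars_in X f \<longleftrightarrow> (\<forall>m\<in>keys f. keys m \<subseteq> X)"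

lemma homog_zero [simp]: "homog d 0" and vars_in_zero [simp]: "vars_in X 0"
  by (simp_all add: homog_def vars_in_def)

lemma homog_const [simp]: "homog 0 (single 0 c)" and vars_in_const [simp]: "vars_in X (single 0 c)"
  by (simp_all add: homog_def vars_in_def)

lemma homog_one [simp]: "homog 0 (1 :: 'a::comm_semiring_1 sym_alg)"
  and vars_in_one [simp]: "vars_in X (1 :: 'a::comm_semiring_1 sym_alg)"
  by (simp_all flip: single_one)

lemma homog_gen [simp]: "homog 1 (sym_gen j)"
  by (simp add: homog_def sym_gen_def)

lemma vars_in_gen [simp]: "vars_in X (sym_gen j :: 'a::comm_semiring_1 sym_alg) \<longleftrightarrow> j \<in> X"
  by (simp add: vars_in_def sym_gen_def)

lemma homog_add: "homog d f \<Longrightarrow> homog d g \<Longrightarrow> homog d (f + g)"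
  and vars_in_add: "vars_in X f \<Longrightarrow> vars_in X g \<Longrightarrow> vars_in X (f + g)"
  for f g :: "'a::comm_monoid_add sym_alg"
  using keys_add [of f g] unfolding homog_def vars_in_def by blast+

lemma homog_uminus: "homog d (- f) \<longleftrightarrow> homog d f" and vars_in_uminus: "vars_in X (- f) \<longleftrightarrow> vars_in X f"
  for f :: "'a::ab_group_add sym_alg"
  by (simp_all add: homog_def vars_in_def in_keys_iff)

lemma homog_diff: "homog d f \<Longrightarrow> homog d g \<Longrightarrow> homog d (f - g)"
  and vars_in_diff: "vars_in X f \<Longrightarrow> vars_in X g \<Longrightarrow> vars_in X (f - g)"
  for f g :: "'a::ab_group_add sym_alg"
  using homog_add [of d f "- g"] vars_in_add [of X f "- g"]
    by (simp_all add: homog_uminus vars_in_uminus)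

lemma homog_sum: "(\<And>x. x \<in> B \<Longrightarrow> homog d (f x)) \<Longrightarrow> homog d (sum f B)"
  and vars_in_sum: "(\<And>x. x \<in> B \<Longrightarrow> vars_in X (f x)) \<Longrightarrow> vars_in X (sum f B)"
  for f :: "'b \<Rightarrow> 'a::comm_monoid_add sym_alg"
  by (induction B rule: infinite_finite_induct) (simp_all add: homog_add vars_in_add)

lemma homog_mult: "homog d f \<Longrightarrow> homog e g \<Longrightarrow> homog (d + e) (f * g)"
  for f g :: "'a::comm_semiring_1 sym_alg"
  using keys_mult [of f g] unfolding homog_def by (fastforce simp: monomial_degree_add)

lemma vars_in_mult:
  fixes f g :: "'a::comm_semiring_1 sym_alg"
  assumes "vars_in X f" "vars_in X g"
  shows "vars_in X (f * g)"
  unfolding vars_in_def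
proof
  fix m assume "m \<in> keys (f * g)"
  then obtain a b where "m = a + b" "a \<in> keys f" "b \<in> keys g" using keys_mult by blast
  then show "keys m \<subseteq> X" using keys_add [of a b] assms unfolding vars_in_def by blast
qed

lemma homog_power: "homog d f \<Longrightarrow> homog (d * i) (f ^ i)"
  and vars_in_power: "vars_in X f \<Longrightarrow> vars_in X (f ^ i)"
  for f :: "'a::comm_semiring_1 sym_alg"
  by (induction i) (simp_all add: homog_mult vars_in_mult)

lemma homog_prod: "(\<And>x. x \<in> B \<Longrightarrow> homog (d x) (f x)) \<Longrightarrow> homog (sum d B) (prod f B)"
  and vars_in_prod: "(\<And>x. x \<in> B \<Longrightarrow> vars_in X (f x)) \<Longrightarrow> vars_in X (prod f B)"
  for f :: "'b \<Rightarrow> 'a::comm_semiring_1 sym_alg"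
  by (induction B rule: infinite_finite_induct) (simp_all add: homog_mult vars_in_mult)

lemma vars_in_scale: "vars_in X f \<Longrightarrow> vars_in X (scale c f)"
  using keys_scale [of c f] unfolding vars_in_def by blast

lemma vars_in_mono: "vars_in X f \<Longrightarrow> X \<subseteq> Y \<Longrightarrow> vars_in Y f"
  unfolding vars_in_def by blast

section \<open>Substitutions\<close>

text \<open>The action of a matrix, the translation of one variable and the exchange of two
  variables are all instances.\<close>

definition subst :: "(nat \<Rightarrow> 'a sym_alg) \<Rightarrow> 'a::comm_ring_1 sym_alg \<Rightarrow> 'a sym_alg" where
  "subst y = linear_extend (\<lambda>m. \<Prod>j\<in>keys m. y j ^ lookup m j)"

lemma sym_act_subst: "sym_act g = subst (\<lambda>j. \<Sum>k<dim_row g. scale (g $$ (k, j)) (sym_gen k))"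
  by (simp add: sym_act_def subst_def)

lemma scale_conv_mult: "scale c f = single 0 c * (f :: 'a::comm_semiring_1 sym_alg)"
  by (simp add: scale_def mult_map_scale_conv_mult)

lemma const_hom: "comm_ring_hom (\<lambda>c. single 0 c :: 'a::comm_ring_1 sym_alg)"
  by unfold_locales (simp_all add: single_add mult_single)

lemma const_power: "single 0 c ^ i = (single 0 (c ^ i) :: 'a::comm_ring_1 sym_alg)"
  by (induction i) (simp_all add: mult_single)

lemma sym_gen_power: "sym_gen j ^ i = (single (single j i) 1 :: 'a::comm_semiring_1 sym_alg)"
  by (induction i) (simp_all add: sym_gen_def mult_single flip: single_add)

lemma prod_single:
  "(\<Prod>j\<in>X. single (a j) 1 :: 'a::comm_semiring_1 sym_alg) = single (sum a X) 1"
  by (induction X rule: infinite_finite_induct) (simp_all add: mult_single)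

lemma monomial_prod:
  "(single m 1 :: 'a::comm_semiring_1 sym_alg) = (\<Prod>j\<in>keys m. sym_gen j ^ lookup m j)"
proof -
  have "(\<Sum>j\<in>keys m. single j (lookup m j)) = m"
    by (rule poly_mapping_eqI) (auto simp: lookup_sum lookup_single when_def in_keys_iff sum.delta')
  then show ?thesis by (simp add: sym_gen_power prod_single)
qed

lemma hom_sym_alg_expand:
  fixes \<phi> :: "'a::comm_ring_1 sym_alg \<Rightarrow> 'b::comm_ring_1"
  assumes "comm_ring_hom \<phi>"
  shows "\<phi> f = (\<Sum>m\<in>keys f. \<phi> (single 0 (lookup f m)) * (\<Prod>j\<in>keys m. \<phi> (sym_gen j) ^ lookup m j))"
proof -
  interpret comm_ring_hom \<phi> by fact
  have "f = (\<Sum>m\<in>keys f. single 0 (lookup f m) * (\<Prod>j\<in>keys m. sym_gen j ^ lookup m j))"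
    by (subst poly_mapping_expand [of f]) (simp add: scale_conv_mult flip: monomial_prod)
  then have "\<phi> f = \<phi> (\<Sum>m\<in>keys f. single 0 (lookup f m) * (\<Prod>j\<in>keys m. sym_gen j ^ lookup m j))"
    by (rule arg_cong)
  then show ?thesis by (simp only: hom_sum hom_mult hom_prod hom_power)
qed

lemma hom_sym_alg_eqI:
  fixes \<phi> \<psi> :: "'a::comm_ring_1 sym_alg \<Rightarrow> 'b::comm_ring_1"
  assumes "comm_ring_hom \<phi>" "comm_ring_hom \<psi>" "vars_in X f"
    "\<And>c. \<phi> (single 0 c) = \<psi> (single 0 c)" "\<And>j. j \<in> X \<Longrightarrow> \<phi> (sym_gen j) = \<psi> (sym_gen j)"
  shows "\<phi> f = \<psi> f"
  unfolding hom_sym_alg_expand [OF assms(1), of f] hom_sym_alg_expand [OF assms(2), of f]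
proof (intro sum.cong refl)
  fix m assume "m \<in> keys f"
  then have "keys m \<subseteq> X" using assms(3) by (simp add: vars_in_def)
  then show "\<phi> (single 0 (lookup f m)) * (\<Prod>j\<in>keys m. \<phi> (sym_gen j) ^ lookup m j)
      = \<psi> (single 0 (lookup f m)) * (\<Prod>j\<in>keys m. \<psi> (sym_gen j) ^ lookup m j)"
    using assms(4,5) by (intro arg_cong2 [of _ _ _ _ times] prod.cong refl) auto
qed

lemma linear_map_subst: "linear_map (subst y)"
  unfolding subst_def by (rule linear_map_linear_extend)

lemma subst_const [simp]: "subst y (single 0 c) = single 0 c"
  by (simp add: subst_def) (simp flip: single_one)

text \<open>The product \<open>E\<close> over the keys of an exponent vector can be taken over any
  larger finite set; over a common set it turns sums of exponent vectors into products.\<close>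

lemma subst_hom: "comm_ring_hom (subst y)"
proof -
  define E where "E m = (\<Prod>j\<in>keys m. y j ^ lookup m j)" for m
  have E: "E m = (\<Prod>j\<in>X. y j ^ lookup m j)" if "finite X" "keys m \<subseteq> X" for X m
    unfolding E_def using that by (intro prod.mono_neutral_left) (auto simp: in_keys_iff)
  have E_add: "E (a + b) = E a * E b" for a b
    using keys_add [of a b]
    by (simp add: E [of "keys a \<union> keys b"] lookup_add power_add prod.distrib)
  have sub: "subst y (single m 1) = E m" for m by (simp add: subst_def E_def)
  have mult: "subst y (f * g) = subst y f * subst y g" for f g
  proof -
    have "f * g = (\<Sum>a\<in>keys f. \<Sum>b\<in>keys g. scale (lookup f a * lookup g b) (single (a + b) 1))"
      by (subst poly_mapping_expand [of f], subst poly_mapping_expand [of g])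
        (simp add: sum_product mult_single)
    moreover have "subst y f * subst y g
        = (\<Sum>a\<in>keys f. \<Sum>b\<in>keys g. scale (lookup f a * lookup g b) (E (a + b)))"
      unfolding linear_map_expand [OF linear_map_subst, of y f] linear_map_expand [OF
        linear_map_subst, of y g]
      by (simp add: sum_product sub E_add scale_conv_mult mult_single flip: mult.assoc)
        (simp add: mult_ac mult_single)
    ultimately show ?thesis
      by (simp only: linear_map_sum [OF linear_map_subst] linear_map_scale [OF linear_map_subst]
        sub)
  qed
  have "subst y 1 = 1" using subst_const [of y 1] by simp
  then show ?thesis
    using linear_map_add [OF linear_map_subst] linear_map_zero [OF linear_map_subst] mult
    by unfold_locales auto
qed

interpretation subst: comm_ring_hom "subst y" by (rule subst_hom)

lemma subst_scale: "subst y (scale c f) = scale c (subst y f)"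
  by (rule linear_map_scale [OF linear_map_subst])

lemma subst_gen [simp]: "subst y (sym_gen j) = y j"
  by (simp add: sym_gen_def subst_def)

lemma subst_cong:
  assumes "vars_in X f" "\<And>j. j \<in> X \<Longrightarrow> y j = z j"
  shows "subst y f = subst z f"
  by (rule hom_sym_alg_eqI [OF subst_hom subst_hom assms(1)]) (simp_all add: assms(2))

lemma comm_ring_hom_compose:
  assumes "comm_ring_hom \<phi>" "comm_ring_hom \<psi>"
  shows "comm_ring_hom (\<lambda>x. \<phi> (\<psi> x))"
proof -
  interpret a: comm_ring_hom \<phi> by fact
  interpret b: comm_ring_hom \<psi> by fact
  show ?thesis by unfold_locales (simp_all add: a.hom_add b.hom_add a.hom_mult b.hom_mult)
qed

lemma subst_subst: "subst y (subst z f) = subst (\<lambda>j. subst y (z j)) f"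
  by (rule hom_sym_alg_eqI [OF comm_ring_hom_compose [OF subst_hom subst_hom] subst_hom,
        of UNIV]) (simp_all add: vars_in_def)

lemma subst_id:
  assumes "vars_in X f" "\<And>j. j \<in> X \<Longrightarrow> y j = sym_gen j"
  shows "subst y f = f"
proof -
  have "comm_ring_hom (\<lambda>f :: 'a sym_alg. f)" by unfold_locales auto
  then show ?thesis
    by (rule hom_sym_alg_eqI [OF subst_hom _ assms(1)]) (simp_all add: assms(2))
qed

section \<open>Polynomials invariant under a finite group of translations\<close>

definition translation_poly :: "'a::idom set \<Rightarrow> 'a poly" where
  "translation_poly W = (\<Prod>w\<in>W. [:- w, 1:])"

lemma degree_translation_poly: "degree (translation_poly W) = card W"
  unfolding translation_poly_def
  by (cases "finite W") (simp_all add: degree_prod_eq_sum_degree)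

lemma lead_coeff_translation_poly: "lead_coeff (translation_poly W) = 1"
  unfolding translation_poly_def by (simp add: lead_coeff_prod)

lemma poly_translation_poly_eq_0_iff: "finite W \<Longrightarrow> poly (translation_poly W) x = 0 \<longleftrightarrow> x \<in> W"
  by (simp add: translation_poly_def poly_prod eq_neg_iff_add_eq_0 [symmetric])

lemma translation_poly_dvd:
  assumes "finite W" "\<And>w. w \<in> W \<Longrightarrow> poly p w = 0"
  shows "translation_poly W dvd p"
  using assms
proof (induction W arbitrary: p rule: finite_induct)
  case (insert w W)
  then obtain r where r: "p = [:- w, 1:] * r" using poly_eq_0_iff_dvd by blast
  have "poly r v = 0" if "v \<in> W" for v
    using insert.prems [of v] insert.hyps that unfolding r by auto
  then show ?case using insert.IH [of r] insert.hyps
    unfolding r by (simp add: translation_poly_def mult_dvd_mono del: mult_pCons_left)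
qed (simp add: translation_poly_def)

lemma poly_eq_of_many_roots:
  fixes p p' :: "'a::idom poly"
  assumes "finite W" "\<And>w. w \<in> W \<Longrightarrow> poly p w = poly p' w" "degree (p - p') < card W"
  shows "p = p'"
proof (rule ccontr)
  assume "p \<noteq> p'"
  then have "finite {x. poly (p - p') x = 0}" "card {x. poly (p - p') x = 0} \<le> degree (p - p')"
    using poly_roots_finite [of "p - p'"] card_poly_roots_bound [of "p - p'"] by simp_all
  moreover have "W \<subseteq> {x. poly (p - p') x = 0}" using assms(2) by auto
  ultimately have "card W \<le> degree (p - p')" using card_mono order.trans by blast
  then show False using assms(3) by simp
qed

lemma pcompose_translation_poly:
  assumes "finite W" "w \<in> W" "\<And>v. v \<in> W \<Longrightarrow> v + w \<in> W"
  shows "pcompose (translation_poly W) [:w, 1:] = translation_poly W"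
proof -
  have "(\<lambda>v. v + w) ` W \<subseteq> W" using assms(3) by auto
  then have "bij_betw (\<lambda>v. v + w) W W"
    using assms(1) by (auto simp: bij_betw_def endo_inj_surj)
  then have "translation_poly W = (\<Prod>v\<in>W. [:- (v + w), 1:])"
    unfolding translation_poly_def by (rule prod.reindex_bij_betw [symmetric])
  then have "pcompose (translation_poly W) [:w, 1:] = (\<Prod>v\<in>W. [:- v, 1:])"
    by (simp add: pcompose_prod pcompose_pCons)
  then show ?thesis by (simp add: translation_poly_def)
qed

text \<open>Comparing coefficients at \<open>i + degree p\<close> expresses \<open>coeff q i\<close>
  by a coefficient of the product and by higher coefficients of \<open>q\<close>, without division
  since \<open>p\<close> is monic. The set \<open>A\<close> will consist of the polynomials free of
  one variable, so that the quotient does not bring this variable back.\<close>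

lemma coeff_cofactor_of_monic:
  fixes p q :: "'a::comm_ring_1 poly"
  assumes A: "0 \<in> A" "\<And>x y. x \<in> A \<Longrightarrow> y \<in> A \<Longrightarrow> x - y \<in> A" "\<And>x y. x \<in> A \<Longrightarrow> y \<in> A \<Longrightarrow> x * y \<in> A"
    and p: "lead_coeff p = 1" "\<And>i. coeff p i \<in> A" and pq: "\<And>i. coeff (p * q) i \<in> A"
  shows "coeff q i \<in> A"
proof (induction "Suc (degree q) - i" arbitrary: i rule: less_induct)
  case less
  show ?case
  proof (cases "i \<le> degree q")
    case False
    then show ?thesis using A(1) by (simp add: coeff_eq_0)
  next
    case True
    define d where "d = degree p"
    have diff: "x - sum f X \<in> A" if "x \<in> A" "\<And>k. k \<in> X \<Longrightarrow> f k \<in> A" for x X and f :: "nat \<Rightarrow> 'a"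
      using that
    proof (induction X arbitrary: x rule: infinite_finite_induct)
      case (insert k X)
      then have "x - f k - sum f X \<in> A" using A(2) by blast
      then show ?case using insert.hyps by (simp add: diff_diff_eq)
    qed simp_all
    have "coeff (p * q) (i + d) = (\<Sum>k\<le>i + d. coeff p k * coeff q (i + d - k))"
      by (simp add: coeff_mult)
    also have "\<dots> = (\<Sum>k\<le>d. coeff p k * coeff q (i + d - k))"
      by (rule sum.mono_neutral_right) (auto simp: d_def coeff_eq_0)
    also have "\<dots> = coeff q i + (\<Sum>k<d. coeff p k * coeff q (i + d - k))"
      using p(1) by (simp add: lessThan_Suc_atMost [symmetric] d_def)
    finally have "coeff q i = coeff (p * q) (i + d) - (\<Sum>k<d. coeff p k * coeff q (i + d - k))"
      by simp
    also have "\<dots> \<in> A"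
      using True by (intro diff pq A(3) p(2) less) auto
    finally show ?thesis .
  qed
qed

text \<open>Repeated division by the monic invariant polynomial that vanishes on \<open>W\<close>.\<close>

lemma translation_invariant_expansion:
  fixes p :: "'a::idom poly"
  assumes W: "finite W" "0 \<in> W" "\<And>v w. v \<in> W \<Longrightarrow> w \<in> W \<Longrightarrow> v + w \<in> W"
    and A: "0 \<in> A" "\<And>x y. x \<in> A \<Longrightarrow> y \<in> A \<Longrightarrow> x - y \<in> A" "\<And>x y. x \<in> A \<Longrightarrow> y \<in> A \<Longrightarrow> x * y \<in> A"
      "\<And>i. coeff (translation_poly W) i \<in> A"
    and p: "\<And>i. coeff p i \<in> A" "\<And>w. w \<in> W \<Longrightarrow> pcompose p [:w, 1:] = p"
  shows "\<exists>B r. p = (\<Sum>b<B. [:r b:] * translation_poly W ^ b) \<and> (\<forall>b<B. r b \<in> A)"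
  using p
proof (induction "degree p" arbitrary: p rule: less_induct)
  case less
  show ?case
  proof (cases "degree p = 0")
    case True
    then obtain c where c: "p = [:c:]" using degree_eq_zeroE by blast
    have "p = (\<Sum>b<1. [:poly p 0:] * translation_poly W ^ b) \<and> (\<forall>b<1::nat. poly p 0 \<in> A)"
      using less.prems(1) [of 0] by (simp add: c)
    then show ?thesis by (intro exI [of _ 1] exI [of _ "\<lambda>_. poly p 0"])
  next
    case False
    define T where "T = translation_poly W"
    have T: "degree T = card W" "T \<noteq> 0" "card W > 0"
      using W(1,2) lead_coeff_translation_poly [of W]
        by (auto simp: T_def degree_translation_poly card_gt_0_iff)
    \<comment> \<open>Evaluating the invariance under translation by \<open>w\<close> at 0 shows
      that \<open>p\<close> is constant on \<open>W\<close>, so \<open>p\<close> minus this constant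
      vanishes there.\<close>
    have inv: "poly p w = poly p 0" if "w \<in> W" for w
      using arg_cong [OF less.prems(2) [OF that], of "\<lambda>p. poly p 0"] by (simp add: poly_pcompose)
    have "T dvd p - [:poly p 0:]"
      unfolding T_def using W(1) inv by (intro translation_poly_dvd) simp_all
    then obtain p' where p': "p - [:poly p 0:] = T * p'" by (rule dvdE)
    then have eq: "p = [:poly p 0:] + T * p'" by (simp add: algebra_simps)
    have "p' \<noteq> 0" using eq False by (metis add.right_neutral degree_pCons_0 mult_zero_right)
    have deg: "degree p = card W + degree p'"
    proof -
      have "degree (T * p') = card W + degree p'" using T \<open>p' \<noteq> 0\<close> by (simp add: degree_mult_eq)
      moreover from this have "degree ([:poly p 0:] + T * p') = degree (T * p')"
        using T(3) by (intro degree_add_eq_right) simp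
      ultimately show ?thesis using eq by simp
    qed
    \<comment> \<open>The quotient inherits the invariance, since the divisor is invariant and can
      be cancelled in a domain.\<close>
    have "pcompose p' [:w, 1:] = p'" if w: "w \<in> W" for w
    proof -
      have "p = pcompose ([:poly p 0:] + T * p') [:w, 1:]"
        using less.prems(2) [OF w] eq by simp
      also have "\<dots> = [:poly p 0:] + T * pcompose p' [:w, 1:]"
        using pcompose_translation_poly [OF W(1) w W(3) [OF _ w]]
        by (simp add: pcompose_add pcompose_mult T_def)
      finally have "T * p' = T * pcompose p' [:w, 1:]" using eq by (metis add_left_cancel)
      then show ?thesis using T(2) by simp
    qed
    moreover have "coeff p' i \<in> A" for i
    proof (rule coeff_cofactor_of_monic [OF A(1-3) lead_coeff_translation_poly A(4)])
      show "coeff (translation_poly W * p') i \<in> A" for i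
        using A(2) [OF less.prems(1) [of 0] less.prems(1) [of 0]] A(1) less.prems(1) [of i]
        unfolding T_def [symmetric] p' [symmetric] by (cases i) (simp_all add: poly_0_coeff_0)
    qed
    ultimately obtain B r where Br: "p' = (\<Sum>b<B. [:r b:] * T ^ b)" "\<forall>b<B. r b \<in> A"
      using less.hyps [of p'] deg T(3) unfolding T_def by auto
    define r' where "r' b = (if b = 0 then poly p 0 else r (b - 1))" for b
    have "p = [:r' 0:] + (\<Sum>b<B. [:r' (Suc b):] * T ^ Suc b)"
      by (subst eq, subst Br(1)) (simp add: r'_def sum_distrib_left mult_ac)
    also have "\<dots> = (\<Sum>b<Suc B. [:r' b:] * T ^ b)"
      by (subst sum.lessThan_Suc_shift) simp
    finally have "p = (\<Sum>b<Suc B. [:r' b:] * T ^ b)" .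
    moreover have "\<forall>b<Suc B. r' b \<in> A"
      using Br(2) less.prems(1) [of 0] by (auto simp: r'_def poly_0_coeff_0)
    ultimately show ?thesis unfolding T_def by blast
  qed
qed

section \<open>Polynomials in one of the variables\<close>

text \<open>The coefficients are kept in the full polynomial ring; that they avoid the variable
  \<open>j\<close> is the separate fact \<open>vars_in_coeff_to_poly\<close>.\<close>

definition to_poly :: "nat \<Rightarrow> 'a::comm_ring_1 sym_alg \<Rightarrow> 'a sym_alg poly" where
  "to_poly j f = (\<Sum>m\<in>keys f. monom (single (m - single j (lookup m j)) (lookup f m)) (lookup m j))"

lemma poly_to_poly: "poly (to_poly j f) (sym_gen j) = f"
proof -
  have "(m - single j (lookup m j)) + single j (lookup m j) = m" for m :: "nat \<Rightarrow>\<^sub>0 nat"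
    by (rule poly_mapping_eqI) (simp add: lookup_add lookup_minus lookup_single when_def)
  then have "poly (to_poly j f) (sym_gen j) = (\<Sum>m\<in>keys f. single m (lookup f m))"
    by (simp add: to_poly_def poly_sum poly_monom sym_gen_power mult_single)
  then show ?thesis by (subst (2) poly_mapping_expand) simp
qed

lemma vars_in_coeff_to_poly:
  assumes "vars_in (insert j X) f" "j \<notin> X"
  shows "vars_in X (coeff (to_poly j f) i)"
proof -
  have "vars_in X (single (m - single j (lookup m j)) (lookup f m))" if "m \<in> keys f" for m
  proof -
    have "keys (m - single j (lookup m j)) \<subseteq> X"
    proof
      fix l assume l: "l \<in> keys (m - single j (lookup m j))"
      then have "l \<noteq> j" "l \<in> keys m"
        by (auto simp: in_keys_iff lookup_minus lookup_single when_def split: if_splits)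
      then show "l \<in> X" using assms(1) that unfolding vars_in_def by blast
    qed
    then show ?thesis by (simp add: vars_in_def)
  qed
  then have "vars_in X (coeff (monom (single (m - single j (lookup m j)) (lookup f m)) (lookup m
    j)) i)"
    if "m \<in> keys f" for m
    using that by (cases "lookup m j = i") auto
  then show ?thesis unfolding to_poly_def coeff_sum by (rule vars_in_sum)
qed

lemma lookup_mult_single:
  fixes f :: "'a::comm_ring_1 sym_alg"
  shows "lookup (f * single a c) (m + a) = lookup f m * c"
proof -
  have "f * single a c = (\<Sum>b\<in>keys f. single (b + a) (lookup f b * c))"
    by (subst poly_mapping_expand [of f]) (simp add: sum_distrib_right mult_single)
  then show ?thesis
    by (auto simp: lookup_sum lookup_single when_def in_keys_iff sum.delta')
qed

text \<open>Coefficients free of the variable \<open>j\<close> contribute disjoint sets of monomials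
  for different powers of \<open>sym_gen j\<close>, so each of them can be read off from the
  value.\<close>

lemma poly_sym_gen_eq_0:
  fixes P :: "'a::comm_ring_1 sym_alg poly"
  assumes "\<And>i. vars_in X (coeff P i)" "j \<notin> X" "poly P (sym_gen j) = 0"
  shows "P = 0"
proof (rule poly_eqI)
  fix i
  have zero: "lookup (coeff P i' * sym_gen j ^ i') (m + single j i) = (if i'
    = i then lookup (coeff P i) m else 0)"
    if m: "lookup m j = 0" for i' m
  proof (cases "i' = i")
    case True
    then show ?thesis by (simp add: sym_gen_power lookup_mult_single)
  next
    case False
    have "m + single j i \<notin> keys (coeff P i' * sym_gen j ^ i')"
    proof
      assume "m + single j i \<in> keys (coeff P i' * sym_gen j ^ i')"
      then obtain b where b: "b \<in> keys (coeff P i')" "m + single j i = b + single j i'"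
        using keys_mult [of "coeff P i'" "sym_gen j ^ i'"]
          by (auto simp: sym_gen_power split: if_splits)
      have "lookup b j = 0" using assms(1) [of i'] assms(2) b(1)
        unfolding vars_in_def in_keys_iff [symmetric]
        by (meson in_keys_iff subsetD)
      then show False using arg_cong [OF b(2), of "\<lambda>a. lookup a j"] m False
        by (simp add: lookup_add)
    qed
    then show ?thesis using False by (simp add: in_keys_iff)
  qed
  show "coeff P i = coeff 0 i"
  proof (rule poly_mapping_eqI)
    fix m
    show "lookup (coeff P i) m = lookup (coeff 0 i) m"
    proof (cases "lookup m j = 0")
      case True
      have "0 = lookup (poly P (sym_gen j)) (m + single j i)" using assms(3) by simp
      also have "\<dots> = (\<Sum>i'\<le>max i (degree P). if i' = i then lookup (coeff P i) m else 0)"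
      proof -
        have "poly P (sym_gen j) = (\<Sum>i'\<le>max i (degree P). coeff P i' * sym_gen j ^ i')"
          unfolding poly_altdef by (rule sum.mono_neutral_left) (auto simp: coeff_eq_0)
        then show ?thesis by (simp add: lookup_sum zero [OF True])
      qed
      finally show ?thesis by simp
    next
      case False
      then have "m \<notin> keys (coeff P i)" using assms(1) [of i] assms(2) unfolding vars_in_def
        by (meson in_keys_iff subsetD)
      then show ?thesis by (simp add: in_keys_iff)
    qed
  qed
qed

lemma poly_sym_gen_inject:
  fixes P P' :: "'a::comm_ring_1 sym_alg poly"
  assumes "\<And>i. vars_in X (coeff P i)" "\<And>i. vars_in X (coeff P' i)" "j \<notin> X"
    "poly P (sym_gen j) = poly P' (sym_gen j)"
  shows "P = P'"
proof -
  have "P - P' = 0"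
    by (rule poly_sym_gen_eq_0 [of X _ j]) (simp_all add: assms vars_in_diff)
  then show ?thesis by simp
qed

section \<open>The Dickson and the Moore polynomials\<close>

locale galois_field =
  fixes p r q :: nat and F :: "'a::{field, finite} itself"
  assumes prime_p: "prime p" and r_pos: "r \<ge> 1" and q_def: "q = p ^ r"
    and card_field: "card (UNIV :: 'a set) = q"
begin

section \<open>The finite field and its Frobenius map\<close>

lemma q_ge_2: "q \<ge> 2"
proof -
  have "2 ^ 1 \<le> (2 :: nat) ^ r" using r_pos by (intro power_increasing) auto
  also have "\<dots> \<le> p ^ r" using prime_ge_2_nat [OF prime_p] by (intro power_mono) auto
  finally show ?thesis by (simp add: q_def)
qed

lemma q_pos [simp]: "q > 0" using q_ge_2 by simp

text \<open>Translation by 1 permutes the field, so summing over all elements shows that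
  \<open>q\<close> times 1 is 0. Hence the characteristic divides \<open>p ^ r\<close>.\<close>

lemma CHAR_field: "CHAR('a) = p"
proof -
  have "(\<Sum>x\<in>UNIV. x + 1) = (\<Sum>x\<in>UNIV. x :: 'a)"
    by (rule sum.reindex_bij_witness [of _ "\<lambda>x. x - 1" "\<lambda>x. x + 1"]) auto
  then have "of_nat q = (0 :: 'a)" by (simp add: sum.distrib card_field)
  then have "CHAR('a) dvd p ^ r" unfolding of_nat_eq_0_iff_char_dvd q_def .
  moreover have "prime CHAR('a)" by (rule prime_CHAR_semidom) (simp add: finite_imp_CHAR_pos)
  ultimately show ?thesis using prime_p by (meson prime_dvd_power primes_dvd_imp_eq)
qed

lemma CHAR_sym_alg: "CHAR('a sym_alg) = p"
proof -
  have "(of_nat i :: 'a sym_alg) = single 0 (of_nat i)" for i by (simp add: single_of_nat)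
  then have "(of_nat i :: 'a sym_alg) = 0 \<longleftrightarrow> p dvd i" for i
    using of_nat_eq_0_iff_char_dvd [of i, where 'a = 'a] CHAR_field
    by (metis single_zero lookup_single_eq lookup_zero)
  then show ?thesis by (intro CHAR_eqI) auto
qed

lemma frobenius_add: "(f + g :: 'a sym_alg) ^ (q ^ b) = f ^ (q ^ b) + g ^ (q ^ b)"
  by (rule freshmans_dream' [where n = "r * b"])
    (simp_all add: CHAR_sym_alg prime_p q_def power_mult)

text \<open>Multiplication by \<open>c\<close> permutes the nonzero elements, hence fixes their
  product.\<close>

lemma field_power_q_minus_1: "c \<noteq> 0 \<Longrightarrow> c ^ (q - 1) = (1 :: 'a)"
proof -
  assume c: "c \<noteq> 0"
  have "(\<Prod>y\<in>UNIV - {0}. c * y) = (\<Prod>y\<in>UNIV - {0}. y)"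
    by (rule prod.reindex_bij_witness [of _ "\<lambda>y. y / c" "\<lambda>y. c * y"]) (use c in auto)
  then have "c ^ card (UNIV - {0 :: 'a}) * (\<Prod>y\<in>UNIV - {0}. y) = (\<Prod>y\<in>UNIV - {0}. y)"
    by (simp add: prod.distrib)
  moreover have "(\<Prod>y\<in>UNIV - {0 :: 'a}. y) \<noteq> 0" by simp
  ultimately show ?thesis by (simp add: card_Diff_singleton card_field)
qed

lemma frobenius_const: "(single 0 c :: 'a sym_alg) ^ (q ^ b) = single 0 c"
proof -
  have q: "c ^ q = c" for c :: 'a
    using field_power_q_minus_1 [of c] power_minus_mult [of q c] by (cases "c = 0") simp_all
  have "c ^ (q ^ b) = c" by (induction b) (simp_all add: power_mult q)
  then show ?thesis by (simp add: const_power)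
qed

lemma q_ge_1 [simp]: "Suc 0 \<le> q" using q_ge_2 by simp

text \<open>The coefficient of \<open>X ^ (q ^ b)\<close> in the product F of \<open>X - v\<close>
  over all linear forms \<open>v\<close> in the first \<open>m\<close> variables; up to sign these
  are the classical Dickson invariants. Adjoining a new variable x turns F into
  \<open>F ^ q - F(x) ^ (q - 1) * F\<close>, and reading off coefficients gives the recursion; the
  sum over \<open>i\<close> is F(x).\<close>

primrec dickson :: "nat \<Rightarrow> nat \<Rightarrow> 'a sym_alg" where
  "dickson 0 b = (if b = 0 then 1 else 0)"
| "dickson (Suc m) b = (if b = 0 then 0 else dickson m (b - 1) ^ q)
    - (\<Sum>i\<le>m. dickson m i * sym_gen m ^ (q ^ i)) ^ (q - 1) * dickson m b"

definition dickson_fun :: "nat \<Rightarrow> 'a sym_alg \<Rightarrow> 'a sym_alg" where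
  "dickson_fun m f = (\<Sum>b\<le>m. dickson m b * f ^ (q ^ b))"

text \<open>The product of the orbit of the variable \<open>m\<close> under translations by linear
  forms in the preceding variables.\<close>

definition orbit_product :: "nat \<Rightarrow> 'a sym_alg" where
  "orbit_product m = dickson_fun m (sym_gen m)"

lemma dickson_Suc: "dickson (Suc m) b =
    (if b = 0 then 0 else dickson m (b - 1) ^ q) - orbit_product m ^ (q - 1) * dickson m b"
  by (simp add: orbit_product_def dickson_fun_def)

declare dickson.simps(2) [simp del]

lemma dickson_eq_0: "b > m \<Longrightarrow> dickson m b = 0"
  by (induction m arbitrary: b) (auto simp: dickson_Suc power_0_left)

lemma dickson_diag [simp]: "dickson m m = 1"
  by (induction m) (auto simp: dickson_Suc dickson_eq_0)

text \<open>The \<open>q\<close>-power map is additive, so it acts on each term and moves the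
  exponent \<open>q ^ b\<close> to \<open>q ^ Suc b\<close>. This is the shift to
  \<open>b - 1\<close> in the recursion of \<open>dickson\<close>.\<close>

lemma dickson_fun_Suc:
  "dickson_fun (Suc m) f = dickson_fun m f ^ q - orbit_product m ^ (q - 1) * dickson_fun m f"
proof -
  have "dickson_fun m f ^ q = (\<Sum>b\<le>m. (dickson m b * f ^ (q ^ b)) ^ q)"
    unfolding dickson_fun_def
    by (rule freshmans_dream_sum' [where n = r]) (simp_all add: CHAR_sym_alg prime_p q_def)
  also have "\<dots> = (\<Sum>b\<le>Suc m. (if b = 0 then 0 else dickson m (b - 1) ^ q) * f ^ (q ^ b))"
    by (subst sum.atMost_Suc_shift) (simp add: power_mult_distrib mult.commute flip: power_mult)
  finally have "dickson_fun m f ^ q =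
    (\<Sum>b\<le>Suc m. (if b = 0 then 0 else dickson m (b - 1) ^ q) * f ^ (q ^ b))" .
  moreover have "dickson_fun m f = (\<Sum>b\<le>Suc m. dickson m b * f ^ (q ^ b))"
    by (simp add: dickson_fun_def dickson_eq_0)
  ultimately show ?thesis
    by (simp add: dickson_fun_def [of "Suc m"] dickson_Suc left_diff_distrib sum_subtractf
        sum_distrib_left mult.assoc del: sum.atMost_Suc)
qed

lemma dickson_fun_0 [simp]: "dickson_fun 0 f = f"
  by (simp add: dickson_fun_def)

lemma dickson_fun_add: "dickson_fun m (f + g) = dickson_fun m f + dickson_fun m g"
  by (simp add: dickson_fun_def frobenius_add distrib_left sum.distrib)

lemma dickson_fun_scale: "dickson_fun m (scale c f) = scale c (dickson_fun m f)"
  by (simp add: dickson_fun_def scale_conv_mult power_mult_distrib frobenius_const sum_distrib_left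
    mult_ac)

lemma linear_map_dickson_fun: "linear_map (dickson_fun m)"
  by (simp add: linear_map_def dickson_fun_add dickson_fun_scale)

lemma dickson_fun_gen_eq_0: "k < m \<Longrightarrow> dickson_fun m (sym_gen k) = 0"
proof (induction m)
  case (Suc m)
  show ?case
  proof (cases "k = m")
    case True
    \<comment> \<open>At the new variable itself the two terms of the recursion cancel.\<close>
    have "orbit_product m ^ q = orbit_product m ^ (q - 1) * orbit_product m"
      by (metis q_pos power_minus_mult)
    then show ?thesis by (simp add: True dickson_fun_Suc orbit_product_def)
  next
    case False
    then show ?thesis using Suc by (simp add: dickson_fun_Suc power_0_left)
  qed
qed simp

section \<open>Linear forms and the additive polynomial vanishing on them\<close>

definition lin_form :: "nat \<Rightarrow> (nat \<Rightarrow> 'a) \<Rightarrow> 'a sym_alg" where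
  "lin_form m c = (\<Sum>k<m. scale (c k) (sym_gen k))"

definition lin_forms :: "nat \<Rightarrow> 'a sym_alg set" where
  "lin_forms m = range (lin_form m)"

lemma lin_form_eq_iff: "lin_form m c = lin_form m d \<longleftrightarrow> (\<forall>k<m. c k = d k)"
proof -
  have s: "single j (1 :: nat) = single k 1 \<longleftrightarrow> j = k" for j k :: nat
    by (metis lookup_single_eq lookup_single_not_eq zero_neq_one)
  have "lookup (lin_form m c) (single k 1) = c k" if "k < m" for c k
    using that by (simp add: lin_form_def lookup_sum sym_gen_def lookup_single when_def s
      [simplified])
  then show ?thesis by (metis (no_types, lifting) lin_form_def lessThan_iff sum.cong)
qed

lemma lin_forms_PiE: "lin_forms m = lin_form m ` ({..<m} \<rightarrow>\<^sub>E UNIV)"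
proof -
  have "lin_form m c = lin_form m (restrict c {..<m})" for c by (simp add: lin_form_eq_iff)
  moreover have "restrict c {..<m} \<in> {..<m} \<rightarrow>\<^sub>E UNIV" for c :: "nat \<Rightarrow> 'a" by simp
  ultimately show ?thesis unfolding lin_forms_def by blast
qed

lemma card_lin_forms: "card (lin_forms m) = q ^ m"
proof -
  have "inj_on (lin_form m) ({..<m} \<rightarrow>\<^sub>E UNIV)"
  proof (rule inj_onI)
    fix c d :: "nat \<Rightarrow> 'a"
    assume "c \<in> {..<m} \<rightarrow>\<^sub>E UNIV" "d \<in> {..<m} \<rightarrow>\<^sub>E UNIV" "lin_form m c = lin_form m d"
    then show "c = d" by (intro PiE_ext [of c _ _ d]) (auto simp: lin_form_eq_iff)
  qed
  then show ?thesis by (simp add: lin_forms_PiE card_image card_PiE card_field)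
qed

lemma finite_lin_forms [simp]: "finite (lin_forms m)"
  by (simp add: lin_forms_PiE finite_PiE)

lemma lin_form_add: "lin_form m c + lin_form m d = lin_form m (\<lambda>k. c k + d k)"
  by (simp add: lin_form_def scale_add_left sum.distrib)

lemma zero_in_lin_forms: "0 \<in> lin_forms m"
  unfolding lin_forms_def by (rule range_eqI [of _ _ "\<lambda>_. 0"]) (simp add: lin_form_def)

lemma add_in_lin_forms: "v \<in> lin_forms m \<Longrightarrow> w \<in> lin_forms m \<Longrightarrow> v + w \<in> lin_forms m"
  unfolding lin_forms_def by (auto simp: lin_form_add)

lemma vars_in_lin_forms: "v \<in> lin_forms m \<Longrightarrow> vars_in {..<m} v"
  unfolding lin_forms_def lin_form_def by (auto intro!: vars_in_sum vars_in_scale)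

lemma dickson_fun_lin_forms: "v \<in> lin_forms m \<Longrightarrow> dickson_fun m v = 0"
  unfolding lin_forms_def lin_form_def
  by (auto simp: linear_map_sum [OF linear_map_dickson_fun] dickson_fun_scale dickson_fun_gen_eq_0)

definition q_poly :: "nat \<Rightarrow> (nat \<Rightarrow> 'a sym_alg) \<Rightarrow> 'a sym_alg poly" where
  "q_poly m d = (\<Sum>b\<le>m. monom (d b) (q ^ b))"

lemma poly_q_poly: "poly (q_poly m d) f = (\<Sum>b\<le>m. d b * f ^ (q ^ b))"
  by (simp add: q_poly_def poly_sum poly_monom)

lemma coeff_q_poly: "b \<le> m \<Longrightarrow> coeff (q_poly m d) (q ^ b) = d b"
  using q_ge_2 by (simp add: q_poly_def coeff_sum power_inject_exp)

lemma degree_q_poly: "d m = 1 \<Longrightarrow> degree (q_poly m d) = q ^ m"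
proof (rule antisym)
  show "degree (q_poly m d) \<le> q ^ m"
    unfolding q_poly_def using q_ge_2
    by (intro degree_sum_le) (auto intro!: order.trans [OF degree_monom_le] power_increasing)
  show "d m = 1 \<Longrightarrow> q ^ m \<le> degree (q_poly m d)"
    by (rule le_degree) (simp add: coeff_q_poly)
qed

lemma degree_diff_monic_less:
  fixes P P' :: "'b::comm_ring_1 poly"
  assumes "degree P = i" "degree P' = i" "coeff P i = coeff P' i" "i > 0"
  shows "degree (P - P') < i"
proof -
  have "coeff (P - P') j = 0" if "j > i - 1" for j
    using that assms by (cases "j = i") (auto simp: coeff_eq_0)
  then have "degree (P - P') \<le> i - 1" by (intro degree_le) auto
  then show ?thesis using assms(4) by simp
qed

text \<open>Two monic polynomials of degree \<open>q ^ m\<close> that vanish at the same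
  \<open>q ^ m\<close> points agree, and their coefficients at the exponents \<open>q ^ b\<close>
  can be compared.\<close>

lemma q_poly_unique:
  assumes "d m = 1" "\<And>v. v \<in> lin_forms m \<Longrightarrow> poly (q_poly m d) v = 0" "b \<le> m"
  shows "d b = dickson m b"
proof -
  have "q_poly m d = q_poly m (dickson m)"
  proof (rule poly_eq_of_many_roots [OF finite_lin_forms [of m]])
    show "degree (q_poly m d - q_poly m (dickson m)) < card (lin_forms m)"
      unfolding card_lin_forms
      by (rule degree_diff_monic_less) (simp_all add: degree_q_poly coeff_q_poly assms(1))
  qed (use dickson_fun_lin_forms in \<open>simp add: assms(2) poly_q_poly [of m
    "dickson m"] dickson_fun_def\<close>)
  then show ?thesis using coeff_q_poly [OF assms(3)] by metis
qed

lemma translation_poly_lin_forms: "translation_poly (lin_forms m) = q_poly m (dickson m)"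
proof (rule poly_eq_of_many_roots [OF finite_lin_forms [of m]])
  show "degree (translation_poly (lin_forms m) - q_poly m (dickson m)) < card (lin_forms m)"
    unfolding card_lin_forms
    using lead_coeff_translation_poly [of "lin_forms m"]
    by (intro degree_diff_monic_less)
      (simp_all add: degree_q_poly coeff_q_poly degree_translation_poly card_lin_forms)
qed (use dickson_fun_lin_forms in \<open>simp add: poly_translation_poly_eq_0_iff poly_q_poly
  dickson_fun_def\<close>)

text \<open>Applying \<open>\<sigma>\<close> to the coefficients gives a monic additive polynomial
  that again vanishes on \<open>lin_forms m\<close>, because \<open>\<sigma>\<close> maps this set
  onto itself. By uniqueness it is the original one.\<close>

lemma hom_dickson:
  assumes hom: "comm_ring_hom \<sigma>" and surj: "\<sigma> ` lin_forms m = lin_forms m" and "b \<le> m"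
  shows "\<sigma> (dickson m b) = dickson m b"
proof (rule q_poly_unique [OF _ _ \<open>b \<le> m\<close>])
  interpret comm_ring_hom \<sigma> by (rule hom)
  show "\<sigma> (dickson m m) = 1" by simp
  fix v assume "v \<in> lin_forms m"
  then obtain w where w: "w \<in> lin_forms m" "v = \<sigma> w" using surj by blast
  have "poly (q_poly m (\<lambda>b. \<sigma> (dickson m b))) v = \<sigma> (dickson_fun m w)"
    by (simp add: poly_q_poly dickson_fun_def hom_sum hom_mult hom_power w)
  then show "poly (q_poly m (\<lambda>b. \<sigma> (dickson m b))) v = 0"
    by (simp add: dickson_fun_lin_forms w)
qed

section \<open>Degrees and leading exponents of the Dickson polynomials\<close>

lemma vars_in_dickson: "vars_in {..<m} (dickson m b)"
proof (induction m arbitrary: b)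
  case (Suc m)
  have "vars_in {..<Suc m} (dickson m b)" for b
    by (rule vars_in_mono [OF Suc]) auto
  then show ?case unfolding dickson_Suc orbit_product_def dickson_fun_def
    by (intro vars_in_diff vars_in_mult vars_in_power vars_in_sum)
      (auto intro!: vars_in_power)
qed simp

lemma homog_dickson: "b \<le> m \<Longrightarrow> homog (q ^ m - q ^ b) (dickson m b)"
proof (induction m arbitrary: b)
  case (Suc m)
  have N: "homog (q ^ m) (orbit_product m)"
    unfolding orbit_product_def dickson_fun_def
  proof (rule homog_sum)
    fix i assume i: "i \<in> {..m}"
    have "homog (q ^ m - q ^ i + 1 * q ^ i) (dickson m i * sym_gen m ^ q ^ i)"
      using i by (intro homog_mult homog_power Suc homog_gen) simp
    moreover have "q ^ i \<le> q ^ m" using i q_pos by (intro power_increasing) (auto simp: Suc_leI)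
    ultimately show "homog (q ^ m) (dickson m i * sym_gen m ^ q ^ i)" by simp
  qed
  have "homog (q ^ Suc m - q ^ b) (if b = 0 then 0 else dickson m (b - 1) ^ q)"
  proof (cases b)
    case (Suc i)
    then have "homog ((q ^ m - q ^ i) * q) (dickson m i ^ q)"
      using Suc.prems by (intro homog_power Suc.IH) simp
    then show ?thesis using \<open>b = Suc i\<close> by (simp add: diff_mult_distrib2 mult.commute)
  qed simp
  moreover have "homog (q ^ Suc m - q ^ b) (orbit_product m ^ (q - 1) * dickson m b)"
  proof (cases "b \<le> m")
    case True
    have "homog (q ^ m * (q - 1) + (q ^ m - q ^ b)) (orbit_product m ^ (q - 1) * dickson m b)"
      by (intro homog_mult homog_power N Suc.IH True)
    moreover have "q ^ m * (q - 1) + (q ^ m - q ^ b) = q ^ Suc m - q ^ b"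
    proof -
      have "q ^ b \<le> q ^ m" using True by (intro power_increasing) auto
      moreover have "q ^ m \<le> q ^ m * q" by simp
      ultimately show ?thesis by (simp add: diff_mult_distrib2 mult.commute)
    qed
    ultimately show ?thesis by simp
  qed (simp add: dickson_eq_0)
  ultimately show ?case unfolding dickson_Suc by (rule homog_diff)
qed simp

lemma mono_less_topI:
  assumes "keys a \<subseteq> {..m}" "keys b \<subseteq> {..m}" "lookup a m < lookup b m"
  shows "a \<prec> b"
  unfolding mono_less_def
proof (intro exI conjI allI impI)
  fix j assume "m < j"
  then have "j \<notin> keys a" "j \<notin> keys b" using assms(1,2) by auto
  then show "lookup a j = lookup b j" by (simp add: in_keys_iff)
qed (rule assms(3))

text \<open>The exponents telescope to the degree: the sum of \<open>(q - 1) * q ^ j\<close> over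
  the range of \<open>j\<close> is \<open>q ^ m - q ^ b\<close>.\<close>

definition dickson_mono :: "nat \<Rightarrow> nat \<Rightarrow> (nat \<Rightarrow>\<^sub>0 nat)" where
  "dickson_mono m b = (\<Sum>j\<in>{b..<m}. single j ((q - 1) * q ^ j))"

lemma lookup_dickson_mono: "lookup (dickson_mono m b) j = (if b \<le> j \<and>
  j < m then (q - 1) * q ^ j else 0)"
  by (simp add: dickson_mono_def lookup_sum lookup_single when_def)

lemma keys_dickson_mono: "keys (dickson_mono m b) \<subseteq> {..<m}"
  by (auto simp: in_keys_iff lookup_dickson_mono split: if_splits)

text \<open>The Dickson polynomials are free of the variable \<open>k\<close>, so its highest power
  \<open>q ^ m\<close> decides. Their leading exponents enter as a hypothesis, because the induction
  that computes them uses the case \<open>k = m\<close>.\<close>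

lemma dickson_fun_lead:
  assumes lead: "\<And>b. b \<le> m \<Longrightarrow> is_lead (dickson m b) (dickson_mono m b)" and "m \<le> k"
  shows "is_lead (dickson_fun m (sym_gen k)) (single k (q ^ m))"
proof -
  have g: "is_lead (sym_gen k ^ i :: 'a sym_alg) (single k i)" for i
    by (simp add: sym_gen_power is_lead_single)
  have "dickson_fun m (sym_gen k) = sym_gen k ^ (q ^ m) + (\<Sum>b<m. dickson m b * sym_gen k ^ (q ^ b))"
    by (simp add: dickson_fun_def lessThan_Suc_atMost [symmetric])
  moreover have "is_lead (sym_gen k ^ (q ^ m) + (\<Sum>b<m. dickson m b * sym_gen k ^ (q ^ b))) (single
    k (q ^ m))"
  proof (rule is_lead_add [OF g])
    fix c assume "c \<in> keys (\<Sum>b<m. dickson m b * sym_gen k ^ (q ^ b))"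
    from subsetD [OF keys_sum_subset this]
    obtain b where b: "b < m" "c \<in> keys (dickson m b * sym_gen k ^ (q ^ b))" by blast
    have "is_lead (dickson m b * sym_gen k ^ (q ^ b)) (dickson_mono m b + single k (q ^ b))"
      using b(1) by (intro is_lead_mult lead g) simp
    moreover have "dickson_mono m b + single k (q ^ b) \<prec> single k (q ^ m)"
    proof (rule mono_less_topI [of _ k])
      show "keys (dickson_mono m b + single k (q ^ b)) \<subseteq> {..k}"
        by (rule order.trans [OF keys_add])
          (use keys_dickson_mono [of m b] \<open>m \<le> k\<close> in \<open>auto simp: subset_iff\<close>)
      show "lookup (dickson_mono m b + single k (q ^ b)) k < lookup (single k (q ^ m)) k"
        using q_ge_2 b(1) \<open>m \<le> k\<close> by (simp add: lookup_add lookup_dickson_mono)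
    qed auto
    ultimately show "c \<prec> single k (q ^ m)" using b(2) by (rule is_lead_keys_less)
  qed
  ultimately show ?thesis by simp
qed

text \<open>In the recursion only the product with a power of \<open>orbit_product m\<close>
  contains the variable \<open>m\<close>, so it outweighs the \<open>q\<close>-th power of
  \<open>dickson m (b - 1)\<close>.\<close>

lemma is_lead_dickson: "b \<le> m \<Longrightarrow> is_lead (dickson m b) (dickson_mono m b)"
proof (induction m arbitrary: b)
  case 0
  then show ?case by (simp add: dickson_mono_def is_lead_one)
next
  case (Suc m)
  show ?case
  proof (cases "b = Suc m")
    case True
    then show ?thesis by (simp add: dickson_mono_def is_lead_one)
  next
    case False
    then have b: "b \<le> m" using Suc.prems by simp
    have N: "is_lead (orbit_product m) (single m (q ^ m))"
      unfolding orbit_product_def by (rule dickson_fun_lead [OF Suc.IH order.refl])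
    have mono: "dickson_mono (Suc m) b = mono_scale (q - 1) (single m (q ^ m)) + dickson_mono m b"
      using b by (intro poly_mapping_eqI) (auto simp: lookup_dickson_mono lookup_add lookup_single
        when_def)
    have "is_lead (- (orbit_product m ^ (q - 1) * dickson m b)) (dickson_mono (Suc m) b)"
      unfolding is_lead_uminus mono by (intro is_lead_mult is_lead_power N Suc.IH b)
    then have "is_lead (- (orbit_product m ^ (q - 1) * dickson m b)
        + (if b = 0 then 0 else dickson m (b - 1) ^ q)) (dickson_mono (Suc m) b)"
    proof (rule is_lead_add)
      fix c assume "c \<in> keys (if b = 0 then 0 else dickson m (b - 1) ^ q)"
      then have "keys c \<subseteq> {..<m}"
        using vars_in_power [OF vars_in_dickson [of m "b - 1"], of q] unfolding vars_in_def
        by (auto split: if_splits)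
      moreover from this have "m \<notin> keys c" by auto
      then have "lookup c m = 0" by (simp add: in_keys_iff)
      moreover have "lookup (dickson_mono (Suc m) b) m > 0"
        using b q_ge_2 by (simp add: lookup_dickson_mono)
      ultimately show "c \<prec> dickson_mono (Suc m) b"
        using keys_dickson_mono [of "Suc m" b] by (intro mono_less_topI [of _ m]) auto
    qed
    then show ?thesis by (simp add: dickson_Suc)
  qed
qed

lemma is_lead_dickson_fun: "m \<le> k \<Longrightarrow> is_lead (dickson_fun m (sym_gen k)) (single k (q ^ m))"
  by (rule dickson_fun_lead [OF is_lead_dickson])

lemma is_lead_orbit_product: "is_lead (orbit_product m) (single m (q ^ m))"
  unfolding orbit_product_def by (rule is_lead_dickson_fun) simp

section \<open>The Moore matrix and its determinant\<close>

definition moore_mat :: "nat \<Rightarrow> 'a sym_alg mat" where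
  "moore_mat n = mat n n (\<lambda>(a, j). sym_gen j ^ (q ^ a))"

definition moore_det :: "nat \<Rightarrow> 'a sym_alg" where
  "moore_det n = det (moore_mat n)"

lemma moore_mat_carrier [simp]: "moore_mat n \<in> carrier_mat n n"
  by (simp add: moore_mat_def)

definition moore_mono :: "nat \<Rightarrow> (nat \<Rightarrow>\<^sub>0 nat)" where
  "moore_mono n = (\<Sum>j<n. single j (q ^ j))"

lemma lookup_moore_mono: "lookup (moore_mono n) j = (if j < n then q ^ j else 0)"
  by (simp add: moore_mono_def lookup_sum lookup_single when_def)

lemma moore_det_sum:
  "moore_det n = (\<Sum>\<pi>\<in>{\<pi>. \<pi> permutes {0..<n}}. signof \<pi> * single (\<Sum>i<n. single (\<pi> i) (q ^ i)) 1)"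
proof -
  have "(\<Prod>i = 0..<n. moore_mat n $$ (i, \<pi> i)) = single (\<Sum>i<n. single (\<pi> i) (q ^ i)) 1"
    if "\<pi> permutes {0..<n}" for \<pi>
  proof -
    have "(\<Prod>i = 0..<n. moore_mat n $$ (i, \<pi> i)) = (\<Prod>i = 0..<n. single (single (\<pi> i) (q ^ i)) 1)"
      using permutes_in_image [OF that] by (intro prod.cong) (auto simp: moore_mat_def
        sym_gen_power)
    then show ?thesis by (simp add: prod_single lessThan_atLeast0)
  qed
  then show ?thesis unfolding moore_det_def det_def' [OF moore_mat_carrier] by (intro sum.cong) auto
qed

lemma lookup_signof_single:
  "lookup (signof \<pi> * single a 1 :: 'a sym_alg) b \<noteq> 0 \<longleftrightarrow> b = a"
  by (auto simp: sign_def lookup_single when_def)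

lemma homog_moore_det: "homog (\<Sum>a<n. q ^ a) (moore_det n)"
  unfolding moore_det_sum
proof (rule homog_sum)
  fix \<pi>
  have "monomial_degree (sum f X) = (\<Sum>x\<in>X. monomial_degree (f x))" for f :: "nat \<Rightarrow> _" and X
    by (induction X rule: infinite_finite_induct) (simp_all add: monomial_degree_add)
  then show "homog (\<Sum>a<n. q ^ a) (signof \<pi> * single (\<Sum>i<n. single (\<pi> i) (q ^ i)) 1 :: 'a sym_alg)"
    by (auto simp: homog_def in_keys_iff lookup_signof_single)
qed

lemma vars_in_moore_det: "vars_in {..<n} (moore_det n)"
  unfolding moore_det_sum
proof (rule vars_in_sum)
  fix \<pi> assume \<pi>: "\<pi> \<in> {\<pi>. \<pi> permutes {0..<n}}"
  have "keys (\<Sum>i<n. single (\<pi> i) (q ^ i)) \<subseteq> {..<n}"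
  proof (rule order.trans [OF keys_sum_subset])
    show "(\<Union>i<n. keys (single (\<pi> i) (q ^ i))) \<subseteq> {..<n}"
      using permutes_in_image [of \<pi> "{0..<n}"] \<pi> by (auto split: if_splits)
  qed
  then show "vars_in {..<n} (signof \<pi> * single (\<Sum>i<n. single (\<pi> i) (q ^ i)) 1 :: 'a sym_alg)"
    by (auto simp: vars_in_def in_keys_iff lookup_signof_single)
qed

text \<open>Each Leibniz term is a single monomial, with exponent \<open>q ^ \<rho> j\<close> at the
  variable \<open>j\<close>, where \<open>\<rho>\<close> is the inverse of the permutation. The
  largest index moved by \<open>\<rho>\<close> is moved downwards, so every other term is smaller
  than the diagonal one.\<close>

lemma is_lead_moore_det: "is_lead (moore_det n) (moore_mono n)"
proof -
  define t :: "(nat \<Rightarrow> nat) \<Rightarrow> 'a sym_alg"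
    where "t \<pi> = signof \<pi> * single (\<Sum>i<n. single (\<pi> i) (q ^ i)) 1" for \<pi>
  let ?P = "{\<pi>. \<pi> permutes {0..<n}}"
  have "moore_det n = t id + sum t (?P - {id})"
    unfolding moore_det_sum t_def [symmetric]
    by (rule sum.remove) (auto simp: finite_permutations permutes_id)
  moreover have "is_lead (t id) (moore_mono n)"
    by (simp add: t_def moore_mono_def is_lead_single)
  moreover have "c \<prec> moore_mono n" if c: "c \<in> keys (sum t (?P - {id}))" for c
  proof -
    from subsetD [OF keys_sum_subset c]
    obtain \<pi> where \<pi>: "\<pi> permutes {0..<n}" "\<pi> \<noteq> id" "c \<in> keys (t \<pi>)" by blast
    then have c: "c = (\<Sum>i<n. single (\<pi> i) (q ^ i))"
      by (simp add: t_def in_keys_iff lookup_signof_single)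
    define \<rho> where "\<rho> = inv_into UNIV \<pi>"
    have \<rho>: "\<rho> permutes {0..<n}" using \<pi>(1) by (simp add: \<rho>_def permutes_inv)
    have eq: "\<pi> i = j \<longleftrightarrow> i = \<rho> j" for i j
      using permutes_inverses [OF \<pi>(1)] by (auto simp: \<rho>_def)
    have lookup_c: "lookup c j = (if j < n then q ^ \<rho> j else 0)" for j
      using permutes_in_image [OF \<rho>, of j]
      by (auto simp: c lookup_sum lookup_single when_def eq)
    define D where "D = {i. \<rho> i \<noteq> i}"
    have D: "D \<subseteq> {..<n}" using \<rho> by (auto simp: D_def permutes_def)
    then have finD: "finite D" by (rule finite_subset) simp
    have "D \<noteq> {}"
    proof
      assume "D = {}"
      then have "\<rho> i = i" for i by (auto simp: D_def)
      then have "\<pi> i = i" for i by (simp add: eq)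
      then show False using \<pi>(2) by (auto simp: fun_eq_iff)
    qed
    define a where "a = Max D"
    have a: "a \<in> D" unfolding a_def using finD \<open>D \<noteq> {}\<close> by (rule Max_in)
    have fixed: "\<rho> j = j" if "a < j" for j
      using that Max_ge [OF finD, of j] unfolding a_def D_def by fastforce
    \<comment> \<open>Otherwise \<open>\<rho> a\<close> lies beyond \<open>a\<close>, where
      \<open>\<rho>\<close> is the identity, against injectivity.\<close>
    have "\<rho> a < a"
    proof (rule ccontr)
      assume "\<not> \<rho> a < a"
      then have "a < \<rho> a" using a by (simp add: D_def)
      then have "\<rho> (\<rho> a) = \<rho> a" by (rule fixed)
      then show False using \<open>a < \<rho> a\<close> by (simp add: inj_eq [OF permutes_inj [OF \<rho>]])
    qed
    then have "lookup c a < lookup (moore_mono n) a"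
      using a D q_ge_2 by (auto simp: lookup_c lookup_moore_mono)
    moreover have "lookup c j = lookup (moore_mono n) j" if "a < j" for j
      using fixed [OF that] by (simp add: lookup_c lookup_moore_mono)
    ultimately show ?thesis unfolding mono_less_def by blast
  qed
  ultimately show ?thesis by (simp add: is_lead_add)
qed

lemma moore_det_nonzero: "moore_det n \<noteq> 0"
  using is_lead_moore_det is_lead_nonzero by blast

end

section \<open>Leading monomials of semi-invariants\<close>

lemma coeff_pcompose_in:
  fixes P Q :: "'a::comm_ring_1 poly"
  assumes A: "0 \<in> A" "\<And>x y. x \<in> A \<Longrightarrow> y \<in> A \<Longrightarrow> x + y \<in> A" "\<And>x y. x \<in> A \<Longrightarrow> y \<in> A \<Longrightarrow> x * y \<in> A"
    and "\<And>i. coeff P i \<in> A" "\<And>i. coeff Q i \<in> A"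
  shows "coeff (pcompose P Q) i \<in> A"
  using assms(4)
proof (induction P arbitrary: i)
  case (pCons a P)
  have sum: "sum f X \<in> A" if "\<And>x. x \<in> X \<Longrightarrow> f x \<in> A" for f :: "nat \<Rightarrow> 'a" and X
    using that by (induction X rule: infinite_finite_induct) (simp_all add: A)
  have "coeff P i \<in> A" for i using pCons.prems [of "Suc i"] by simp
  then have "coeff (Q * pcompose P Q) i \<in> A" for i
    unfolding coeff_mult by (intro sum A(3) assms(5) pCons.IH)
  moreover have "coeff [:a:] i \<in> A" for i
    using pCons.prems [of 0] A(1) by (cases i) simp_all
  ultimately show ?case unfolding pcompose_pCons coeff_add by (intro A(2))
qed (simp add: A(1))

lemma is_lead_scale:
  fixes f :: "'a::idom sym_alg"
  assumes "c \<noteq> 0"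
  shows "is_lead (scale c f) a \<longleftrightarrow> is_lead f a"
proof -
  have "keys (scale c f) = keys f" using assms by (auto simp: in_keys_iff)
  then show ?thesis by (simp add: is_lead_def)
qed

section \<open>Exchange of two adjacent variables\<close>

definition permute_mono :: "(nat \<Rightarrow> nat) \<Rightarrow> (nat \<Rightarrow>\<^sub>0 nat) \<Rightarrow> (nat \<Rightarrow>\<^sub>0 nat)" where
  "permute_mono \<pi> m = Poly_Mapping.map_key \<pi> m"

lemma lookup_permute_mono: "inj \<pi> \<Longrightarrow> lookup (permute_mono \<pi> m) j = lookup m (\<pi> j)"
  by (simp add: permute_mono_def map_key.rep_eq)

abbreviation swap_mono :: "nat \<Rightarrow> (nat \<Rightarrow>\<^sub>0 nat) \<Rightarrow> (nat \<Rightarrow>\<^sub>0 nat)" where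
  "swap_mono i \<equiv> permute_mono (transpose i (Suc i))"

abbreviation swap_vars :: "nat \<Rightarrow> 'a::comm_ring_1 sym_alg \<Rightarrow> 'a sym_alg" where
  "swap_vars i \<equiv> subst (\<lambda>j. sym_gen (transpose i (Suc i) j))"

lemma lookup_swap_mono: "lookup (swap_mono i m) j = lookup m (transpose i (Suc i) j)"
  by (simp add: lookup_permute_mono)

lemma swap_mono_involution [simp]: "swap_mono i (swap_mono i m) = m"
  by (rule poly_mapping_eqI) (simp add: lookup_swap_mono)

lemma swap_vars_single: "swap_vars i (single m 1) = single (swap_mono i m) 1"
proof -
  let ?t = "transpose i (Suc i)"
  have "keys (swap_mono i m) = ?t ` keys m"
    by (auto simp: in_keys_iff lookup_swap_mono image_iff)
      (metis gr_implies_not0 in_keys_iff transpose_involutory)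
  then have "single (swap_mono i m) 1 = (\<Prod>j\<in>?t ` keys m. sym_gen j ^ lookup (swap_mono i m) j :: 'a
    sym_alg)"
    by (simp add: monomial_prod)
  also have "\<dots> = (\<Prod>j\<in>keys m. sym_gen (?t j) ^ lookup m j)"
    by (subst prod.reindex) (auto simp: lookup_swap_mono intro: inj_on_subset [OF inj_transpose])
  finally show ?thesis by (simp add: subst_def)
qed

lemma lookup_swap_vars: "lookup (swap_vars i f) m = lookup f (swap_mono i m)"
proof -
  have "swap_vars i f = (\<Sum>a\<in>keys f. scale (lookup f a) (single (swap_mono i a) 1))"
    by (simp add: linear_map_expand [OF linear_map_subst, of _ f] swap_vars_single del:
      scale_single)
  moreover have "swap_mono i a = m \<longleftrightarrow> a = swap_mono i m" for a by auto
  ultimately show ?thesis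
    by (auto simp: lookup_sum lookup_single when_def in_keys_iff)
qed

text \<open>The exchange does not respect the order in general. If the variable \<open>Suc i\<close>
  is absent on both sides, it merely renames the variable \<open>i\<close>, and no variable lies
  between the two.\<close>

lemma swap_mono_less:
  assumes "a \<prec> b" "lookup a (Suc i) = 0" "lookup b (Suc i) = 0"
  shows "swap_mono i a \<prec> swap_mono i b"
proof -
  obtain l where l: "lookup a l < lookup b l" "\<forall>j>l. lookup a j = lookup b j"
    using assms(1) by (auto simp: mono_less_def)
  have "l \<noteq> Suc i" using l(1) assms by auto
  then consider "l = i" | "l > Suc i" | "l < i" by linarith
  then show ?thesis
  proof cases
    case 1
    then show ?thesis unfolding mono_less_def using l
      by (intro exI [of _ "Suc i"]) (auto simp: lookup_swap_mono transpose_def)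
  next
    case 2
    then show ?thesis unfolding mono_less_def using l
      by (intro exI [of _ l]) (auto simp: lookup_swap_mono transpose_def)
  next
    case 3
    then show ?thesis unfolding mono_less_def using l assms(2,3)
      by (intro exI [of _ l]) (auto simp: lookup_swap_mono transpose_def)
  qed
qed

lemma is_lead_swap_vars:
  assumes "is_lead f a" "vars_in X f" "Suc i \<notin> X"
  shows "is_lead (swap_vars i f) (swap_mono i a)"
  unfolding is_lead_def
proof (intro conjI ballI impI)
  show "swap_mono i a \<in> keys (swap_vars i f)"
    using assms(1) by (simp add: is_lead_def in_keys_iff lookup_swap_vars)
  have zero: "lookup b (Suc i) = 0" if "b \<in> keys f" for b
    using that assms(2,3) unfolding vars_in_def by (meson in_keys_iff subsetD)
  fix b assume b: "b \<in> keys (swap_vars i f)" "b \<noteq> swap_mono i a"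
  then have "swap_mono i b \<in> keys f" "swap_mono i b \<noteq> a"
    by (auto simp: in_keys_iff lookup_swap_vars)
  then have "swap_mono i (swap_mono i b) \<prec> swap_mono i a"
    using assms(1) zero by (intro swap_mono_less) (auto simp: is_lead_def)
  then show "b \<prec> swap_mono i a" by simp
qed

abbreviation shift_var :: "nat \<Rightarrow> 'a::comm_ring_1 sym_alg \<Rightarrow> 'a sym_alg \<Rightarrow> 'a sym_alg" where
  "shift_var j v \<equiv> subst (\<lambda>i. if i = j then sym_gen j + v else sym_gen i)"

context galois_field
begin

text \<open>Otherwise the remainder \<open>s\<close> of \<open>i\<close> modulo \<open>q - 1\<close>
  is positive, and all \<open>q - 1\<close> nonzero elements are roots of \<open>X ^ s - 1\<close>,
  whose degree is less than \<open>q - 1\<close>.\<close>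

lemma dvd_of_power_eq_1:
  assumes "\<And>c :: 'a. c \<noteq> 0 \<Longrightarrow> c ^ i = 1"
  shows "(q - 1) dvd i"
proof (rule ccontr)
  assume "\<not> (q - 1) dvd i"
  define s where "s = i mod (q - 1)"
  have s: "0 < s" "s < q - 1"
    using \<open>\<not> (q - 1) dvd i\<close> q_ge_2 by (auto simp: s_def dvd_eq_mod_eq_0)
  have "c ^ s = 1" if "c \<noteq> 0" for c :: 'a
  proof -
    have "c ^ (q - 1) = 1" using that by (rule field_power_q_minus_1)
    then have "c ^ ((q - 1) * (i div (q - 1)) + s) = c ^ s"
      by (simp only: power_add power_mult power_one mult_1)
    then have "c ^ i = c ^ s" by (simp add: s_def)
    then show ?thesis using assms [OF that] by simp
  qed
  then have roots: "UNIV - {0} \<subseteq> {c :: 'a. poly (monom 1 s - 1) c = 0}"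
    by (auto simp: poly_monom)
  have nz: "monom 1 s - 1 \<noteq> (0 :: 'a poly)"
  proof
    assume "monom 1 s - 1 = (0 :: 'a poly)"
    then have "coeff (monom 1 s - 1 :: 'a poly) s = coeff 0 s" by simp
    then show False using s(1) by (simp add: coeff_1)
  qed
  have "card (UNIV - {0 :: 'a}) \<le> card {c :: 'a. poly (monom 1 s - 1) c = 0}"
    by (rule card_mono [OF poly_roots_finite [OF nz] roots])
  also have "\<dots> \<le> degree (monom 1 s - 1 :: 'a poly)" by (rule card_poly_roots_bound [OF nz])
  also have "\<dots> \<le> s" by (intro degree_diff_le degree_monom_le) simp
  finally show False using s(2) by (simp add: card_Diff_singleton card_field)
qed

text \<open>With \<open>y\<close> and \<open>z\<close> the values of \<open>dickson_fun i\<close> at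
  the variables \<open>i\<close> and \<open>Suc i\<close>, the orbit product is
  \<open>z ^ q - y ^ (q - 1) * z\<close>. The exchange interchanges \<open>y\<close> and
  \<open>z\<close>, and \<open>z ^ (q - 1) * y\<close> leads the result: the original leads with a
  pure power, whereas now a part of the exponent stays at \<open>i\<close>.\<close>

lemma is_lead_swap_orbit_product:
  "is_lead (swap_vars i (orbit_product (Suc i))) (single (Suc i) ((q - 1) * q ^ i) + single i (q ^
    i))"
proof -
  define y where "y = dickson_fun i (sym_gen i)"
  define z where "z = dickson_fun i (sym_gen (Suc i))"
  have "swap_vars i (dickson i b) = dickson i b" for b
    by (rule subst_id [OF vars_in_dickson]) auto
  then have f: "swap_vars i (dickson_fun i f) = dickson_fun i (swap_vars i f)" for f
    by (simp add: dickson_fun_def subst.hom_sum subst.hom_mult subst.hom_power)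
  have "orbit_product (Suc i) = z ^ q - y ^ (q - 1) * z"
    unfolding orbit_product_def dickson_fun_Suc y_def z_def by (simp add: orbit_product_def)
  then have eq: "swap_vars i (orbit_product (Suc i)) = - (z ^ (q - 1) * y) + y ^ q"
    by (simp add: subst.hom_minus subst.hom_mult subst.hom_power y_def z_def f)
  have y: "is_lead y (single i (q ^ i))" and z: "is_lead z (single (Suc i) (q ^ i))"
    unfolding y_def z_def by (rule is_lead_dickson_fun; simp)+
  have mono: "mono_scale j (single l d) = single l (j * d)" for j l d
    by (rule poly_mapping_eqI) (simp add: lookup_single when_def)
  have "is_lead (- (z ^ (q - 1) * y) + y ^ q) (single (Suc i) ((q - 1) * q ^ i) + single i (q ^ i))"
  proof (rule is_lead_add)
    show "is_lead (- (z ^ (q - 1) * y)) (single (Suc i) ((q - 1) * q ^ i) + single i (q ^ i))"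
      unfolding is_lead_uminus mono [symmetric] by (intro is_lead_mult is_lead_power y z)
    fix c assume c: "c \<in> keys (y ^ q)"
    have "single i (q * q ^ i) \<prec> single (Suc i) ((q - 1) * q ^ i) + single i (q ^ i)"
    proof (rule mono_less_topI [of _ "Suc i"])
      show "keys (single (Suc i) ((q - 1) * q ^ i) + single i (q ^ i)) \<subseteq> {..Suc i}"
        by (rule order.trans [OF keys_add]) auto
    qed (use q_ge_2 in \<open>auto simp: lookup_add lookup_single\<close>)
    then show "c \<prec> single (Suc i) ((q - 1) * q ^ i) + single i (q ^ i)"
      using is_lead_keys_less [OF is_lead_power [OF y, of q] _ c] by (simp add: mono)
  qed
  then show ?thesis by (simp add: eq)
qed

text \<open>
  The polynomials \<open>h b\<close> do not contain \<open>x\<^sub>j\<close>, so the leading monomials of the summands are distinct.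
\<close>

lemma translation_invariant_lead:
  fixes f :: "'a sym_alg"
  assumes f: "vars_in {..<n} f" "is_lead f e" and "j < n"
    and inv: "\<And>v. v \<in> lin_forms j \<Longrightarrow> shift_var j v f = f"
  obtains B h b \<rho> where "finite B" "f = (\<Sum>b\<in>B. h b * orbit_product j ^ b)"
    "\<And>b. b \<in> B \<Longrightarrow> h b \<noteq> 0" "\<And>b. b \<in> B \<Longrightarrow> vars_in ({..<n} - {j}) (h b)"
    "b \<in> B" "is_lead (h b) \<rho>" "e = \<rho> + single j (b * q ^ j)"
proof -
  define X where "X = {..<n} - {j}"
  define P where "P = to_poly j f"
  have f_P: "poly P (sym_gen j) = f" by (simp add: P_def poly_to_poly)
  have P_vars: "vars_in X (coeff P i)" for i
    unfolding P_def by (rule vars_in_coeff_to_poly) (use f(1) \<open>j < n\<close>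
      in \<open>simp_all add: X_def insert_absorb\<close>)
  have W_vars: "vars_in X v" if "v \<in> lin_forms j" for v
    by (rule vars_in_mono [OF vars_in_lin_forms [OF that]]) (use \<open>j < n\<close> in \<open>auto simp: X_def\<close>)
  \<comment> \<open>Translating the variable \<open>j\<close> by \<open>v\<close> becomes the
    substitution of \<open>X + v\<close> in the univariate polynomial; the equality is transferred
    by injectivity of the evaluation at \<open>sym_gen j\<close>.\<close>
  have P_inv: "pcompose P [:v, 1:] = P" if v: "v \<in> lin_forms j" for v
  proof (rule poly_sym_gen_inject [of X _ _ j])
    have "shift_var j v (coeff P i) = coeff P i" for i
      by (rule subst_id [OF P_vars]) (auto simp: X_def)
    then have "shift_var j v (poly P (sym_gen j))
        = poly P (sym_gen j + v)"
      by (simp add: poly_altdef subst.hom_sum subst.hom_mult subst.hom_power)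
    then show "poly (pcompose P [:v, 1:]) (sym_gen j) = poly P (sym_gen j)"
      using inv [OF v] by (simp add: f_P poly_pcompose add.commute)
    show "vars_in X (coeff (pcompose P [:v, 1:]) i)" for i
      using coeff_pcompose_in [of "{f. vars_in X f}" P "[:v, 1:]" i] P_vars W_vars [OF v]
      by (auto simp: vars_in_add vars_in_mult coeff_pCons split: nat.splits)
  qed (simp_all add: P_vars, simp add: X_def)
  have "vars_in X (dickson j b)" for b
    by (rule vars_in_mono [OF vars_in_dickson]) (use \<open>j < n\<close> in \<open>auto simp: X_def\<close>)
  then have T_vars: "vars_in X (coeff (translation_poly (lin_forms j)) i)" for i
    unfolding translation_poly_lin_forms q_poly_def coeff_sum coeff_monom
    by (intro vars_in_sum) simp
  have "\<exists>B h. P = (\<Sum>b<B. [:h b:] * translation_poly (lin_forms j) ^ b) \<and>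
    (\<forall>b<B. h b \<in> {f. vars_in X f})"
    by (rule translation_invariant_expansion)
      (simp_all add: zero_in_lin_forms add_in_lin_forms vars_in_diff vars_in_mult T_vars P_vars
        P_inv)
  then obtain B h where Br: "P = (\<Sum>b<B. [:h b:] * translation_poly (lin_forms j) ^ b)"
    "\<forall>b<B. vars_in X (h b)" by blast
  have "poly (translation_poly (lin_forms j)) (sym_gen j) = orbit_product j"
    by (simp add: translation_poly_lin_forms poly_q_poly orbit_product_def dickson_fun_def)
  then have "f = (\<Sum>b<B. h b * orbit_product j ^ b)"
    using f_P unfolding Br(1) by (simp add: poly_sum)
  \<comment> \<open>Zero coefficients are discarded, since every remaining one must have a leading
    exponent.\<close>
  also have "\<dots> = (\<Sum>b\<in>{b\<in>{..<B}. h b \<noteq> 0}. h b * orbit_product j ^ b)"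
    by (rule sum.mono_neutral_right) auto
  finally have f_sum: "f = (\<Sum>b\<in>{b\<in>{..<B}. h b \<noteq> 0}. h b * orbit_product j ^ b)" .
  define D where "D = {b\<in>{..<B}. h b \<noteq> 0}"
  have "\<forall>b\<in>D. \<exists>a. is_lead (h b) a" unfolding D_def by (blast intro: is_lead_exists)
  then obtain \<rho> where \<rho>: "\<And>b. b \<in> D \<Longrightarrow> is_lead (h b) (\<rho> b)" by metis
  define l where "l b = \<rho> b + single j (b * q ^ j)" for b
  have \<rho>j: "lookup (\<rho> b) j = 0" if "b \<in> D" for b
  proof -
    have "vars_in X (h b)" "\<rho> b \<in> keys (h b)" using Br(2) \<rho> [OF that] that
      by (auto simp: D_def is_lead_def)
    then have "j \<notin> keys (\<rho> b)" unfolding vars_in_def X_def by blast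
    then show ?thesis by (simp add: in_keys_iff)
  qed
  have "mono_scale b (single j (q ^ j)) = single j (b * q ^ j)" for b
    by (rule poly_mapping_eqI) (simp add: lookup_single when_def)
  then have lead: "is_lead (h b * orbit_product j ^ b) (l b)" if "b \<in> D" for b
    unfolding l_def using is_lead_mult [OF \<rho> [OF that] is_lead_power [OF is_lead_orbit_product, of
      j b]] by simp
  have inj: "inj_on l D"
  proof (rule inj_onI)
    fix b c assume "b \<in> D" "c \<in> D" "l b = l c"
    then have "lookup (l b) j = lookup (l c) j" by simp
    then show "b = c" using q_ge_2 \<rho>j [OF \<open>b \<in> D\<close>] \<rho>j [OF \<open>c \<in> D\<close>] by (simp add: l_def lookup_add)
  qed
  note f_sum = f_sum [folded D_def]
  have "D \<noteq> {}" using is_lead_nonzero [OF f(2)] f_sum by auto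
  have "finite D" by (simp add: D_def)
  from is_lead_sum [of D "\<lambda>b. h b * orbit_product j ^ b" l, OF this \<open>D \<noteq> {}\<close> lead inj]
  obtain b where b: "b \<in> D" "is_lead (\<Sum>b\<in>D. h b * orbit_product j ^ b) (l b)" by blast
  have e: "e = l b" using is_lead_unique [OF f(2)] b(2) f_sum by simp
  show ?thesis
  proof (rule that [of D h b "\<rho> b"])
    show "e = \<rho> b + single j (b * q ^ j)" using e by (simp add: l_def)
    show "h c \<noteq> 0" "vars_in ({..<n} - {j}) (h c)" if "c \<in> D" for c
      using that Br(2) by (simp_all add: D_def X_def)
  qed (use b(1) \<rho> f_sum \<open>finite D\<close> in blast)+
qed

text \<open>Expand \<open>f\<close> in powers of the orbit product of the variable
  \<open>Suc i\<close> and let the summand \<open>b\<close> lead, so that \<open>e\<close> has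
  exponent \<open>b * q ^ Suc i\<close> at \<open>Suc i\<close>. After the exchange the summands
  have distinct leading exponents \<open>l\<close>, told apart by the exponent
  \<open>b * q ^ i\<close> at \<open>i\<close>, so \<open>l b\<close> cannot exceed the leading
  exponent \<open>e\<close> of the exchanged polynomial. The two agree above \<open>Suc i\<close>,
  and at \<open>Suc i\<close> the comparison reads
  \<open>lookup e i + b * ((q - 1) * q ^ i) \<le> b * q ^ Suc i\<close>. What remains is
  \<open>lookup e i \<le> b * q ^ i\<close>.\<close>

lemma swap_invariant_lead:
  fixes f :: "'a sym_alg"
  assumes f: "vars_in {..<n} f" "is_lead f e" and "Suc i < n"
    and inv: "\<And>v. v \<in> lin_forms (Suc i) \<Longrightarrow>
      shift_var (Suc i) v f = f"
    and swap: "is_lead (swap_vars i f) e"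
  shows "q * lookup e i \<le> lookup e (Suc i)"
proof -
  obtain B h b \<rho> where Br: "finite B" "f = (\<Sum>b\<in>B. h b * orbit_product (Suc i) ^ b)"
    "\<And>b. b \<in> B \<Longrightarrow> h b \<noteq> 0" "\<And>b. b \<in> B \<Longrightarrow> vars_in ({..<n} - {Suc i}) (h b)"
    "b \<in> B" "is_lead (h b) \<rho>" "e = \<rho> + single (Suc i) (b * q ^ Suc i)"
    using translation_invariant_lead [OF f \<open>Suc i < n\<close> inv] by blast
  define \<mu> where "\<mu> = single (Suc i) ((q - 1) * q ^ i) + single i (q ^ i)"
  have sum: "swap_vars i f = (\<Sum>b\<in>B. swap_vars i (h b) * swap_vars i (orbit_product (Suc i)) ^ b)"
    unfolding Br(2) by (simp add: subst.hom_sum subst.hom_mult subst.hom_power)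
  have "\<forall>b\<in>B. \<exists>a. is_lead (h b) a" using is_lead_exists Br(3) by blast
  then obtain \<tau> where \<tau>: "\<And>b. b \<in> B \<Longrightarrow> is_lead (h b) (\<tau> b)" by metis
  define l where "l b = swap_mono i (\<tau> b) + mono_scale b \<mu>" for b
  have lead: "is_lead (swap_vars i (h b) * swap_vars i (orbit_product (Suc i)) ^ b) (l b)"
    if "b \<in> B" for b
    unfolding l_def \<mu>_def
    by (intro is_lead_mult is_lead_power is_lead_swap_orbit_product is_lead_swap_vars [OF \<tau> [OF
      that] Br(4) [OF that]]) simp
  have zero: "lookup (\<tau> b) (Suc i) = 0" if "b \<in> B" for b
  proof -
    have "\<tau> b \<in> keys (h b)" using \<tau> [OF that] by (simp add: is_lead_def)
    then have "Suc i \<notin> keys (\<tau> b)" using Br(4) [OF that] unfolding vars_in_def by blast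
    then show ?thesis by (simp add: in_keys_iff)
  qed
  have l_i: "lookup (l b) i = b * q ^ i" if "b \<in> B" for b
    using zero [OF that] by (simp add: l_def lookup_add lookup_swap_mono \<mu>_def lookup_single)
  have "inj_on l B"
  proof (rule inj_onI)
    fix b c assume "b \<in> B" "c \<in> B" "l b = l c"
    then have "b * q ^ i = c * q ^ i" using l_i by metis
    then show "b = c" using q_ge_2 by simp
  qed
  then obtain c where c: "c \<in> B" "is_lead (swap_vars i f) (l c)" "\<forall>b\<in>B. b \<noteq> c \<longrightarrow> l b \<prec> l c"
    using is_lead_sum [of B "\<lambda>b. swap_vars i (h b) * swap_vars i (orbit_product (Suc i)) ^ b" l]
      lead Br(1,5) unfolding sum by blast
  have "e = l c" using is_lead_unique [OF swap c(2)] .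
  then have le: "l b = e \<or> l b \<prec> e" using c(3) Br(5) by auto
  have "\<tau> b = \<rho>" using is_lead_unique [OF \<tau> [OF Br(5)] Br(6)] .
  \<comment> \<open>The exchange and \<open>\<mu>\<close> only touch the indices \<open>i\<close>
    and \<open>Suc i\<close>.\<close>
  then have above: "lookup (l b) j = lookup e j" if "Suc i < j" for j
    using that by (simp add: l_def Br(7) lookup_add lookup_swap_mono \<mu>_def lookup_single
      transpose_def)
  have "lookup (l b) (Suc i) \<le> lookup e (Suc i)"
    using le
  proof
    assume "l b \<prec> e"
    then obtain w where w: "lookup (l b) w < lookup e w" "\<forall>j>w. lookup (l b) j = lookup e j"
      by (auto simp: mono_less_def)
    then have "w \<le> Suc i" using above [of w] by (metis leI nat_neq_iff)
    then show ?thesis using w by (cases "w = Suc i") auto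
  qed simp
  moreover have "lookup (l b) (Suc i) = lookup e i + b * ((q - 1) * q ^ i)"
    using \<open>\<tau> b = \<rho>\<close> by (simp add: l_def Br(7) lookup_add lookup_swap_mono \<mu>_def lookup_single)
  moreover have "lookup e (Suc i) = b * q ^ Suc i"
    using zero [OF Br(5)] \<open>\<tau> b = \<rho>\<close> by (simp add: Br(7) lookup_add)
  moreover have "b * q ^ Suc i = b * ((q - 1) * q ^ i) + b * q ^ i"
    using q_pos by (cases q) (simp_all add: algebra_simps)
  ultimately have "lookup e i \<le> b * q ^ i" by linarith
  then have "q * lookup e i \<le> q * (b * q ^ i)" by simp
  also have "\<dots> = lookup e (Suc i)" using \<open>lookup e (Suc i) = b * q ^ Suc i\<close> by simp
  finally show ?thesis .
qed

end

section \<open>Semi-invariants of a parabolic subgroup\<close>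

definition scaling_mat :: "nat \<Rightarrow> nat \<Rightarrow> 'a::comm_ring_1 \<Rightarrow> 'a mat" where
  "scaling_mat n j c = mat n n (\<lambda>(a, b). if a = b then if a = j then c else 1 else 0)"

definition transvection_mat :: "nat \<Rightarrow> nat \<Rightarrow> (nat \<Rightarrow> 'a::comm_ring_1) \<Rightarrow> 'a mat" where
  "transvection_mat n j c = mat n n (\<lambda>(a, b). if a = b then 1 else if b = j \<and>
    a < j then c a else 0)"

definition swap_mat :: "nat \<Rightarrow> nat \<Rightarrow> 'a::comm_ring_1 mat" where
  "swap_mat n i = mat n n (\<lambda>(a, b). if a = transpose i (Suc i) b then 1 else 0)"

lemma det_scaling_mat: "j < n \<Longrightarrow> det (scaling_mat n j c) = c"
proof -
  assume "j < n"
  have "det (scaling_mat n j c) = prod_list (diag_mat (scaling_mat n j c))"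
    by (rule det_upper_triangular [of _ n]) (auto simp: scaling_mat_def upper_triangular_def)
  also have "\<dots> = (\<Prod>i\<in>set [0..<n]. if i = j then c else 1)"
    by (subst prod.distinct_set_conv_list) (auto simp: diag_mat_def scaling_mat_def intro!:
      arg_cong [of _ _ prod_list])
  also have "\<dots> = c" using \<open>j < n\<close> by simp
  finally show ?thesis .
qed

lemma det_transvection_mat: "det (transvection_mat n j c) = 1"
proof -
  have "det (transvection_mat n j c) = prod_list (diag_mat (transvection_mat n j c))"
    by (rule det_upper_triangular [of _ n]) (auto simp: transvection_mat_def upper_triangular_def)
  also have "\<dots> = (\<Prod>i\<in>set [0..<n]. 1)"
    by (subst prod.distinct_set_conv_list) (auto simp: diag_mat_def transvection_mat_def intro!:
      arg_cong [of _ _ prod_list])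
  also have "\<dots> = 1" by simp
  finally show ?thesis .
qed

lemma lookup_subst_scale:
  "lookup (subst (\<lambda>i. scale (a i) (sym_gen i)) f) m = (\<Prod>i\<in>keys m. a i ^ lookup m i) * lookup f m"
proof -
  have s: "subst (\<lambda>i. scale (a i) (sym_gen i)) (single m 1)
    = single m (\<Prod>i\<in>keys m. a i ^ lookup m i)" for m
  proof -
    have c: "(\<Prod>i\<in>X. single 0 (g i)) = (single 0 (prod g X) :: 'a sym_alg)" for g X
      by (induction X rule: infinite_finite_induct) (simp_all add: mult_single)
    have "subst (\<lambda>i. scale (a i) (sym_gen i)) (single m 1)
        = (\<Prod>i\<in>keys m. single 0 (a i ^ lookup m i)) * (\<Prod>i\<in>keys m. sym_gen i ^ lookup m i)"
      by (simp add: subst_def scale_conv_mult power_mult_distrib prod.distrib const_power)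
    then show ?thesis by (simp add: c mult_single flip: monomial_prod)
  qed
  have "subst (\<lambda>i. scale (a i) (sym_gen i)) f
      = (\<Sum>m\<in>keys f. scale (lookup f m) (single m (\<Prod>i\<in>keys m. a i ^ lookup m i)))"
    by (simp add: linear_map_expand [OF linear_map_subst, of _ f] s)
  then show ?thesis
    by (auto simp: lookup_sum lookup_single when_def in_keys_iff mult.commute)
qed

text \<open>\<open>M\<close> is the set of block boundaries. The block shape and the inverses make
  the explicit elements semi-invariant; diagonal matrices, transvections and exchanges within a
  block restrict the leading exponents. The exchange of \<open>i\<close> and \<open>Suc i\<close>
  stays inside a block exactly if \<open>Suc i\<close> is not a boundary.\<close>

locale parabolic_group = galois_field p r q F
  for p r q :: nat and F :: "'a::{field, finite} itself" +
  fixes n k :: nat and M :: "nat set" and G :: "'a mat set"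
  assumes k_pos: "1 \<le> k" and k_le: "k \<le> q - 2"
    and M: "M \<subseteq> {..n}" "0 \<in> M" "n \<in> M"
    and G_carrier: "g \<in> G \<Longrightarrow> g \<in> carrier_mat n n"
    and G_inverse: "g \<in> G \<Longrightarrow> \<exists>h\<in>carrier_mat n n. g * h = 1\<^sub>m n \<and> h * g = 1\<^sub>m n"
    and G_block: "g \<in> G \<Longrightarrow> m \<in> M \<Longrightarrow> b < m \<Longrightarrow> m \<le> a \<Longrightarrow> a < n \<Longrightarrow> g $$ (a, b) = 0"
    and G_scaling: "j < n \<Longrightarrow> c \<noteq> 0 \<Longrightarrow> scaling_mat n j c \<in> G"
    and G_transvection: "j < n \<Longrightarrow> transvection_mat n j d \<in> G"
    and G_swap: "Suc i < n \<Longrightarrow> Suc i \<notin> M \<Longrightarrow> swap_mat n i \<in> G"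
begin

lemma det_nonzero: "g \<in> G \<Longrightarrow> det g \<noteq> 0"
proof -
  assume g: "g \<in> G"
  then obtain h where h: "h \<in> carrier_mat n n" "g * h = 1\<^sub>m n" using G_inverse by blast
  then have "det g * det h = 1" using det_mult [OF G_carrier [OF g] h(1)] by simp
  then show ?thesis by auto
qed

lemma sym_act_eq_subst: "g \<in> carrier_mat n n \<Longrightarrow>
  sym_act (g :: 'a mat) = subst (\<lambda>j. lin_form n (\<lambda>l. g $$ (l, j)))"
  by (simp add: sym_act_subst lin_form_def)

lemma comm_ring_hom_sym_act: "comm_ring_hom (sym_act g)"
  unfolding sym_act_subst by (rule subst_hom)

lemma sym_act_lin_form:
  fixes g :: "'a mat"
  assumes "g \<in> carrier_mat n n" "m \<le> n"
  shows "sym_act g (lin_form m c) = lin_form n (\<lambda>l. \<Sum>j<m. g $$ (l, j) * c j)"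
proof -
  have "sym_act g (lin_form m c) = (\<Sum>j<m. \<Sum>l<n. scale (c j * g $$ (l, j)) (sym_gen l))"
    by (simp add: sym_act_eq_subst [OF assms(1)] lin_form_def linear_map_sum [OF linear_map_subst]
        subst_scale scale_sum)
  also have "\<dots> = (\<Sum>l<n. \<Sum>j<m. scale (g $$ (l, j) * c j) (sym_gen l))"
    by (subst sum.swap) (simp add: mult.commute)
  finally show ?thesis by (simp add: lin_form_def scale_sum_left)
qed

text \<open>The restriction to the first \<open>n\<close> variables is essential for the encoding:
  at larger indices the action reads matrix entries that are unspecified.\<close>

lemma sym_act_mult:
  fixes g h :: "'a mat"
  assumes "g \<in> carrier_mat n n" "h \<in> carrier_mat n n" "vars_in {..<n} f"
  shows "sym_act g (sym_act h f) = sym_act (g * h) f"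
proof -
  have "sym_act g (lin_form n (\<lambda>l. h $$ (l, j))) = lin_form n (\<lambda>l. (g * h) $$ (l, j))" if "j < n"
    for j
    using assms(1,2) that
    by (simp add: sym_act_lin_form lin_form_eq_iff scalar_prod_def lessThan_atLeast0)
  note lin = this
  have "sym_act g (sym_act h f) = subst (\<lambda>j. sym_act g (lin_form n (\<lambda>l. h $$ (l, j)))) f"
    unfolding sym_act_eq_subst [OF assms(1)] sym_act_eq_subst [OF assms(2)] by (rule subst_subst)
  also have "\<dots> = subst (\<lambda>j. lin_form n (\<lambda>l. (g * h) $$ (l, j))) f"
    by (rule subst_cong [OF assms(3)]) (simp only: lin lessThan_iff)
  also have "\<dots> = sym_act (g * h) f"
    using assms(1,2) by (subst sym_act_eq_subst) auto
  finally show ?thesis .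
qed

lemma sym_act_one: "vars_in {..<n} f \<Longrightarrow> sym_act (1\<^sub>m n) f = (f :: 'a sym_alg)"
proof -
  assume f: "vars_in {..<n} f"
  have "lin_form n (\<lambda>l. 1\<^sub>m n $$ (l, j)) = (sym_gen j :: 'a sym_alg)" if "j < n" for j
  proof -
    have "lin_form n (\<lambda>l. 1\<^sub>m n $$ (l, j)) = (\<Sum>l<n. if l = j then sym_gen j else 0)"
      unfolding lin_form_def using that by (intro sum.cong) auto
    then show ?thesis using that by simp
  qed
  then show ?thesis unfolding sym_act_eq_subst [OF one_carrier_mat] by (intro subst_id [OF f]) simp
qed

text \<open>Block triangularity preserves the span of the first \<open>m\<close> variables, the
  inverse makes the map injective there, and an injection of a finite set into itself is
  onto.\<close>

lemma sym_act_lin_forms: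
  assumes g: "g \<in> G" and m: "m \<in> M"
  shows "sym_act g ` lin_forms m = lin_forms m"
proof (rule endo_inj_surj)
  have mn: "m \<le> n" using m M(1) by auto
  show "sym_act g ` lin_forms m \<subseteq> lin_forms m"
  proof
    fix v assume "v \<in> sym_act g ` lin_forms m"
    then obtain c where v: "v = sym_act g (lin_form m c)" unfolding lin_forms_def by blast
    define d where "d l = (\<Sum>j<m. g $$ (l, j) * c j)" for l
    have "d l = 0" if "l \<in> {..<n} - {..<m}" for l
      unfolding d_def using that G_block [OF g m] by (intro sum.neutral) auto
    then have "lin_form n d = lin_form m d"
      unfolding lin_form_def using mn by (intro sum.mono_neutral_right) auto
    then show "v \<in> lin_forms m"
      unfolding v sym_act_lin_form [OF G_carrier [OF g] mn] d_def [symmetric]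
        by (simp add: lin_forms_def)
  qed
  obtain h where h: "h \<in> carrier_mat n n" "h * g = 1\<^sub>m n" using G_inverse [OF g] by blast
  show "inj_on (sym_act g) (lin_forms m)"
  proof (rule inj_on_inverseI)
    fix v assume "v \<in> lin_forms m"
    then have v: "vars_in {..<n} v" using vars_in_mono [OF vars_in_lin_forms] mn by blast
    show "sym_act h (sym_act g v) = v"
      using sym_act_mult [OF h(1) G_carrier [OF g] v] sym_act_one [OF v] by (simp add: h(2))
  qed
qed simp

lemma sym_act_dickson: "g \<in> G \<Longrightarrow> m \<in> M \<Longrightarrow> b \<le> m \<Longrightarrow> sym_act g (dickson m b) = dickson m b"
  by (rule hom_dickson [OF comm_ring_hom_sym_act sym_act_lin_forms])

text \<open>Taking \<open>q ^ a\<close>-th powers is additive and fixes the field, so the linear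
  substitution acts on every row of the Moore matrix by the same matrix \<open>g\<close>.\<close>

lemma map_moore_mat:
  fixes g :: "'a mat"
  assumes "g \<in> carrier_mat n n"
  shows "map_mat (sym_act g) (moore_mat n) = moore_mat n * map_mat (single 0) g"
proof (rule eq_matI)
  fix a j assume "a < dim_row (moore_mat n * map_mat (single 0) g)"
    "j < dim_col (moore_mat n * map_mat (single 0) g)"
  then have aj: "a < n" "j < n" using assms moore_mat_carrier [of n] by auto
  interpret \<sigma>: comm_ring_hom "sym_act g" by (rule comm_ring_hom_sym_act)
  have "sym_act g (sym_gen j ^ (q ^ a)) = (\<Sum>l<n. scale (g $$ (l, j)) (sym_gen l)) ^ (q ^ a)"
    unfolding \<sigma>.hom_power using assms by (simp add: sym_act_eq_subst lin_form_def)
  also have "\<dots> = (\<Sum>l<n. scale (g $$ (l, j)) (sym_gen l) ^ (q ^ a))"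
    by (rule freshmans_dream_sum' [where n = "r * a"]) (simp_all add: CHAR_sym_alg prime_p q_def
      power_mult)
  also have "\<dots> = (\<Sum>l<n. sym_gen l ^ (q ^ a) * single 0 (g $$ (l, j)))"
    by (simp add: scale_conv_mult power_mult_distrib frobenius_const mult.commute)
  finally show "map_mat (sym_act g) (moore_mat n) $$ (a, j)
    = (moore_mat n * map_mat (single 0) g) $$ (a, j)"
    using aj assms by (simp add: moore_mat_def scalar_prod_def lessThan_atLeast0)
qed (use assms carrier_matD [OF moore_mat_carrier [of n]] in auto)

lemma sym_act_moore_det:
  fixes g :: "'a mat"
  assumes "g \<in> carrier_mat n n"
  shows "sym_act g (moore_det n) = scale (det g) (moore_det n)"
proof -
  interpret \<sigma>: comm_ring_hom "sym_act g" by (rule comm_ring_hom_sym_act)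
  interpret c: comm_ring_hom "\<lambda>c. single 0 c :: 'a sym_alg" by (rule const_hom)
  have "sym_act g (moore_det n) = det (map_mat (sym_act g) (moore_mat n))"
    by (simp add: moore_det_def)
  also have "\<dots> = moore_det n * det (map_mat (\<lambda>c. single 0 c :: 'a sym_alg) g)"
    unfolding map_moore_mat [OF assms] moore_det_def using assms by (intro det_mult) auto
  also have "det (map_mat (\<lambda>c. single 0 c :: 'a sym_alg) g) = single 0 (det g)" by (rule c.hom_det)
  finally show ?thesis by (simp add: scale_conv_mult mult.commute)
qed

definition semi_invariant :: "'a sym_alg \<Rightarrow> bool" where
  "semi_invariant f \<longleftrightarrow> vars_in {..<n} f \<and> (\<forall>g\<in>G. scale (det g ^ k) (sym_act g f) = f)"

text \<open>The diagonal matrix with entry \<open>c\<close> at \<open>j\<close> multiplies the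
  monomial \<open>m\<close> by \<open>c ^ (k + lookup m j)\<close>; the summand \<open>k\<close>
  comes from the determinant.\<close>

lemma semi_invariant_dvd:
  assumes f: "semi_invariant f" and m: "m \<in> keys f" and j: "j < n"
  shows "(q - 1) dvd k + lookup m j"
proof (rule dvd_of_power_eq_1)
  fix c :: 'a assume "c \<noteq> 0"
  define g where "g = scaling_mat n j c"
  have g: "g \<in> G" unfolding g_def by (rule G_scaling [OF j \<open>c \<noteq> 0\<close>])
  have "lin_form n (\<lambda>l. g $$ (l, i)) = scale (if i = j then c else 1) (sym_gen i)" if "i < n" for i
  proof -
    have "lin_form n (\<lambda>l. g $$ (l, i)) = (\<Sum>l<n. if l = i then scale (if i
      = j then c else 1) (sym_gen i) else 0)"
      unfolding lin_form_def using that by (intro sum.cong) (auto simp: g_def scaling_mat_def)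
    then show ?thesis using that by simp
  qed
  then have "sym_act g f = subst (\<lambda>i. scale (if i = j then c else 1) (sym_gen i)) f"
    unfolding sym_act_eq_subst [OF G_carrier [OF g]]
    using f by (intro subst_cong [of "{..<n}"]) (auto simp: semi_invariant_def)
  moreover have "(\<Prod>i\<in>keys m. (if i = j then c else 1) ^ lookup m i) = c ^ lookup m j"
  proof -
    have "(\<Prod>i\<in>keys m. (if i = j then c else 1) ^ lookup m i) = (\<Prod>i\<in>keys m. if i
      = j then c ^ lookup m j else 1)"
      by (intro prod.cong) auto
    then show ?thesis by (auto simp: in_keys_iff)
  qed
  ultimately have "lookup (sym_act g f) m = c ^ lookup m j * lookup f m"
    by (simp add: lookup_subst_scale)
  moreover have "scale (det g ^ k) (sym_act g f) = f" using f g by (simp add: semi_invariant_def)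
  ultimately have "c ^ k * (c ^ lookup m j * lookup f m) = lookup f m"
    by (metis det_scaling_mat g_def j lookup_scale)
  then have "c ^ (k + lookup m j) * lookup f m = 1 * lookup f m" by (simp add: power_add mult.assoc)
  then show "c ^ (k + lookup m j) = 1" using m by (simp add: in_keys_iff)
qed

lemma semi_invariant_translation:
  assumes f: "semi_invariant f" and v: "v \<in> lin_forms j" and j: "j < n"
  shows "shift_var j v f = f"
proof -
  obtain c where c: "v = lin_form j c" using v by (auto simp: lin_forms_def)
  define g where "g = transvection_mat n j c"
  have g: "g \<in> G" unfolding g_def by (rule G_transvection [OF j])
  have "lin_form n (\<lambda>l. g $$ (l, i)) = (if i = j then sym_gen j + v else sym_gen i)" if "i < n"
    for i
  proof -
    have "lin_form n (\<lambda>l. g $$ (l, i)) = (\<Sum>l<n. (if l = i then sym_gen i else 0) +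
        (if i = j \<and> l < j then scale (c l) (sym_gen l) else 0))"
      unfolding lin_form_def using that by (intro sum.cong) (auto simp: g_def transvection_mat_def)
    also have "\<dots> = sym_gen i + (\<Sum>l<n. if i = j \<and> l < j then scale (c l) (sym_gen l) else 0)"
      using that by (simp add: sum.distrib)
    also have "(\<Sum>l<n. if i = j \<and> l < j then scale (c l) (sym_gen l) else 0) = (if i
      = j then v else 0)"
      unfolding c lin_form_def using j by (auto intro!: sum.mono_neutral_cong_right split:
        if_splits)
    finally show ?thesis by simp
  qed
  then have "sym_act g f = shift_var j v f"
    unfolding sym_act_eq_subst [OF G_carrier [OF g]]
    using f by (intro subst_cong [of "{..<n}"]) (auto simp: semi_invariant_def)
  moreover have "scale (det g ^ k) (sym_act g f) = f" using f g by (simp add: semi_invariant_def)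
  ultimately show ?thesis by (simp add: g_def det_transvection_mat)
qed

text \<open>The power of the determinant is a nonzero scalar, so it does not affect the leading
  exponent.\<close>

lemma semi_invariant_swap:
  assumes f: "semi_invariant f" and lead: "is_lead f e" and i: "Suc i < n" "Suc i \<notin> M"
  shows "is_lead (swap_vars i f) e"
proof -
  define g :: "'a mat" where "g = swap_mat n i"
  have g: "g \<in> G" unfolding g_def by (rule G_swap [OF i])
  have "lin_form n (\<lambda>l. g $$ (l, j)) = sym_gen (transpose i (Suc i) j)" if "j < n" for j
  proof -
    have t: "transpose i (Suc i) j < n" using that i by (simp add: transpose_def)
    have "lin_form n (\<lambda>l. g $$ (l, j)) = (\<Sum>l<n. if l
      = transpose i (Suc i) j then sym_gen (transpose i (Suc i) j) else 0)"
      unfolding lin_form_def using that by (intro sum.cong) (auto simp: g_def swap_mat_def)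
    then show ?thesis using t by simp
  qed
  then have "sym_act g f = swap_vars i f"
    unfolding sym_act_eq_subst [OF G_carrier [OF g]]
    using f by (intro subst_cong [of "{..<n}"]) (auto simp: semi_invariant_def)
  moreover have "scale (det g ^ k) (sym_act g f) = f" using f g by (simp add: semi_invariant_def)
  ultimately have "is_lead (scale (det g ^ k) (swap_vars i f)) e" using lead by simp
  then show ?thesis using is_lead_scale [of "det g ^ k" "swap_vars i f" e] det_nonzero [OF g]
    by simp
qed

section \<open>The exponents that can lead a semi-invariant\<close>

definition block_end :: "nat \<Rightarrow> nat" where
  "block_end b = (LEAST m. m \<in> M \<and> b < m)"

lemma block_end: "b < n \<Longrightarrow> block_end b \<in> M \<and> b < block_end b"
  unfolding block_end_def by (rule LeastI [of _ n]) (simp add: M(3))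

lemma block_end_le: "m \<in> M \<Longrightarrow> b < m \<Longrightarrow> block_end b \<le> m"
  unfolding block_end_def by (rule Least_le) simp

lemma block_end_le_n: "b < n \<Longrightarrow> block_end b \<le> n"
  using block_end M(1) by blast

text \<open>The indices in the sum are those of the block of \<open>j\<close> up to
  \<open>j\<close>: exactly the \<open>b\<close> for which
  \<open>dickson_mono (block_end b) b\<close> involves the variable \<open>j\<close>.\<close>

definition block_sum :: "(nat \<Rightarrow>\<^sub>0 nat) \<Rightarrow> nat \<Rightarrow> nat" where
  "block_sum \<alpha> j = (\<Sum>b\<in>{b. b \<le> j \<and> j < block_end b}. lookup \<alpha> b)"

text \<open>A running sum that restarts at every block boundary.\<close>

lemma block_sum_rec:
  assumes "j < n"
  shows "block_sum \<alpha> j = lookup \<alpha> j + (if j \<in> M then 0 else block_sum \<alpha> (j - 1))"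
proof -
  have jj: "j < block_end j" using block_end [OF assms] by simp
  show ?thesis
  proof (cases "j \<in> M")
    case True
    have "{b. b \<le> j \<and> j < block_end b} = {j}"
      using jj block_end_le [OF True] by (fastforce simp: le_less dest: leD)
    then show ?thesis using True by (simp add: block_sum_def)
  next
    case False
    have j: "j > 0" using False M(2) by (cases j) auto
    have "{b. b \<le> j \<and> j < block_end b} = insert j {b. b \<le> j - 1 \<and> j - 1 < block_end b}"
    proof -
      have "j < block_end b \<longleftrightarrow> j - 1 < block_end b" if "b \<le> j - 1" for b
      proof -
        have "b < n" using that assms by simp
        then have "block_end b \<noteq> j" using block_end [of b] False by auto
        then show ?thesis using j by linarith
      qed
      then show ?thesis using jj j by auto
    qed
    moreover have "j \<notin> {b. b \<le> j - 1 \<and> j - 1 < block_end b}" using j by auto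
    ultimately show ?thesis using False by (simp add: block_sum_def)
  qed
qed

definition semi_mono :: "(nat \<Rightarrow>\<^sub>0 nat) \<Rightarrow> (nat \<Rightarrow>\<^sub>0 nat)" where
  "semi_mono \<alpha> = mono_scale (q - 1 - k) (moore_mono n)
     + (\<Sum>b<n. mono_scale (lookup \<alpha> b) (dickson_mono (block_end b) b))"

lemma lookup_semi_mono:
  "lookup (semi_mono \<alpha>) j = (if j < n then q ^ j * ((q - 1 - k) + (q - 1) * block_sum \<alpha> j) else 0)"
proof (cases "j < n")
  case True
  have "(\<Sum>b<n. lookup \<alpha> b * lookup (dickson_mono (block_end b) b) j)
      = (\<Sum>b\<in>{b. b \<le> j \<and> j < block_end b}. lookup \<alpha> b * ((q - 1) * q ^ j))"
    using True by (intro sum.mono_neutral_cong_right) (auto simp: lookup_dickson_mono)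
  also have "\<dots> = q ^ j * ((q - 1) * block_sum \<alpha> j)"
    by (simp add: block_sum_def sum_distrib_left mult_ac)
  finally show ?thesis
    using True by (simp add: semi_mono_def lookup_add lookup_sum lookup_moore_mono distrib_left
      mult.commute)
next
  case False
  then have "lookup (dickson_mono (block_end b) b) j = 0" if "b < n" for b
    using block_end_le_n [OF that] by (simp add: lookup_dickson_mono)
  then show ?thesis using False by (simp add: semi_mono_def lookup_add lookup_sum lookup_moore_mono)
qed

text \<open>The exponents determine the running sums, and the differences of these are the
  entries.\<close>

lemma semi_mono_inject:
  assumes "semi_mono \<alpha> = semi_mono \<beta>" "keys \<alpha> \<subseteq> {..<n}" "keys \<beta> \<subseteq> {..<n}"
  shows "\<alpha> = \<beta>"
proof (rule poly_mapping_eqI)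
  fix b
  have s: "block_sum \<alpha> j = block_sum \<beta> j" if "j < n" for j
    using arg_cong [OF assms(1), of "\<lambda>m. lookup m j"] that q_ge_2 by (simp add: lookup_semi_mono)
  show "lookup \<alpha> b = lookup \<beta> b"
  proof (cases "b < n")
    case True
    then show ?thesis
      using block_sum_rec [OF True, of \<alpha>] block_sum_rec [OF True, of \<beta>] s [of b] s [of "b - 1"]
      by (auto split: if_splits)
  next
    case False
    then have "b \<notin> keys \<alpha>" "b \<notin> keys \<beta>" using assms(2,3) by auto
    then show ?thesis by (simp add: in_keys_iff)
  qed
qed

text \<open>Translations and diagonal matrices give every exponent the form
  \<open>q ^ j * ((q - 1 - k) + (q - 1) * t j)\<close>, and the exchanges make \<open>t\<close>
  nondecreasing within each block. Its differences, restarted at the boundaries, are therefore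
  genuine natural numbers with running sum \<open>t\<close>; they form
  \<open>\<alpha>\<close>.\<close>

lemma semi_invariant_lead:
  assumes f: "semi_invariant f" "is_lead f e"
  shows "\<exists>\<alpha>. keys \<alpha> \<subseteq> {..<n} \<and> e = semi_mono \<alpha>"
proof -
  have vars: "vars_in {..<n} f" using f(1) by (simp add: semi_invariant_def)
  have "\<exists>t. lookup e j = q ^ j * ((q - 1 - k) + (q - 1) * t)" if j: "j < n" for j
  proof -
    obtain B h b \<rho> where *: "finite B" "f = (\<Sum>b\<in>B. h b * orbit_product j ^ b)"
        "\<And>b. b \<in> B \<Longrightarrow> h b \<noteq> 0" "\<And>b. b \<in> B \<Longrightarrow> vars_in ({..<n} - {j}) (h b)"
        "b \<in> B" "is_lead (h b) \<rho>" "e = \<rho> + single j (b * q ^ j)"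
      using translation_invariant_lead [OF vars f(2) j semi_invariant_translation [OF f(1) _ j]]
        by blast
    have "\<rho> \<in> keys (h b)" using *(6) by (simp add: is_lead_def)
    then have "j \<notin> keys \<rho>" using *(4) [OF *(5)] unfolding vars_in_def by blast
    then have e: "lookup e j = b * q ^ j" using *(7) by (simp add: lookup_add in_keys_iff)
    have "(q - 1) dvd k + b * q ^ j"
      using semi_invariant_dvd [OF f(1) _ j, of e] f(2) e by (simp add: is_lead_def)
    \<comment> \<open>Modulo \<open>q - 1\<close> the factor \<open>q ^ j\<close> is 1, so the
      divisibility will pass from \<open>k + b * q ^ j\<close> to \<open>k + b\<close>.\<close>
    moreover have "\<exists>u. q ^ j = 1 + (q - 1) * u"
    proof (induction j)
      case (Suc j)
      then obtain u where "q ^ j = 1 + (q - 1) * u" by blast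
      then have "q ^ Suc j = 1 + (q - 1) * (1 + q * u)"
        using q_pos by (cases q) (simp_all add: algebra_simps)
      then show ?case by blast
    qed (simp add: exI [of _ 0])
    ultimately obtain u where u: "(q - 1) dvd k + b * q ^ j" "q ^ j = 1 + (q - 1) * u" by blast
    have "k + b * q ^ j = (k + b) + (q - 1) * (b * u)"
      unfolding u(2) by (simp only: distrib_left mult_1_right ac_simps)
    then have "(q - 1) dvd k + b"
      using u(1) by (metis dvd_add_left_iff dvd_triv_left)
    then obtain t where t: "k + b = (q - 1) * t" by (rule dvdE)
    \<comment> \<open>Positivity of \<open>k\<close> rules out \<open>t = 0\<close>, so one multiple
      of \<open>q - 1\<close> can be set aside to make \<open>q - 1 - k\<close> appear.\<close>
    then obtain t' where t': "t = Suc t'" using k_pos by (cases t) auto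
    have "b = (q - 1 - k) + (q - 1) * t'" using t k_le unfolding t' by simp
    then show ?thesis using e by (auto simp: mult.commute)
  qed
  then obtain t where t: "\<And>j. j < n \<Longrightarrow> lookup e j = q ^ j * ((q - 1 - k) + (q - 1) * t j)" by metis
  have t_mono: "t (j - 1) \<le> t j" if j: "j < n" "j \<notin> M" for j
  proof -
    obtain i where i: "j = Suc i" using j M(2) by (cases j) auto
    have "q * lookup e i \<le> lookup e (Suc i)"
      using j unfolding i
      by (intro swap_invariant_lead [OF vars f(2)] semi_invariant_translation [OF f(1)]
          semi_invariant_swap [OF f]) simp_all
    then have "q ^ Suc i * ((q - 1 - k) + (q - 1) * t i)
      \<le> q ^ Suc i * ((q - 1 - k) + (q - 1) * t (Suc i))"
      using t [of i] t [of "Suc i"] j i by (simp add: mult.assoc)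
    then show ?thesis using q_ge_2 by (simp add: i)
  qed
  define \<alpha> where "\<alpha> = (\<Sum>b<n. single b (t b - (if b \<in> M then 0 else t (b - 1))))"
  have lookup_\<alpha>: "lookup \<alpha> b = (if b < n then t b - (if b \<in> M then 0 else t (b - 1)) else 0)" for b
    by (simp add: \<alpha>_def lookup_sum lookup_single when_def)
  have sum: "block_sum \<alpha> j = t j" if "j < n" for j
    using that
  proof (induction j)
    case 0
    then show ?case by (simp add: block_sum_rec lookup_\<alpha> M(2))
  next
    case (Suc j)
    then show ?case using t_mono [of "Suc j"] by (simp add: block_sum_rec lookup_\<alpha>)
  qed
  have "e = semi_mono \<alpha>"
  proof (rule poly_mapping_eqI)
    fix j
    show "lookup e j = lookup (semi_mono \<alpha>) j"
    proof (cases "j < n")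
      case False
      have "e \<in> keys f" using f(2) by (simp add: is_lead_def)
      then have "j \<notin> keys e" using vars False unfolding vars_in_def by auto
      then show ?thesis using False by (simp add: lookup_semi_mono in_keys_iff)
    qed (simp add: t sum lookup_semi_mono)
  qed
  moreover have "keys \<alpha> \<subseteq> {..<n}" by (auto simp: in_keys_iff lookup_\<alpha> split: if_splits)
  ultimately show ?thesis by blast
qed

section \<open>Explicit semi-invariants\<close>

definition dickson_prod :: "(nat \<Rightarrow>\<^sub>0 nat) \<Rightarrow> 'a sym_alg" where
  "dickson_prod \<alpha> = (\<Prod>b<n. dickson (block_end b) b ^ lookup \<alpha> b)"

definition dickson_degree :: "(nat \<Rightarrow>\<^sub>0 nat) \<Rightarrow> nat" where
  "dickson_degree \<alpha> = (\<Sum>b<n. (q ^ block_end b - q ^ b) * lookup \<alpha> b)"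

text \<open>The power of \<open>moore_det n\<close> contributes \<open>det g ^ (q - 1 - k)\<close>,
  which cancels against \<open>det g ^ k\<close> because nonzero scalars satisfy
  \<open>c ^ (q - 1) = 1\<close>.\<close>

definition semi_elem :: "(nat \<Rightarrow>\<^sub>0 nat) \<Rightarrow> 'a sym_alg" where
  "semi_elem \<alpha> = moore_det n ^ (q - 1 - k) * dickson_prod \<alpha>"

lemma is_lead_semi_elem: "is_lead (semi_elem \<alpha>) (semi_mono \<alpha>)"
  unfolding semi_elem_def semi_mono_def dickson_prod_def
  by (intro is_lead_mult is_lead_power is_lead_prod is_lead_moore_det is_lead_dickson)
    (use block_end less_imp_le in auto)

lemma homog_dickson_prod: "homog (dickson_degree \<alpha>) (dickson_prod \<alpha>)"
  unfolding dickson_degree_def dickson_prod_def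
  by (intro homog_prod homog_power homog_dickson) (use block_end less_imp_le in auto)

lemma homog_semi_elem:
  "homog ((\<Sum>a<n. q ^ a) * (q - 1 - k) + dickson_degree \<alpha>) (semi_elem \<alpha>)"
  unfolding semi_elem_def by (intro homog_mult homog_power homog_moore_det homog_dickson_prod)

lemma vars_in_dickson_prod: "vars_in {..<n} (dickson_prod \<alpha>)"
  unfolding dickson_prod_def
  by (intro vars_in_prod vars_in_power vars_in_mono [OF vars_in_dickson]) (use block_end_le_n
    in auto)

lemma semi_invariant_semi_elem: "semi_invariant (semi_elem \<alpha>)"
  unfolding semi_invariant_def
proof (intro conjI ballI)
  show "vars_in {..<n} (semi_elem \<alpha>)"
    unfolding semi_elem_def by (intro vars_in_mult vars_in_power vars_in_moore_det
      vars_in_dickson_prod)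
  fix g assume g: "g \<in> G"
  interpret \<sigma>: comm_ring_hom "sym_act g" by (rule comm_ring_hom_sym_act)
  have "sym_act g (dickson_prod \<alpha>) = dickson_prod \<alpha>"
    unfolding dickson_prod_def \<sigma>.hom_prod \<sigma>.hom_power
    by (intro prod.cong refl arg_cong2 [of _ _ _ _ power] sym_act_dickson [OF g])
      (use block_end less_imp_le in auto)
  then have "sym_act g (semi_elem \<alpha>) = scale (det g) (moore_det n) ^ (q - 1 - k) * dickson_prod \<alpha>"
    by (simp add: semi_elem_def \<sigma>.hom_mult \<sigma>.hom_power sym_act_moore_det [OF G_carrier [OF g]])
  also have "scale (det g) (moore_det n) ^ (q - 1 - k)
    = scale (det g ^ (q - 1 - k)) (moore_det n ^ (q - 1 - k))"
    by (simp add: scale_conv_mult power_mult_distrib const_power)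
  finally have "sym_act g (semi_elem \<alpha>) = scale (det g ^ (q - 1 - k)) (semi_elem \<alpha>)"
    by (simp add: semi_elem_def scale_conv_mult mult.assoc)
  moreover have "det g ^ k * det g ^ (q - 1 - k) = 1"
  proof -
    have "k + (q - 1 - k) = q - 1" using k_le by simp
    then show ?thesis using field_power_q_minus_1 [OF det_nonzero [OF g]] by (metis power_add)
  qed
  ultimately show "scale (det g ^ k) (sym_act g (semi_elem \<alpha>)) = semi_elem \<alpha>" by simp
qed

end

section \<open>The dimension of the spaces of invariants\<close>

text \<open>The vectors \<open>w\<close> bound the dimension from below and the functionals
  \<open>l\<close> from above, since the matrix of the values \<open>l \<tau> (w \<sigma>)\<close>
  is triangular with nonzero diagonal. The order \<open>R\<close> may be partial; the entries of
  incomparable distinct indices vanish.\<close>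

lemma (in vector_space) dim_eq_card_triangular:
  fixes w :: "'i \<Rightarrow> 'b" and l :: "'i \<Rightarrow> 'b \<Rightarrow> 'a"
  assumes V: "subspace V" and T: "finite T" and w: "\<And>\<tau>. \<tau> \<in> T \<Longrightarrow> w \<tau> \<in> V"
    and l: "\<And>\<tau> x y. l \<tau> (x + y) = l \<tau> x + l \<tau> y" "\<And>\<tau> c x. l \<tau> (scale c x) = c * l \<tau> x"
    and inj: "\<And>x. x \<in> V \<Longrightarrow> (\<And>\<tau>. \<tau> \<in> T \<Longrightarrow> l \<tau> x = 0) \<Longrightarrow> x = 0"
    and R: "asymp R" "transp R"
    and tri: "\<And>\<tau>. \<tau> \<in> T \<Longrightarrow> l \<tau> (w \<tau>) \<noteq> 0"
      "\<And>\<sigma> \<tau>. \<sigma> \<in> T \<Longrightarrow> \<tau> \<in> T \<Longrightarrow> \<sigma> \<noteq> \<tau> \<Longrightarrow> \<not> R \<tau> \<sigma> \<Longrightarrow> l \<tau> (w \<sigma>) = 0"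
  shows "dim V = card T"
proof -
  have l0: "l \<tau> 0 = 0" for \<tau> using l(2) [of \<tau> 0 0] by simp
  have l_sum: "l \<tau> (sum f X) = (\<Sum>x\<in>X. l \<tau> (f x))" for \<tau> f and X :: "'i set"
    by (induction X rule: infinite_finite_induct) (simp_all add: l l0)
  have l_diff: "l \<tau> (x - y) = l \<tau> x - l \<tau> y" for \<tau> x y
    using l(1) [of \<tau> "x - y" y] by simp
  have R': "asymp_on A R" "transp_on A R" for A
    using R by (auto intro: asymp_on_subset transp_on_subset)
  \<comment> \<open>The index \<open>\<tau>0\<close> split off in the induction is minimal for
    \<open>R\<close>, so \<open>w \<tau>0\<close> corrects its own functional without disturbing the
    others.\<close>
  have approx: "\<exists>u\<in>span (w ` T'). \<forall>\<tau>\<in>T'. l \<tau> (x - u) = 0" if "finite T'" "T' \<subseteq> T" for T' x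
    using that
  proof (induction "card T'" arbitrary: T')
    case 0
    then show ?case by (auto intro: bexI [of _ 0] simp: span_zero)
  next
    case (Suc d)
    then have "T' \<noteq> {}" by auto
    then obtain \<tau>0 where \<tau>0: "\<tau>0 \<in> T'" "\<forall>\<tau>\<in>T'. \<tau> \<noteq> \<tau>0 \<longrightarrow> \<not> R \<tau> \<tau>0"
      using Finite_Set.bex_min_element [OF Suc.prems(1) R'] by blast
    have "d = card (T' - {\<tau>0})" using Suc.hyps(2) Suc.prems(1) \<tau>0(1) by simp
    then obtain u where u: "u \<in> span (w ` (T' - {\<tau>0}))" "\<forall>\<tau>\<in>T' - {\<tau>0}. l \<tau> (x - u) = 0"
      using Suc.hyps(1) [of "T' - {\<tau>0}"] Suc.prems by auto
    define c where "c = l \<tau>0 (x - u) / l \<tau>0 (w \<tau>0)"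
    have "u \<in> span (w ` T')" using u(1) span_mono [of "w ` (T' - {\<tau>0})" "w ` T'"] by blast
    then have "u + scale c (w \<tau>0) \<in> span (w ` T')"
      by (rule span_add) (use \<tau>0(1) in \<open>intro span_scale span_base imageI\<close>)
    moreover have "l \<tau> (x - (u + scale c (w \<tau>0))) = 0" if \<tau>: "\<tau> \<in> T'" for \<tau>
    proof (cases "\<tau> = \<tau>0")
      case True
      have "l \<tau>0 (w \<tau>0) \<noteq> 0" using tri(1) \<tau>0(1) Suc.prems(2) by blast
      then show ?thesis using True by (simp add: l l_diff c_def)
    next
      case False
      have "l \<tau> (w \<tau>0) = 0" using tri(2) [of \<tau>0 \<tau>] \<tau>0 \<tau> False Suc.prems(2) by blast
      moreover have "l \<tau> (x - u) = 0" using u(2) \<tau> False by blast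
      ultimately show ?thesis by (simp add: l l_diff)
    qed
    ultimately show ?case by blast
  qed
  have span_V: "span (w ` T) \<subseteq> V" using w V by (intro span_minimal) auto
  have "V \<subseteq> span (w ` T)"
  proof
    fix x assume x: "x \<in> V"
    obtain u where u: "u \<in> span (w ` T)" "\<forall>\<tau>\<in>T. l \<tau> (x - u) = 0" using approx [OF T order.refl]
      by blast
    have "x - u = 0" using u span_V x by (intro inj subspace_diff [OF V]) auto
    then show "x \<in> span (w ` T)" using u by simp
  qed
  have zero: "c \<tau> = 0" if c: "(\<Sum>\<tau>\<in>T. scale (c \<tau>) (w \<tau>)) = 0" and \<tau>: "\<tau> \<in> T" for c \<tau>
  proof (rule ccontr)
    assume "c \<tau> \<noteq> 0"
    then have "{\<tau>\<in>T. c \<tau> \<noteq> 0} \<noteq> {}" using \<tau> by auto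
    \<comment> \<open>At a maximal index with nonzero coefficient only the diagonal term
      survives.\<close>
    then obtain \<tau>1 where \<tau>1: "\<tau>1 \<in> T" "c \<tau>1 \<noteq> 0" "\<forall>\<tau>\<in>{\<tau>\<in>T. c \<tau> \<noteq> 0}. \<tau> \<noteq> \<tau>1 \<longrightarrow> \<not> R \<tau>1 \<tau>"
      using Finite_Set.bex_max_element [OF _ R', of "{\<tau>\<in>T. c \<tau> \<noteq> 0}"] T by auto
    have "0 = l \<tau>1 (\<Sum>\<tau>\<in>T. scale (c \<tau>) (w \<tau>))" by (simp add: c l0)
    also have "\<dots> = (\<Sum>\<tau>\<in>T. c \<tau> * l \<tau>1 (w \<tau>))" by (simp add: l_sum l)
    also have "\<dots> = (\<Sum>\<tau>\<in>T. if \<tau> = \<tau>1 then c \<tau>1 * l \<tau>1 (w \<tau>1) else 0)"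
    proof (intro sum.cong refl)
      fix \<tau> assume "\<tau> \<in> T"
      then show "c \<tau> * l \<tau>1 (w \<tau>) = (if \<tau> = \<tau>1 then c \<tau>1 * l \<tau>1 (w \<tau>1) else 0)"
        using \<tau>1 tri(2) [of \<tau> \<tau>1] by (cases "c \<tau> = 0") auto
    qed
    also have "\<dots> = c \<tau>1 * l \<tau>1 (w \<tau>1)" using T \<tau>1(1) by simp
    finally show False using tri(1) [OF \<tau>1(1)] \<tau>1(2) by simp
  qed
  have inj_w: "inj_on w T"
  proof (rule inj_onI, rule ccontr)
    fix \<sigma> \<tau> assume \<sigma>\<tau>: "\<sigma> \<in> T" "\<tau> \<in> T" "w \<sigma> = w \<tau>" "\<sigma> \<noteq> \<tau>"
    define c where "c \<rho> = (if \<rho> = \<sigma> then 1 else if \<rho> = \<tau> then - 1 else 0 :: 'a)" for \<rho>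
    have "(\<Sum>\<rho>\<in>T. scale (c \<rho>) (w \<rho>)) = (\<Sum>\<rho>\<in>{\<sigma>, \<tau>}. scale (c \<rho>) (w \<rho>))"
      using T \<sigma>\<tau> by (intro sum.mono_neutral_right) (auto simp: c_def)
    also have "\<dots> = 0" using \<sigma>\<tau> by (simp add: c_def)
    finally have "c \<sigma> = 0" by (rule zero) (rule \<sigma>\<tau>(1))
    then show False by (simp add: c_def)
  qed
  have "independent (w ` T)"
  proof (rule independent_if_scalars_zero)
    fix c x assume "(\<Sum>x\<in>w ` T. scale (c x) x) = 0" "x \<in> w ` T"
    then show "c x = 0" using zero [of "\<lambda>\<tau>. c (w \<tau>)"] by (auto simp: sum.reindex [OF inj_w])
  qed (use T in simp)
  then have "card (w ` T) = dim V"
    using w \<open>V \<subseteq> span (w ` T)\<close> by (intro basis_card_eq_dim) auto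
  then show ?thesis by (simp add: card_image [OF inj_w])
qed

text \<open>
  The space \<open>S(V) \<otimes> \<Lambda>(V)\<close> as the exterior algebra over the polynomial ring.
\<close>

definition curry_ext :: "'a::comm_ring_1 sym_ext \<Rightarrow> 'a sym_alg ext_alg" where
  "curry_ext u = (\<Sum>(m, J)\<in>keys u. single J (single m (lookup u (m, J))))"

definition uncurry_ext :: "'a::comm_ring_1 sym_alg ext_alg \<Rightarrow> 'a sym_ext" where
  "uncurry_ext w = (\<Sum>J\<in>keys w. \<Sum>m\<in>keys (lookup w J). single (m, J) (lookup (lookup w J) m))"

lemma lookup_curry_ext: "lookup (lookup (curry_ext u) J) m = lookup u (m, J)"
proof -
  have "lookup (lookup (curry_ext u) J) m = (\<Sum>b\<in>keys u. if b = (m, J) then lookup u (m, J) else 0)"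
    unfolding curry_ext_def lookup_sum
    by (intro sum.cong) (auto simp: lookup_single when_def split: if_splits)
  then show ?thesis by (auto simp: in_keys_iff)
qed

lemma lookup_uncurry_ext: "lookup (uncurry_ext w) (m, J) = lookup (lookup w J) m"
proof -
  have "lookup (uncurry_ext w) (m, J)
      = (\<Sum>K\<in>keys w. if K = J then \<Sum>a\<in>keys (lookup w J).
        if a = m then lookup (lookup w J) m else 0 else 0)"
    unfolding uncurry_ext_def lookup_sum
    by (intro sum.cong refl) (auto simp: lookup_single when_def intro!: sum.cong sum.neutral)
  then show ?thesis by (auto simp: in_keys_iff)
qed

lemma curry_uncurry_ext [simp]: "curry_ext (uncurry_ext w) = w"
  by (intro poly_mapping_eqI) (simp add: lookup_curry_ext lookup_uncurry_ext)

lemma curry_ext_inject: "curry_ext u = curry_ext v \<longleftrightarrow> u = v"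
  by (auto intro!: poly_mapping_eqI simp flip: lookup_curry_ext)

lemma curry_ext_add: "curry_ext (u + v) = curry_ext u + curry_ext v"
  by (intro poly_mapping_eqI) (simp add: lookup_curry_ext lookup_add)

lemma curry_ext_zero [simp]: "curry_ext 0 = 0"
  by (intro poly_mapping_eqI) (simp add: lookup_curry_ext)

lemma curry_ext_sum: "curry_ext (sum f X) = (\<Sum>x\<in>X. curry_ext (f x))"
  by (induction X rule: infinite_finite_induct) (simp_all add: curry_ext_add)

lemma curry_ext_scale: "curry_ext (scale c u) = scale (single 0 c) (curry_ext u)"
  by (intro poly_mapping_eqI) (simp add: lookup_curry_ext flip: scale_conv_mult)

lemma curry_ext_tensor: "curry_ext (tensor f w) = scale f (map_coeffs (single 0) w)"
proof -
  interpret c: comm_ring_hom "\<lambda>c. single 0 c :: 'a sym_alg" by (rule const_hom)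
  show ?thesis
    by (intro poly_mapping_eqI)
      (simp add: lookup_curry_ext lookup_tensor c.lookup_map_coeffs mult.commute [of f]
        mult.commute [of "lookup f _"]
        flip: scale_conv_mult)
qed

text \<open>The action splits into two layers: \<open>sym_act g\<close> on the polynomial
  coefficients, and the constant matrix \<open>g\<close> on the exterior generators. Only the second
  layer is linear over the polynomial ring.\<close>

lemma curry_ext_act:
  assumes g: "g \<in> carrier_mat n n" and u: "\<And>m J. (m, J) \<in> keys u \<Longrightarrow> J \<subseteq> {..<n}"
  shows "curry_ext (sym_ext_det_act k g u) = scale (single 0 (det g ^ k))
    (ext_act (map_mat (single 0) g) (map_coeffs (sym_act g) (curry_ext u)))"
proof -
  interpret c: comm_ring_hom "\<lambda>c. single 0 c :: 'a sym_alg" by (rule const_hom)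
  interpret \<sigma>: comm_ring_hom "sym_act g" unfolding sym_act_subst by (rule subst_hom)
  have term_eq: "curry_ext (scale d (tensor (sym_act g (single m 1)) (ext_act g (single J 1))))
      = ext_act (map_mat (single 0) g) (single J (sym_act g (single m d)))" if "J \<subseteq>
        {..<n}" for m J d
  proof -
    have "map_coeffs (single 0) (ext_act g (single J 1))
      = ext_act (map_mat (single 0) g) (single J (1 :: 'a sym_alg))"
      using c.map_coeffs_ext_act [OF g, of "single J 1"] that c.map_coeffs_single [of J 1] by simp
    moreover have "single 0 d * sym_act g (single m 1) = sym_act g (single m d)"
    proof -
      have "sym_act g (scale d (single m 1)) = scale d (sym_act g (single m 1))"
        unfolding sym_act_subst by (rule subst_scale)
      then show ?thesis by (simp flip: scale_conv_mult)
    qed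
    ultimately have "curry_ext (scale d (tensor (sym_act g (single m 1)) (ext_act g (single J 1))))
      = scale (sym_act g (single m d)) (ext_act (map_mat (single 0) g) (single J 1))"
      by (simp add: curry_ext_scale curry_ext_tensor)
    also have "\<dots> = ext_act (map_mat (single 0) g) (single J (sym_act g (single m d)))"
      using linear_map_scale [OF linear_map_ext_act, of _ "sym_act g (single m d)" "single J 1"]
        by simp
    finally show ?thesis .
  qed
  have "curry_ext (sym_ext_det_act k g u) = scale (single 0 (det g ^ k))
      (\<Sum>(m, J)\<in>keys u. curry_ext (scale (lookup u (m, J))
        (tensor (sym_act g (single m 1)) (ext_act g (single J 1)))))"
    by (simp add: sym_ext_det_act_def linear_extend_def curry_ext_scale curry_ext_sum
      case_prod_unfold)
  also have "(\<Sum>(m, J)\<in>keys u. curry_ext (scale (lookup u (m, J))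
        (tensor (sym_act g (single m 1)) (ext_act g (single J 1)))))
      = (\<Sum>(m, J)\<in>keys u. ext_act (map_mat (single 0) g) (single J (sym_act g (single m (lookup u
        (m, J))))))"
    using u by (intro sum.cong refl) (auto simp: term_eq)
  also have "\<dots> = ext_act (map_mat (single 0) g) (map_coeffs (sym_act g) (curry_ext u))"
    by (simp add: curry_ext_def \<sigma>.map_coeffs_sum \<sigma>.map_coeffs_single linear_map_sum [OF
      linear_map_ext_act]
        case_prod_unfold)
  finally show ?thesis .
qed

lemma finite_bounded_monomials:
  "finite {\<alpha> :: nat \<Rightarrow>\<^sub>0 nat. keys \<alpha> \<subseteq> {..<n} \<and> (\<forall>b<n. lookup \<alpha> b \<le> D)}" (is "finite ?A")
proof (rule finite_imageD [of "\<lambda>\<alpha>. restrict (lookup \<alpha>) {..<n}"])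
  show "inj_on (\<lambda>\<alpha>. restrict (lookup \<alpha>) {..<n}) ?A"
  proof (rule inj_onI, rule poly_mapping_eqI)
    fix \<alpha> \<beta> :: "nat \<Rightarrow>\<^sub>0 nat" and b
    assume *: "\<alpha> \<in> ?A" "\<beta> \<in> ?A" "restrict (lookup \<alpha>) {..<n} = restrict (lookup \<beta>) {..<n}"
    show "lookup \<alpha> b = lookup \<beta> b"
    proof (cases "b < n")
      case True
      then show ?thesis using fun_cong [OF *(3), of b] by simp
    next
      case False
      then have "b \<notin> keys \<alpha>" "b \<notin> keys \<beta>" using *(1,2) by auto
      then show ?thesis by (simp add: in_keys_iff)
    qed
  qed
  have "(\<lambda>\<alpha>. restrict (lookup \<alpha>) {..<n}) ` ?A \<subseteq> {..<n} \<rightarrow>\<^sub>E {..D}"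
    by (rule image_subsetI) (simp add: restrict_PiE_iff)
  then show "finite ((\<lambda>\<alpha>. restrict (lookup \<alpha>) {..<n}) ` ?A)"
    by (rule finite_subset) (simp add: finite_PiE)
qed

lemma homog_sign: "homog d ((- 1) ^ i * f) \<longleftrightarrow> homog d f"
  and vars_in_sign: "vars_in X ((- 1) ^ i * f) \<longleftrightarrow> vars_in X f"
  for f :: "'a::comm_ring_1 sym_alg"
  by (cases "even i"; simp add: homog_uminus vars_in_uminus)+

context parabolic_group
begin

section \<open>The Moore map and its grading\<close>

definition weight :: "nat set \<Rightarrow> nat" where
  "weight J = (\<Sum>a\<in>J. q ^ a)"

text \<open>This gives the target generator with index \<open>a\<close> the degree
  \<open>- (q ^ a)\<close>. The columns of the Moore matrix then have degree 0, so the Moore map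
  preserves degrees when the generators of its source are given degree 0.\<close>

definition graded :: "nat \<Rightarrow> 'a sym_alg ext_alg \<Rightarrow> bool" where
  "graded d w \<longleftrightarrow> ext_in n w \<and>
    (\<forall>J. homog (d + weight J) (lookup w J) \<and> vars_in {..<n} (lookup w J))"

lemma graded_single:
  "J \<subseteq> {..<n} \<Longrightarrow> homog (d + weight J) f \<Longrightarrow> vars_in {..<n} f \<Longrightarrow> graded d (single J f)"
  by (auto simp: graded_def lookup_single when_def)

lemma graded_zero [simp]: "graded d 0"
  by (simp add: graded_def ext_in_def)

lemma graded_add: "graded d u \<Longrightarrow> graded d v \<Longrightarrow> graded d (u + v)"
proof -
  assume uv: "graded d u" "graded d v"
  then have "ext_in n (u + v)"
    unfolding graded_def ext_in_def using keys_add [of u v] by blast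
  then show ?thesis using uv by (auto simp: graded_def lookup_add intro: homog_add vars_in_add)
qed

lemma graded_sum: "(\<And>x. x \<in> X \<Longrightarrow> graded d (f x)) \<Longrightarrow> graded d (sum f X)"
  by (induction X rule: infinite_finite_induct) (simp_all add: graded_add)

lemma graded_scale: "homog e c \<Longrightarrow> vars_in {..<n} c \<Longrightarrow> graded d w \<Longrightarrow> graded (e + d) (scale c w)"
  by (auto simp: graded_def intro: ext_in_scale homog_mult vars_in_mult simp: add.assoc)

lemma graded_wedge:
  assumes u: "graded d u" and v: "graded e v"
  shows "graded (d + e) (wedge u v)"
  unfolding wedge_def
proof (intro graded_sum)
  fix J K assume JK: "J \<in> keys u" "K \<in> keys v"
  have sub: "J \<subseteq> {..<n}" "K \<subseteq> {..<n}"
    using JK u v unfolding graded_def by (auto dest: ext_in_keys)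
  show "graded (d + e) (scale (lookup u J * lookup v K) (ext_basis_mult J K))"
  proof (cases "J \<inter> K = {}")
    case True
    have fin: "finite J" "finite K" using sub finite_subset by blast+
    have w: "d + e + weight (J \<union> K) = (d + weight J) + (e + weight K)"
      using True fin by (simp add: weight_def sum.union_disjoint)
    have "homog (d + e + weight (J \<union> K)) (lookup u J * lookup v K)"
      unfolding w using u v by (intro homog_mult) (auto simp: graded_def)
    moreover have "vars_in {..<n} (lookup u J * lookup v K)"
      using u v by (intro vars_in_mult) (auto simp: graded_def)
    ultimately show ?thesis
      using True sub unfolding ext_basis_mult_inversions
      by (auto intro!: graded_single simp: mult.commute [of _ "(- 1) ^ i"
        for i] homog_sign vars_in_sign)
  qed (simp add: ext_basis_mult_inversions)
qed

lemma graded_ext_act_moore_single: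
  assumes "J \<subseteq> {..<n}"
  shows "graded 0 (ext_act (moore_mat n) (single J 1))"
proof -
  have "finite J" using assms finite_subset by blast
  then show ?thesis using assms
  proof (induction J rule: finite_linorder_min_induct)
    case empty
    then show ?case
      by (simp flip: ext_one_def) (simp add: ext_one_def graded_single weight_def)
  next
    case (insert j J)
    have "graded 0 (ext_col (moore_mat n) j)"
      unfolding ext_vector_def
    proof (rule graded_sum)
      fix a assume a: "a \<in> {..<dim_row (moore_mat n)}"
      have "homog (1 * q ^ a) (sym_gen j ^ q ^ a :: 'a sym_alg)" by (intro homog_power homog_gen)
      then show "graded 0 (scale (moore_mat n $$ (a, j)) (ext_gen a))"
        using a insert.prems by (simp add: moore_mat_def ext_gen_def weight_def graded_single
          vars_in_power)
    qed
    then show ?case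
      using graded_wedge [of 0 "ext_col (moore_mat n) j" 0] insert by (simp add: ext_act_insert)
  qed
qed

lemma graded_ext_act_moore:
  assumes "ext_in n w" "\<And>J. homog d (lookup w J)" "\<And>J. vars_in {..<n} (lookup w J)"
  shows "graded d (ext_act (moore_mat n) w)"
  unfolding linear_map_expand [OF linear_map_ext_act, of _ w]
proof (rule graded_sum)
  fix J assume "J \<in> keys w"
  then have "graded (d + 0) (scale (lookup w J) (ext_act (moore_mat n) (single J 1)))"
    using assms by (intro graded_scale graded_ext_act_moore_single) (auto dest: ext_in_keys)
  then show "graded d (scale (lookup w J) (ext_act (moore_mat n) (single J 1)))" by simp
qed

definition moore_act :: "'a sym_ext \<Rightarrow> 'a sym_alg ext_alg" where
  "moore_act u = ext_act (moore_mat n) (curry_ext u)"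

lemma sym_ext_component_iff:
  "u \<in> sym_ext_component n i j \<longleftrightarrow> (\<forall>m J. (m, J) \<in> keys u \<longrightarrow>
    keys m \<subseteq> {..<n} \<and> monomial_degree m = i \<and> J \<subseteq> {..<n} \<and> card J = j)"
  unfolding sym_ext_component_def mem_Collect_eq Ball_def split_paired_All case_prod_conv by blast

lemma curry_ext_component:
  assumes "u \<in> sym_ext_component n i j"
  shows "ext_in n (curry_ext u)" "homog i (lookup (curry_ext u) J)"
    "vars_in {..<n} (lookup (curry_ext u) J)"
    "J \<in> keys (curry_ext u) \<Longrightarrow> card J = j"
proof -
  have u: "keys m \<subseteq> {..<n} \<and> monomial_degree m = i \<and> J \<subseteq> {..<n} \<and> card J = j"
    if "lookup (lookup (curry_ext u) J) m \<noteq> 0" for m J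
    using that assms unfolding sym_ext_component_iff lookup_curry_ext in_keys_iff by blast
  have nz: "\<exists>m. lookup (lookup (curry_ext u) J) m \<noteq> 0" if "J \<in> keys (curry_ext u)" for J
    using that by (metis in_keys_iff lookup_zero poly_mapping_eqI)
  show "ext_in n (curry_ext u)" unfolding ext_in_def using u nz by blast
  show "homog i (lookup (curry_ext u) J)" "vars_in {..<n} (lookup (curry_ext u) J)"
    using u by (auto simp: homog_def vars_in_def in_keys_iff)
  show "J \<in> keys (curry_ext u) \<Longrightarrow> card J = j" using u nz by blast
qed

lemma sym_ext_component_curryI:
  assumes "\<And>J. homog i (lookup (curry_ext u) J)" "\<And>J. vars_in {..<n} (lookup (curry_ext u) J)"
    "\<And>J. J \<in> keys (curry_ext u) \<Longrightarrow> J \<subseteq> {..<n} \<and> card J = j"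
  shows "u \<in> sym_ext_component n i j"
proof -
  have "keys m \<subseteq> {..<n} \<and> monomial_degree m = i \<and> J \<subseteq> {..<n} \<and> card J = j" if "(m, J) \<in> keys u"
    for m J
  proof -
    have m: "m \<in> keys (lookup (curry_ext u) J)" using that
      by (simp add: in_keys_iff lookup_curry_ext)
    then have "J \<in> keys (curry_ext u)" by (auto simp: in_keys_iff)
    then show ?thesis using m assms unfolding homog_def vars_in_def by blast
  qed
  then show ?thesis unfolding sym_ext_component_iff by blast
qed

lemma moore_equivariant:
  assumes g: "g \<in> carrier_mat n n" and w: "ext_in n w"
  shows "map_coeffs (sym_act g) (ext_act (moore_mat n) w)
    = ext_act (moore_mat n) (ext_act (map_mat (single 0) g) (map_coeffs (sym_act g) w))"
proof -
  interpret \<sigma>: comm_ring_hom "sym_act g" by (rule comm_ring_hom_sym_act)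
  have "map_coeffs (sym_act g) (ext_act (moore_mat n) w)
      = ext_act (moore_mat n * map_mat (single 0) g) (map_coeffs (sym_act g) w)"
    using \<sigma>.map_coeffs_ext_act [OF moore_mat_carrier w] by (simp add: map_moore_mat [OF g])
  also have "\<dots> = ext_act (moore_mat n) (ext_act (map_mat (single 0) g) (map_coeffs (sym_act g) w))"
    using g \<sigma>.ext_in_map_coeffs [OF w] by (intro ext_act_mult) auto
  finally show ?thesis .
qed

text \<open>By \<open>map_moore_mat\<close> the Moore matrix absorbs the matrix part of the action,
  and only the action on coefficients is left on the target side. Injectivity of the Moore map turns
  the equation between images back into one for \<open>u\<close>.\<close>

lemma moore_act_invariant_iff:
  assumes g: "g \<in> carrier_mat n n" and u: "u \<in> sym_ext_component n i j"
  shows "sym_ext_det_act k g u = u \<longleftrightarrow>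
    (\<forall>J. scale (det g ^ k) (sym_act g (lookup (moore_act u) J)) = lookup (moore_act u) J)"
proof -
  interpret \<sigma>: comm_ring_hom "sym_act g" by (rule comm_ring_hom_sym_act)
  define w where "w = curry_ext u"
  define v where "v = curry_ext (sym_ext_det_act k g u)"
  have w_in: "ext_in n w" unfolding w_def by (rule curry_ext_component [OF u])
  have v: "v = scale (single 0 (det g ^ k)) (ext_act (map_mat (single 0) g) (map_coeffs (sym_act g)
    w))"
    unfolding v_def w_def using u by (intro curry_ext_act [OF g]) (unfold sym_ext_component_iff,
      blast)
  have v_in: "ext_in n v"
    unfolding v using g w_in by (intro ext_in_scale ext_in_ext_act \<sigma>.ext_in_map_coeffs) auto
  have "ext_act (moore_mat n) v = scale (single 0 (det g ^ k)) (map_coeffs (sym_act g) (moore_act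
    u))"
    unfolding moore_act_def w_def [symmetric] moore_equivariant [OF g w_in] v
    by (rule linear_map_scale [OF linear_map_ext_act])
  moreover have "v = w \<longleftrightarrow> ext_act (moore_mat n) v = ext_act (moore_mat n) w"
  proof
    assume "ext_act (moore_mat n) v = ext_act (moore_mat n) w"
    then have "ext_act (moore_mat n) (v - w) = 0"
      by (simp add: linear_map_diff [OF linear_map_ext_act])
    then have "v - w = 0"
      using moore_det_nonzero by (intro ext_act_inj [OF moore_mat_carrier _ ext_in_diff [OF v_in
        w_in]])
        (simp_all add: moore_det_def)
    then show "v = w" by simp
  qed simp
  ultimately have "sym_ext_det_act k g u = u \<longleftrightarrow>
      scale (single 0 (det g ^ k)) (map_coeffs (sym_act g) (moore_act u)) = moore_act u"
    by (simp add: v_def w_def curry_ext_inject moore_act_def)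
  also have "\<dots> \<longleftrightarrow> (\<forall>J. scale (det g ^ k) (sym_act g (lookup (moore_act u) J))
    = lookup (moore_act u) J)"
  proof -
    have "lookup (scale (single 0 (det g ^ k)) (map_coeffs (sym_act g) (moore_act u))) J
        = scale (det g ^ k) (sym_act g (lookup (moore_act u) J))" for J
      by (simp add: \<sigma>.lookup_map_coeffs flip: scale_conv_mult)
    then show ?thesis by (metis poly_mapping_eqI)
  qed
  finally show ?thesis .
qed

section \<open>A basis of the invariants\<close>

definition cofactor_ext :: "nat set \<Rightarrow> 'a sym_alg ext_alg" where
  "cofactor_ext T = (\<Sum>J\<in>Pow {..<n}. single J (ext_sign n J * ext_sign n T *
    lookup (ext_act (moore_mat n) (single ({..<n} - J) 1)) ({..<n} - T)))"

lemma ext_act_cofactor_ext: "T \<subseteq> {..<n} \<Longrightarrow> ext_act (moore_mat n) (cofactor_ext T)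
  = single T (moore_det n)"
  unfolding cofactor_ext_def moore_det_def
  using moore_det_nonzero [of n] by (intro ext_act_adjoint) (simp_all add: moore_det_def)

lemma lookup_cofactor_ext: "lookup (cofactor_ext T) J = (if J
  \<subseteq> {..<n} then ext_sign n J * ext_sign n T *
    lookup (ext_act (moore_mat n) (single ({..<n} - J) 1)) ({..<n} - T) else 0)"
  by (simp add: cofactor_ext_def lookup_sum lookup_single when_def sum.delta')

text \<open>Up to sign the coefficients are minors of the Moore matrix with rows
  \<open>{..<n} - T\<close>, so their degree is the weight of that set.\<close>

lemma cofactor_ext_props:
  assumes T: "T \<subseteq> {..<n}"
  shows "homog (weight ({..<n} - T)) (lookup (cofactor_ext T) J)"
    "vars_in {..<n} (lookup (cofactor_ext T) J)"
    "J \<in> keys (cofactor_ext T) \<Longrightarrow> J \<subseteq> {..<n} \<and> card J = card T"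
proof -
  define f where "f = lookup (ext_act (moore_mat n) (single ({..<n} - J) 1)) ({..<n} - T)"
  have f: "homog (weight ({..<n} - T)) f" "vars_in {..<n} f"
    using graded_ext_act_moore_single [of "{..<n} - J"] by (auto simp: graded_def f_def)
  then show "homog (weight ({..<n} - T)) (lookup (cofactor_ext T) J)"
    "vars_in {..<n} (lookup (cofactor_ext T) J)"
    unfolding lookup_cofactor_ext f_def [symmetric]
    by (simp_all add: homog_sign vars_in_sign mult.assoc)
  assume "J \<in> keys (cofactor_ext T)"
  then have J: "J \<subseteq> {..<n}" "{..<n} - T \<in> keys (ext_act (moore_mat n) (single ({..<n} - J) 1))"
    by (auto simp: in_keys_iff lookup_cofactor_ext split: if_splits)
  have "card ({..<n} - T) = card ({..<n} - J)" by (rule card_keys_ext_act_single [OF _ J(2)]) simp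
  moreover have "card J \<le> n" "card T \<le> n" using card_mono [OF finite_lessThan J(1)] card_mono [OF
    finite_lessThan T] by simp_all
  moreover have "finite J" "finite T" using J(1) T finite_subset by blast+
  ultimately show "J \<subseteq> {..<n} \<and> card J = card T"
    using J(1) T by (simp add: card_Diff_subset)
qed

text \<open>The equation says that \<open>semi_elem \<alpha>\<close> has degree
  \<open>i + weight T\<close>, which is the degree that the Moore map forces on a coefficient at
  \<open>T\<close>.\<close>

definition index_set :: "nat \<Rightarrow> nat \<Rightarrow> (nat set \<times> (nat \<Rightarrow>\<^sub>0 nat)) set" where
  "index_set i j = {(T, \<alpha>). T \<subseteq> {..<n} \<and> card T = j \<and> keys \<alpha> \<subseteq> {..<n} \<and>
    (\<Sum>a<n. q ^ a) * (q - 1 - k) + dickson_degree \<alpha> = i + weight T}"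

text \<open>The preimage under \<open>moore_act\<close> of \<open>semi_elem \<alpha>\<close> placed
  at \<open>T\<close>. The exponent is one less than in \<open>semi_elem\<close>, because
  \<open>cofactor_ext T\<close> supplies a factor \<open>moore_det n\<close>.\<close>

definition basis_elem :: "nat set \<times> (nat \<Rightarrow>\<^sub>0 nat) \<Rightarrow> 'a sym_ext" where
  "basis_elem = (\<lambda>(T, \<alpha>). uncurry_ext
    (scale (moore_det n ^ (q - 2 - k) * dickson_prod \<alpha>) (cofactor_ext T)))"

lemma moore_act_basis_elem: "T \<subseteq> {..<n} \<Longrightarrow> moore_act (basis_elem (T, \<alpha>)) = single T (semi_elem \<alpha>)"
proof -
  assume T: "T \<subseteq> {..<n}"
  have "q - 1 - k = Suc (q - 2 - k)" using k_le k_pos by linarith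
  then have "semi_elem \<alpha> = moore_det n ^ (q - 2 - k) * dickson_prod \<alpha> * moore_det n"
    by (simp add: semi_elem_def mult_ac)
  then show ?thesis
    by (simp add: moore_act_def basis_elem_def linear_map_scale [OF linear_map_ext_act]
      ext_act_cofactor_ext [OF T])
qed

lemma basis_elem_invariant:
  assumes "(T, \<alpha>) \<in> index_set i j"
  shows "basis_elem (T, \<alpha>) \<in> sym_ext_det_invariants n G k i j"
proof -
  have T: "T \<subseteq> {..<n}" "card T = j" and d: "(\<Sum>a<n. q ^ a) * (q - 1 - k) + dickson_degree \<alpha>
    = i + weight T"
    using assms by (auto simp: index_set_def)
  define f where "f = moore_det n ^ (q - 2 - k) * dickson_prod \<alpha>"
  have cur: "curry_ext (basis_elem (T, \<alpha>)) = scale f (cofactor_ext T)"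
    by (simp add: basis_elem_def f_def)
  have "homog ((\<Sum>a<n. q ^ a) * (q - 2 - k) + dickson_degree \<alpha>) f"
    unfolding f_def by (intro homog_mult homog_power homog_moore_det homog_dickson_prod)
  then have h: "homog ((\<Sum>a<n. q ^ a) * (q - 2 - k) + dickson_degree \<alpha> + weight ({..<n} - T)) (f *
    lookup (cofactor_ext T) J)" for J
    by (intro homog_mult cofactor_ext_props T)
  have "(\<Sum>a<n. q ^ a) = weight T + weight ({..<n} - T)"
    unfolding weight_def using T(1) by (simp add: sum.subset_diff [of T "{..<n}"] add.commute)
  moreover have "q - 1 - k = Suc (q - 2 - k)" using k_le k_pos by linarith
  ultimately have deg: "(\<Sum>a<n. q ^ a) * (q - 2 - k) + dickson_degree \<alpha> + weight ({..<n} - T) = i"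
    using d by simp
  have comp: "basis_elem (T, \<alpha>) \<in> sym_ext_component n i j"
  proof (rule sym_ext_component_curryI)
    show "homog i (lookup (curry_ext (basis_elem (T, \<alpha>))) J)" for J
      using h [of J] unfolding deg by (simp add: cur)
    show "vars_in {..<n} (lookup (curry_ext (basis_elem (T, \<alpha>))) J)" for J
      by (auto simp: cur f_def intro!: vars_in_mult vars_in_power vars_in_moore_det
        vars_in_dickson_prod
          cofactor_ext_props T)
    show "J \<subseteq> {..<n} \<and> card J = j" if "J \<in> keys (curry_ext (basis_elem (T, \<alpha>)))" for J
      using cofactor_ext_props(3) [OF T(1)] that T(2) keys_scale [of f "cofactor_ext T"]
        by (auto simp: cur)
  qed
  moreover have "sym_ext_det_act k g (basis_elem (T, \<alpha>)) = basis_elem (T, \<alpha>)" if g: "g \<in> G" for g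
  proof -
    interpret \<sigma>: comm_ring_hom "sym_act g" by (rule comm_ring_hom_sym_act)
    show ?thesis
      unfolding moore_act_invariant_iff [OF G_carrier [OF g] comp] moore_act_basis_elem [OF T(1)]
      using semi_invariant_semi_elem [of \<alpha>] g
      by (auto simp: lookup_single when_def semi_invariant_def)
  qed
  ultimately show ?thesis by (simp add: sym_ext_det_invariants_def)
qed

lemma card_keys_ext_act:
  assumes "ext_in n w" "\<And>J. J \<in> keys w \<Longrightarrow> card J = j" "K \<in> keys (ext_act A w)"
  shows "card K = j"
proof -
  have "K \<in> keys (\<Sum>J\<in>keys w. scale (lookup w J) (ext_act A (single J 1)))"
    using assms(3) by (simp add: linear_map_expand [OF linear_map_ext_act, of A w, symmetric])
  from subsetD [OF keys_sum_subset this]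
  obtain J where J: "J \<in> keys w" "K \<in> keys (scale (lookup w J) (ext_act A (single J 1)))" by blast
  from subsetD [OF keys_scale J(2)] have "K \<in> keys (ext_act A (single J 1))" .
  moreover have "finite J" using ext_in_keys [OF assms(1) J(1)] finite_subset by blast
  ultimately show ?thesis using card_keys_ext_act_single assms(2) [OF J(1)] by metis
qed

lemma lead_in_index_set:
  assumes u: "u \<in> sym_ext_det_invariants n G k i j" and lead: "is_lead (lookup (moore_act u) T) e"
  shows "\<exists>\<alpha>. (T, \<alpha>) \<in> index_set i j \<and> e = semi_mono \<alpha>"
proof -
  have comp: "u \<in> sym_ext_component n i j" and inv: "\<And>g. g \<in> G \<Longrightarrow> sym_ext_det_act k g u = u"
    using u by (auto simp: sym_ext_det_invariants_def)
  have gr: "graded i (moore_act u)"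
    unfolding moore_act_def by (intro graded_ext_act_moore curry_ext_component [OF comp])
  have T_keys: "T \<in> keys (moore_act u)" using is_lead_nonzero [OF lead] by (simp add: in_keys_iff)
  have T: "T \<subseteq> {..<n}" using gr T_keys by (auto simp: graded_def dest: ext_in_keys)
  have cT: "card T = j"
    by (rule card_keys_ext_act [OF curry_ext_component(1) [OF comp] curry_ext_component(4) [OF
      comp] T_keys [unfolded moore_act_def]])
  have semi: "semi_invariant (lookup (moore_act u) T)"
    unfolding semi_invariant_def
    using gr moore_act_invariant_iff [OF G_carrier comp] inv by (auto simp: graded_def)
  obtain \<alpha> where \<alpha>: "keys \<alpha> \<subseteq> {..<n}" "e = semi_mono \<alpha>" using semi_invariant_lead [OF semi lead]
    by blast
  have "monomial_degree e = i + weight T"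
    using gr lead by (auto simp: graded_def homog_def is_lead_def)
  \<comment> \<open>The homogeneous polynomial \<open>semi_elem \<alpha>\<close> contains the same
    monomial, so the degree of \<open>e\<close> can be read off there.\<close>
  moreover have "monomial_degree e = (\<Sum>a<n. q ^ a) * (q - 1 - k) + dickson_degree \<alpha>"
    using homog_semi_elem [of \<alpha>] is_lead_semi_elem [of \<alpha>] \<alpha>(2) by (auto simp: homog_def is_lead_def)
  ultimately show ?thesis using T cT \<alpha> by (auto simp: index_set_def)
qed

lemma finite_index_set: "finite (index_set i j)"
proof -
  define D where "D = i + (\<Sum>a<n. q ^ a)"
  have "index_set i j \<subseteq> Pow {..<n} \<times> {\<alpha>. keys \<alpha> \<subseteq> {..<n} \<and> (\<forall>b<n. lookup \<alpha> b \<le> D)}"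
  proof
    fix x assume "x \<in> index_set i j"
    then obtain T \<alpha> where x: "x = (T, \<alpha>)" "T \<subseteq> {..<n}" "keys \<alpha> \<subseteq> {..<n}"
        "(\<Sum>a<n. q ^ a) * (q - 1 - k) + dickson_degree \<alpha> = i + weight T"
      by (auto simp: index_set_def)
    have "weight T \<le> (\<Sum>a<n. q ^ a)" unfolding weight_def by (intro sum_mono2 x(2)) auto
    then have deg: "dickson_degree \<alpha> \<le> D" using x(4) by (simp add: D_def)
    have "lookup \<alpha> b \<le> D" if "b < n" for b
    proof -
      have "q ^ b < q ^ block_end b" using block_end [OF that] q_ge_2
        by (intro power_strict_increasing) auto
      then have "1 * lookup \<alpha> b \<le> (q ^ block_end b - q ^ b) * lookup \<alpha> b"
        by (intro mult_le_mono1) linarith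
      also have "\<dots> \<le> dickson_degree \<alpha>"
        unfolding dickson_degree_def using that by (intro member_le_sum) auto
      finally show ?thesis using deg by linarith
    qed
    then show "x \<in> Pow {..<n} \<times> {\<alpha>. keys \<alpha> \<subseteq> {..<n} \<and> (\<forall>b<n. lookup \<alpha> b \<le> D)}" using x by auto
  qed
  moreover have "finite {\<alpha> :: nat \<Rightarrow>\<^sub>0 nat. keys \<alpha> \<subseteq> {..<n} \<and> (\<forall>b<n. lookup \<alpha> b \<le> D)}"
    by (rule finite_bounded_monomials)
  ultimately show ?thesis by (meson finite_Pow_iff finite_SigmaI finite_lessThan finite_subset)
qed

lemma subspace_invariants: "Modules.module.subspace scale (sym_ext_det_invariants n G k i j)"
proof -
  interpret vs: vector_space "scale :: 'a \<Rightarrow> 'a sym_ext \<Rightarrow> 'a sym_ext" by (rule vector_space_scale)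
  have act: "linear_map (sym_ext_det_act k g)" for g :: "'a mat"
    unfolding sym_ext_det_act_def by (intro linear_map_scale_fun linear_map_linear_extend)
  show ?thesis
  proof (rule vs.subspaceI)
    show "0 \<in> sym_ext_det_invariants n G k i j"
      by (simp add: sym_ext_det_invariants_def sym_ext_component_def linear_map_zero [OF act])
  next
    fix u v assume uv: "u \<in> sym_ext_det_invariants n G k i j" "v \<in> sym_ext_det_invariants n G k i j"
    then have "u + v \<in> sym_ext_component n i j"
      using keys_add [of u v] unfolding sym_ext_det_invariants_def sym_ext_component_iff
        mem_Collect_eq by blast
    then show "u + v \<in> sym_ext_det_invariants n G k i j"
      using uv by (simp add: sym_ext_det_invariants_def linear_map_add [OF act])
  next
    fix c u assume u: "u \<in> sym_ext_det_invariants n G k i j"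
    then have "scale c u \<in> sym_ext_component n i j"
      using keys_scale [of c u] unfolding sym_ext_det_invariants_def sym_ext_component_iff
        mem_Collect_eq by blast
    then show "scale c u \<in> sym_ext_det_invariants n G k i j"
      using u by (simp add: sym_ext_det_invariants_def linear_map_scale [OF act])
  qed
qed

text \<open>The functional of an index \<open>(T, \<alpha>)\<close> is the coefficient of the Moore
  image at \<open>T\<close> and \<open>semi_mono \<alpha>\<close>. These functionals are jointly
  injective on the invariants, since a nonzero component would have a leading exponent belonging to
  \<open>index_set\<close>. The image of a basis element is concentrated at its own
  \<open>T\<close>, so \<open>R\<close> only has to compare exponents.\<close>

theorem dim_invariants:
  "vector_space.dim scale (sym_ext_det_invariants n G k i j) = card (index_set i j)"
proof -
  interpret vs: vector_space "scale :: 'a \<Rightarrow> 'a sym_ext \<Rightarrow> 'a sym_ext" by (rule vector_space_scale)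
  define l where "l \<tau> u = lookup (lookup (moore_act u) (fst \<tau>)) (semi_mono (snd \<tau>))"
    for \<tau> :: "nat set \<times> (nat \<Rightarrow>\<^sub>0 nat)" and u :: "'a sym_ext"
  define R where "R \<sigma> \<tau> \<longleftrightarrow> semi_mono (snd \<sigma>) \<prec> semi_mono (snd \<tau>)"
    for \<sigma> \<tau> :: "nat set \<times> (nat \<Rightarrow>\<^sub>0 nat)"
  show ?thesis
  proof (rule vs.dim_eq_card_triangular [OF subspace_invariants finite_index_set, where l = l
    and R = R and w = basis_elem])
    show "basis_elem \<tau> \<in> sym_ext_det_invariants n G k i j" if "\<tau> \<in> index_set i j" for \<tau>
      using that by (cases \<tau>) (simp add: basis_elem_invariant)
    show "l \<tau> (u + v) = l \<tau> u + l \<tau> v" for \<tau> u v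
      by (simp add: l_def moore_act_def curry_ext_add linear_map_add [OF linear_map_ext_act]
        lookup_add)
    show "l \<tau> (scale c u) = c * l \<tau> u" for \<tau> c u
      by (simp add: l_def moore_act_def curry_ext_scale linear_map_scale [OF linear_map_ext_act]
          flip: scale_conv_mult)
    show "asymp R" unfolding R_def by (rule asympI) (metis mono_less_irrefl mono_less_trans)
    show "transp R" unfolding R_def by (rule transpI) (metis mono_less_trans)
    show "l \<tau> (basis_elem \<tau>) \<noteq> 0" if "\<tau> \<in> index_set i j" for \<tau>
      using that is_lead_lookup [OF is_lead_semi_elem]
      by (auto simp: l_def index_set_def moore_act_basis_elem)
    show "l \<tau> (basis_elem \<sigma>) = 0" if "\<sigma> \<in> index_set i j" "\<tau> \<in> index_set i j" "\<sigma> \<noteq> \<tau>" "\<not> R \<tau> \<sigma>"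
      for \<sigma> \<tau>
    proof (cases "fst \<sigma> = fst \<tau>")
      case False
      then show ?thesis using that(1)
        by (cases \<sigma>) (auto simp: l_def index_set_def moore_act_basis_elem lookup_single_not_eq)
    next
      case True
      have "semi_mono (snd \<sigma>) \<noteq> semi_mono (snd \<tau>)"
      proof
        assume "semi_mono (snd \<sigma>) = semi_mono (snd \<tau>)"
        then have "snd \<sigma> = snd \<tau>"
          by (rule semi_mono_inject) (use that(1,2) in \<open>auto simp: index_set_def\<close>)
        then show False using True that(3) by (simp add: prod_eq_iff)
      qed
      then have "semi_mono (snd \<sigma>) \<prec> semi_mono (snd \<tau>)"
        using mono_less_total that(4) unfolding R_def by blast
      then have "lookup (semi_elem (snd \<sigma>)) (semi_mono (snd \<tau>)) = 0"
        by (rule is_lead_greater [OF is_lead_semi_elem])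
      moreover have "moore_act (basis_elem \<sigma>) = single (fst \<sigma>) (semi_elem (snd \<sigma>))"
        using that(1) by (cases \<sigma>) (auto simp: index_set_def moore_act_basis_elem)
      ultimately show ?thesis using True by (simp add: l_def)
    qed
    fix u assume u: "u \<in> sym_ext_det_invariants n G k i j"
      and zero: "\<And>\<tau>. \<tau> \<in> index_set i j \<Longrightarrow> l \<tau> u = 0"
    have comp: "u \<in> sym_ext_component n i j" using u by (simp add: sym_ext_det_invariants_def)
    have "lookup (moore_act u) T = 0" for T
    proof (rule ccontr)
      assume "lookup (moore_act u) T \<noteq> 0"
      then obtain e where e: "is_lead (lookup (moore_act u) T) e" using is_lead_exists by blast
      then obtain \<alpha> where "(T, \<alpha>) \<in> index_set i j" "e = semi_mono \<alpha>" using lead_in_index_set [OF u]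
        by blast
      then show False using zero [of "(T, \<alpha>)"] is_lead_lookup [OF e] by (simp add: l_def)
    qed
    then have "moore_act u = 0" by (intro poly_mapping_eqI) simp
    then have "curry_ext u = 0"
      using moore_det_nonzero [of n]
      by (intro ext_act_inj [OF moore_mat_carrier _ curry_ext_component(1) [OF comp]])
        (simp_all add: moore_det_def moore_act_def)
    then show "u = 0" using curry_ext_inject [of u 0] by simp
  qed
qed

end

section \<open>The standard parabolic subgroups\<close>

lemma partial_sum_Suc: "i < length I \<Longrightarrow> partial_sum I (Suc i) = partial_sum I i + I ! i"
  by (simp add: partial_sum_def take_Suc_conv_app_nth)

lemma partial_sum_mono: "i \<le> i' \<Longrightarrow> partial_sum I i \<le> partial_sum I i'"
proof -
  assume "i \<le> i'"
  then have "take i' I = take i I @ take (i' - i) (drop i I)"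
    by (metis le_add_diff_inverse take_add)
  then show ?thesis by (simp add: partial_sum_def)
qed

lemma partial_sum_0 [simp]: "partial_sum I 0 = 0"
  by (simp add: partial_sum_def)

lemma partial_sum_length [simp]: "partial_sum I (length I) = sum_list I"
  by (simp add: partial_sum_def)

definition block_upper :: "nat list \<Rightarrow> 'a::zero mat \<Rightarrow> bool" where
  "block_upper I g \<longleftrightarrow> (\<forall>i \<le> length I. \<forall>a < sum_list I. \<forall>b < sum_list I.
    b < partial_sum I i \<longrightarrow> partial_sum I i \<le> a \<longrightarrow> g $$ (a, b) = 0)"

lemma block_upperD:
  "block_upper I g \<Longrightarrow> i \<le> length I \<Longrightarrow> b < partial_sum I i \<Longrightarrow> partial_sum I i \<le> a \<Longrightarrow>
    a < sum_list I \<Longrightarrow> g $$ (a, b) = 0"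
  by (auto simp: block_upper_def)

text \<open>In the sum for an entry of the product, indices \<open>c\<close> before the block are
  killed by \<open>g\<close> and those after it by \<open>h\<close>, so the diagonal block of the
  product is the product of the diagonal blocks.\<close>

lemma diag_block_mult_inverse:
  fixes g h :: "'a::comm_ring_1 mat"
  assumes g: "g \<in> carrier_mat (sum_list I) (sum_list I)" "block_upper I g"
    and h: "h \<in> carrier_mat (sum_list I) (sum_list I)" "block_upper I h"
    and gh: "g * h = 1\<^sub>m (sum_list I)" and i: "i < length I"
  shows "diag_block I i g * diag_block I i h = 1\<^sub>m (I ! i)"
proof (rule eq_matI)
  fix a b assume "a < dim_row (1\<^sub>m (I ! i) :: 'a mat)" "b < dim_col (1\<^sub>m (I ! i) :: 'a mat)"
  then have ab: "a < I ! i" "b < I ! i" by simp_all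
  define s where "s = partial_sum I i"
  have Suc_s: "partial_sum I (Suc i) = s + I ! i" using i by (simp add: partial_sum_Suc s_def)
  have le: "s + I ! i \<le> sum_list I"
    using partial_sum_mono [of "Suc i" "length I" I] i Suc_s by simp
  have "(\<Sum>c<sum_list I. g $$ (s + a, c) * h $$ (c, s + b)) = (g * h) $$ (s + a, s + b)"
    using g(1) h(1) ab le by (simp add: scalar_prod_def lessThan_atLeast0)
  also have "\<dots> = (if a = b then 1 else 0)" using ab le by (simp add: gh)
  finally have 1: "(\<Sum>c<sum_list I. g $$ (s + a, c) * h $$ (c, s + b)) = (if a = b then 1 else 0)" .
  have "g $$ (s + a, c) * h $$ (c, s + b) = 0" if c: "c \<in> {..<sum_list I} - {s..<s + I ! i}" for c
  proof (cases "c < s")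
    case True
    then have "g $$ (s + a, c) = 0"
      using block_upperD [OF g(2), of i c "s + a"] i ab le by (simp add: s_def)
    then show ?thesis by simp
  next
    case False
    then have "h $$ (c, s + b) = 0"
      using block_upperD [OF h(2), of "Suc i" "s + b" c] i c ab Suc_s by simp
    then show ?thesis by simp
  qed
  then have "(\<Sum>c<sum_list I. g $$ (s + a, c) * h $$ (c, s + b))
      = (\<Sum>c\<in>{s..<s + I ! i}. g $$ (s + a, c) * h $$ (c, s + b))"
    using le by (intro sum.mono_neutral_right) auto
  also have "\<dots> = (\<Sum>c\<in>{0..<I ! i}. g $$ (s + a, s + c) * h $$ (s + c, s + b))"
    using sum.shift_bounds_nat_ivl [of "\<lambda>c. g $$ (s + a, c) * h $$ (c, s + b)" 0 s "I ! i"]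
    by (simp add: add.commute)
  finally show "(diag_block I i g * diag_block I i h) $$ (a, b) = 1\<^sub>m (I ! i) $$ (a, b)"
    using ab 1 by (simp add: diag_block_def scalar_prod_def s_def)
qed (simp_all add: diag_block_def)

text \<open>The diagonal blocks of a block triangular inverse invert those of \<open>g\<close>, so
  such an inverse witnesses the invertibility of the matrix and of its blocks alike.\<close>

lemma parabolicI:
  fixes g h :: "'a::comm_ring_1 mat"
  assumes g: "g \<in> carrier_mat (sum_list I) (sum_list I)" "block_upper I g"
    and h: "h \<in> carrier_mat (sum_list I) (sum_list I)" "block_upper I h"
    and gh: "g * h = 1\<^sub>m (sum_list I)" "h * g = 1\<^sub>m (sum_list I)"
  shows "g \<in> parabolic I"
proof -
  have "invertible_mat g"
    unfolding invertible_mat_def inverts_mat_def using g(1) h(1) gh by (auto intro!: exI [of _ h])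
  moreover have "invertible_mat (diag_block I i g)" if "i < length I" for i
    unfolding invertible_mat_def inverts_mat_def
    using diag_block_mult_inverse [OF g h gh(1) that] diag_block_mult_inverse [OF h g gh(2) that]
    by (auto simp: diag_block_def intro!: exI [of _ "diag_block I i h"])
  ultimately show ?thesis
    using g by (simp add: parabolic_def GL_def block_upper_def)
qed

section \<open>Inverses for the three families of matrices\<close>

lemma scaling_mat_mult:
  "scaling_mat n j c * scaling_mat n j d = scaling_mat n j (c * d :: 'a::comm_ring_1)"
proof (rule eq_matI)
  fix a b assume "a < dim_row (scaling_mat n j (c * d))" "b < dim_col (scaling_mat n j (c * d))"
  then have ab: "a < n" "b < n" by (simp_all add: scaling_mat_def)
  have "(scaling_mat n j c * scaling_mat n j d) $$ (a, b)
      = (\<Sum>l\<in>{0..<n}. scaling_mat n j c $$ (a, l) * scaling_mat n j d $$ (l, b))"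
    using ab by (auto simp: scaling_mat_def scalar_prod_def)
  also have "\<dots> = (\<Sum>l\<in>{0..<n}. if l = a then scaling_mat n j c $$ (a, a) * scaling_mat n j d $$ (a,
    b) else 0)"
    using ab by (intro sum.cong) (auto simp: scaling_mat_def)
  also have "\<dots> = scaling_mat n j (c * d) $$ (a, b)"
    using ab by (simp add: scaling_mat_def)
  finally show "(scaling_mat n j c * scaling_mat n j d) $$ (a, b)
    = scaling_mat n j (c * d) $$ (a, b)" .
qed (simp_all add: scaling_mat_def)

lemma scaling_mat_one: "scaling_mat n j 1 = 1\<^sub>m n"
  by (intro eq_matI) (auto simp: scaling_mat_def)

lemma transvection_mat_mult:
  "transvection_mat n j c * transvection_mat n j d
    = transvection_mat n j (\<lambda>l. c l + d l :: 'a::comm_ring_1)"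
proof (rule eq_matI)
  let ?g = "transvection_mat n j c" and ?h = "transvection_mat n j d"
  fix a b assume "a < dim_row (transvection_mat n j (\<lambda>l. c l + d l))"
    "b < dim_col (transvection_mat n j (\<lambda>l. c l + d l))"
  then have ab: "a < n" "b < n" by (simp_all add: transvection_mat_def)
  have "(?g * ?h) $$ (a, b) = (\<Sum>l\<in>{0..<n}. ?g $$ (a, l) * ?h $$ (l, b))"
    using ab by (auto simp: transvection_mat_def scalar_prod_def)
  also have "\<dots> = (\<Sum>l\<in>{0..<n}. (if l = a then ?h $$ (a, b) else 0)
      + (if l = j then (if a < j then c a * ?h $$ (j, b) else 0) else 0))"
    using ab by (intro sum.cong) (auto simp: transvection_mat_def)
  also have "\<dots> = ?h $$ (a, b) + (if j < n \<and> a < j then c a * ?h $$ (j, b) else 0)"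
    using ab by (simp add: sum.distrib)
  also have "\<dots> = transvection_mat n j (\<lambda>l. c l + d l) $$ (a, b)"
    using ab by (auto simp: transvection_mat_def)
  finally show "(?g * ?h) $$ (a, b) = transvection_mat n j (\<lambda>l. c l + d l) $$ (a, b)" .
qed (simp_all add: transvection_mat_def)

lemma transvection_mat_zero: "transvection_mat n j (\<lambda>_. 0) = 1\<^sub>m n"
  by (intro eq_matI) (auto simp: transvection_mat_def)

lemma swap_mat_mult: "Suc i < n \<Longrightarrow> swap_mat n i * swap_mat n i = (1\<^sub>m n :: 'a::comm_ring_1 mat)"
proof (rule eq_matI)
  let ?g = "swap_mat n i :: 'a mat"
  fix a b assume i: "Suc i < n" and "a < dim_row (1\<^sub>m n :: 'a mat)" "b < dim_col (1\<^sub>m n :: 'a mat)"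
  then have ab: "a < n" "b < n" by simp_all
  have t: "transpose i (Suc i) b < n" using ab i by (simp add: transpose_def)
  have "(?g * ?g) $$ (a, b) = (\<Sum>l\<in>{0..<n}. ?g $$ (a, l) * ?g $$ (l, b))"
    using ab by (auto simp: swap_mat_def scalar_prod_def)
  also have "\<dots> = (\<Sum>l\<in>{0..<n}. if l = transpose i (Suc i) b then (if a = b then 1 else 0) else 0)"
    using ab by (intro sum.cong) (auto simp: swap_mat_def)
  also have "\<dots> = 1\<^sub>m n $$ (a, b)" using ab t by simp
  finally show "(?g * ?g) $$ (a, b) = 1\<^sub>m n $$ (a, b)" .
qed (simp_all add: swap_mat_def)

lemma parabolic_group_parabolic:
  assumes "prime p" "r \<ge> 1" "q = p ^ r" "card (UNIV :: 'a::{field, finite} set) = q"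
    and I: "is_composition I n" and k: "1 \<le> k" "k \<le> q - 2"
  shows "parabolic_group p r q n k (partial_sum I ` {..length I}) (parabolic I :: 'a mat set)"
proof -
  have n: "sum_list I = n" using I by (simp add: is_composition_def)
  have upper: "block_upper I g" if "\<And>a b. b < a \<Longrightarrow> a < n \<Longrightarrow> g $$ (a, b) = 0" for g :: "'a mat"
    unfolding block_upper_def using that n by (meson order_less_le_trans)
  show ?thesis
  proof
    show "partial_sum I ` {..length I} \<subseteq> {..n}"
      using partial_sum_mono [of _ "length I" I] n by auto
    show "0 \<in> partial_sum I ` {..length I}" by (intro image_eqI [of _ _ 0]) simp_all
    show "n \<in> partial_sum I ` {..length I}" by (intro image_eqI [of _ _
      "length I"]) (simp_all add: n)
  next
    fix g :: "'a mat" assume g: "g \<in> parabolic I"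
    then show gc: "g \<in> carrier_mat n n" by (simp add: parabolic_def GL_def n)
    \<comment> \<open>Invertibility does not state the size of the inverse; it is recovered by
      comparing dimensions in the two equations.\<close>
    obtain h where h: "g * h = 1\<^sub>m (dim_row g)" "h * g = 1\<^sub>m (dim_row h)"
      using g unfolding parabolic_def GL_def invertible_mat_def inverts_mat_def by blast
    have "dim_col h = n" using arg_cong [OF h(1), of dim_col] gc by simp
    moreover have "dim_row h = n" using arg_cong [OF h(2), of dim_col] gc by simp
    ultimately show "\<exists>h\<in>carrier_mat n n. g * h = 1\<^sub>m n \<and> h * g = 1\<^sub>m n"
      using h gc by (intro bexI [of _ h]) auto
    fix m a b assume "m \<in> partial_sum I ` {..length I}" "b < m" "m \<le> a" "a < n"
    then show "g $$ (a, b) = 0" using g n unfolding parabolic_def by auto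
  next
    fix j and c :: 'a assume "j < n" "c \<noteq> 0"
    then show "scaling_mat n j c \<in> parabolic I"
      by (intro parabolicI [of _ _ "scaling_mat n j (1 / c)"] upper)
        (auto simp: n scaling_mat_mult scaling_mat_one, auto simp: scaling_mat_def)
  next
    fix j and d :: "nat \<Rightarrow> 'a" assume "j < n"
    then show "transvection_mat n j d \<in> parabolic I"
      by (intro parabolicI [of _ _ "transvection_mat n j (\<lambda>l. - d l)"] upper)
        (auto simp: n transvection_mat_mult transvection_mat_zero, auto simp: transvection_mat_def)
  next
    fix i assume i: "Suc i < n" "Suc i \<notin> partial_sum I ` {..length I}"
    have "block_upper I (swap_mat n i :: 'a mat)"
      unfolding block_upper_def
    proof (intro allI impI)
      fix l a b assume l: "l \<le> length I" "a < sum_list I" "b < sum_list I" "b < partial_sum I l"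
        "partial_sum I l \<le> a"
      have "a \<noteq> transpose i (Suc i) b"
      proof
        assume "a = transpose i (Suc i) b"
        \<comment> \<open>The only nonzero entry of an exchange below the diagonal is in row
          \<open>Suc i\<close> and column \<open>i\<close>, and the only boundary that separates
          these is \<open>Suc i\<close>.\<close>
        then have "b = i" "a = Suc i" using l(4,5) by (auto simp: transpose_def split: if_splits)
        then have "partial_sum I l = Suc i" using l(4,5) by simp
        then show False using i(2) l(1) by (metis atMost_iff image_eqI)
      qed
      then show "swap_mat n i $$ (a, b) = (0 :: 'a)" using l n by (simp add: swap_mat_def)
    qed
    moreover have "(swap_mat n i :: 'a mat) \<in> carrier_mat n n" by (simp add: swap_mat_def)
    ultimately show "(swap_mat n i :: 'a mat) \<in> parabolic I"
      using swap_mat_mult [OF i(1), where 'a = 'a]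
        by (intro parabolicI [of _ _ "swap_mat n i"]) (simp_all add: n)
  qed (use assms in auto)
qed

section \<open>Hilbert series\<close>

definition weighted_monomials :: "nat \<Rightarrow> (nat \<Rightarrow> nat) \<Rightarrow> nat \<Rightarrow> (nat \<Rightarrow>\<^sub>0 nat) set" where
  "weighted_monomials n \<delta> d = {\<alpha>. keys \<alpha> \<subseteq> {..<n} \<and> (\<Sum>b<n. \<delta> b * lookup \<alpha> b) = d}"

lemma finite_weighted_monomials:
  assumes "\<And>b. b < n \<Longrightarrow> \<delta> b > 0"
  shows "finite (weighted_monomials n \<delta> d)"
proof (rule finite_subset [OF _ finite_bounded_monomials [of n d]])
  show "weighted_monomials n \<delta> d \<subseteq> {\<alpha>. keys \<alpha> \<subseteq> {..<n} \<and> (\<forall>b<n. lookup \<alpha> b \<le> d)}"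
  proof
    fix \<alpha> assume \<alpha>: "\<alpha> \<in> weighted_monomials n \<delta> d"
    have "lookup \<alpha> b \<le> d" if "b < n" for b
    proof -
      have "1 * lookup \<alpha> b \<le> \<delta> b * lookup \<alpha> b" using assms [OF that] by (intro mult_le_mono1) simp
      also have "\<dots> \<le> (\<Sum>b<n. \<delta> b * lookup \<alpha> b)" using that by (intro member_le_sum) auto
      finally show ?thesis using \<alpha> by (simp add: weighted_monomials_def)
    qed
    then show "\<alpha> \<in> {\<alpha>. keys \<alpha> \<subseteq> {..<n} \<and> (\<forall>b<n. lookup \<alpha> b \<le> d)}"
      using \<alpha> by (simp add: weighted_monomials_def)
  qed
qed

text \<open>A weighted monomial in \<open>Suc n\<close> variables either has last exponent 0 or
  arises by raising that exponent by 1. Hence multiplication by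
  \<open>1 - fps_X ^ \<delta> n\<close> takes the counting series for \<open>Suc n\<close> variables
  to the one for \<open>n\<close>.\<close>

lemma weighted_monomials_generating_function:
  assumes "\<And>b. b < n \<Longrightarrow> \<delta> b > 0"
  shows "(\<Prod>b<n. 1 - fps_X ^ \<delta> b) * Abs_fps (\<lambda>d. of_nat (card (weighted_monomials n \<delta> d)))
    = (1 :: rat fps)"
  using assms
proof (induction n)
  case 0
  have "weighted_monomials 0 \<delta> d = (if d = 0 then {0} else {})" for d
    by (auto simp: weighted_monomials_def)
  then show ?case by (intro fps_ext) simp
next
  case (Suc n)
  let ?W = "\<lambda>n d. weighted_monomials n \<delta> d"
  let ?C = "\<lambda>n. Abs_fps (\<lambda>d. of_nat (card (?W n d))) :: rat fps"
  let ?S = "\<lambda>d. (\<lambda>\<alpha>. \<alpha> + single n 1) ` (if \<delta> n \<le> d then ?W (Suc n) (d - \<delta> n) else {})"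
  have card_Suc: "card (?W (Suc n) d) = card (?W n d) + (if \<delta> n
    \<le> d then card (?W (Suc n) (d - \<delta> n)) else 0)" for d
  proof -
    have split: "?W (Suc n) d = ?W n d \<union> ?S d"
    proof (intro equalityI subsetI)
      fix \<alpha> assume \<alpha>: "\<alpha> \<in> ?W (Suc n) d"
      show "\<alpha> \<in> ?W n d \<union> ?S d"
      proof (cases "lookup \<alpha> n = 0")
        case True
        then have "n \<notin> keys \<alpha>" by (simp add: in_keys_iff)
        then have "keys \<alpha> \<subseteq> {..<n}" using \<alpha> unfolding weighted_monomials_def
          by (auto simp: less_Suc_eq)
        then show ?thesis using \<alpha> True by (simp add: weighted_monomials_def)
      next
        case False
        define \<beta> where "\<beta> = \<alpha> - single n 1"
        have \<alpha>_\<beta>: "\<alpha> = \<beta> + single n 1"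
          using False by (intro poly_mapping_eqI) (auto simp: \<beta>_def lookup_add lookup_minus
            lookup_single when_def)
        have "keys \<beta> \<subseteq> keys \<alpha>"
          by (auto simp: in_keys_iff \<beta>_def lookup_minus)
        then have keys: "keys \<beta> \<subseteq> {..<Suc n}" using \<alpha> by (auto simp: weighted_monomials_def)
        have "(\<Sum>b<Suc n. \<delta> b * lookup \<alpha> b) = (\<Sum>b<Suc n. \<delta> b * lookup \<beta> b) + \<delta> n"
          by (simp add: \<alpha>_\<beta> lookup_add lookup_single)
        then have "(\<Sum>b<Suc n. \<delta> b * lookup \<beta> b) + \<delta> n = d" using \<alpha>
          by (simp add: weighted_monomials_def)
        then have "\<delta> n \<le> d" "\<beta> \<in> ?W (Suc n) (d - \<delta> n)" using keys
          by (auto simp: weighted_monomials_def)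
        then show ?thesis using \<alpha>_\<beta> by auto
      qed
    next
      fix \<alpha> assume "\<alpha> \<in> ?W n d \<union> ?S d"
      then consider "\<alpha> \<in> ?W n d" | \<beta> where "\<delta> n \<le> d" "\<beta> \<in> ?W (Suc n) (d - \<delta> n)" "\<alpha> = \<beta> + single n 1"
        by (auto split: if_splits)
      then show "\<alpha> \<in> ?W (Suc n) d"
      proof cases
        case 1
        then have "n \<notin> keys \<alpha>" by (auto simp: weighted_monomials_def)
        then show ?thesis using 1 by (auto simp: weighted_monomials_def in_keys_iff)
      next
        case 2
        have "keys \<alpha> \<subseteq> {..<Suc n}"
          using keys_add [of \<beta> "single n 1"] 2 unfolding weighted_monomials_def by fastforce
        then show ?thesis using 2 by (auto simp: weighted_monomials_def lookup_add lookup_single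
          distrib_left)
      qed
    qed
    have "?W n d \<inter> ?S d = {}"
    proof -
      have "lookup \<alpha> n = 0" if "\<alpha> \<in> ?W n d" for \<alpha>
        using that by (auto simp: weighted_monomials_def in_keys_iff)
      moreover have "lookup (\<alpha> + single n 1) n \<noteq> 0" for \<alpha> :: "nat \<Rightarrow>\<^sub>0 nat"
        by (simp add: lookup_add)
      ultimately show ?thesis by (metis (no_types, lifting) disjoint_iff imageE)
    qed
    moreover have "inj (\<lambda>\<alpha>. \<alpha> + single n (1 :: nat))" by (simp add: inj_def)
    ultimately show ?thesis
      unfolding split using Suc.prems
      by (subst card_Un_disjoint) (auto simp: finite_weighted_monomials card_image inj_on_subset)
  qed
  have "(1 - fps_X ^ \<delta> n) * ?C (Suc n) = ?C n"
  proof (rule fps_ext)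
    fix d
    show "fps_nth ((1 - fps_X ^ \<delta> n) * ?C (Suc n)) d = fps_nth (?C n) d"
      by (simp add: left_diff_distrib fps_X_power_mult_nth card_Suc [of d])
  qed
  then have "(\<Prod>b<Suc n. 1 - fps_X ^ \<delta> b) * ?C (Suc n) = (\<Prod>b<n. 1 - fps_X ^ \<delta> b) * ?C n"
    by (simp add: mult.assoc)
  then show ?case using Suc by simp
qed

text \<open>In block \<open>i\<close> the product over \<open>j\<close> runs through the indices
  \<open>b = partial_sum I i - j\<close> of the block in reverse order, and
  \<open>partial_sum I i\<close> is the least boundary beyond each of them.\<close>

lemma prod_blocks:
  fixes f :: "nat \<Rightarrow> nat \<Rightarrow> 'a::comm_monoid_mult"
  assumes "l \<le> length I"
  shows "(\<Prod>i = 1..l. \<Prod>j = 1..I ! (i - 1). f (partial_sum I i) (partial_sum I i - j))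
    = (\<Prod>b<partial_sum I l. f (LEAST m. m \<in> partial_sum I ` {..length I} \<and> b < m) b)"
  using assms
proof (induction l)
  case (Suc l)
  define s where "s = partial_sum I l"
  have Suc_s: "partial_sum I (Suc l) = s + I ! l" using Suc.prems
    by (simp add: partial_sum_Suc s_def)
  have least: "(LEAST m. m \<in> partial_sum I ` {..length I} \<and> b < m) = s + I ! l"
    if b: "s \<le> b" "b < s + I ! l" for b
  proof (rule Least_equality)
    show "s + I ! l \<in> partial_sum I ` {..length I} \<and> b < s + I ! l"
      using Suc.prems b(2) by (auto intro!: image_eqI [of _ _ "Suc l"] simp: Suc_s)
    fix m assume "m \<in> partial_sum I ` {..length I} \<and> b < m"
    then obtain i where i: "m = partial_sum I i" "b < m" by blast
    have "\<not> i \<le> l" using partial_sum_mono [of i l I] i b(1) by (auto simp: s_def)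
    then show "s + I ! l \<le> m" using partial_sum_mono [of "Suc l" i I] by (simp add: i Suc_s)
  qed
  have "(\<Prod>j = 1..I ! l. f (s + I ! l) (s + I ! l - j)) = (\<Prod>b = s..<s + I ! l. f (s + I ! l) b)"
    by (rule prod.reindex_bij_witness [of _ "\<lambda>b. s + I ! l - b" "\<lambda>j. s + I ! l - j"]) auto
  also have "\<dots> = (\<Prod>b = s..<s + I ! l. f (LEAST m. m \<in> partial_sum I ` {..length I} \<and> b < m) b)"
    using least by (intro prod.cong) auto
  finally have "(\<Prod>i = 1..Suc l. \<Prod>j = 1..I ! (i - 1). f (partial_sum I i) (partial_sum I i - j))
      = (\<Prod>b<s. f (LEAST m. m \<in> partial_sum I ` {..length I} \<and> b < m) b)
        * (\<Prod>b = s..<s + I ! l. f (LEAST m. m \<in> partial_sum I ` {..length I} \<and> b < m) b)"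
    using Suc by (simp add: Suc_s s_def)
  also have "\<dots> = (\<Prod>b<s + I ! l. f (LEAST m. m \<in> partial_sum I ` {..length I} \<and> b < m) b)"
    unfolding lessThan_atLeast0 by (rule prod.atLeastLessThan_concat) auto
  finally show ?case by (simp add: Suc_s)
qed simp

lemma geometric_sum_nat:
  fixes q :: nat
  assumes "q \<ge> 2"
  shows "(q ^ n - 1) div (q - 1) = (\<Sum>a<n. q ^ a)"
proof -
  have "Suc m ^ n = m * (\<Sum>a<n. Suc m ^ a) + 1" for m
    by (induction n) (simp_all add: algebra_simps)
  from this [of "q - 1"] have "q ^ n = (q - 1) * (\<Sum>a<n. q ^ a) + 1" using assms by simp
  then show ?thesis using assms by simp
qed

lemma hs_t_power: "hs_t ^ m = fps_const (fps_X ^ m)"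
  by (simp add: hs_t_def fps_const_power)

lemma fps_const_prod: "(\<Prod>x\<in>X. fps_const (f x)) = fps_const (\<Prod>x\<in>X. f x :: 'a::comm_ring_1)"
  by (induction X rule: infinite_finite_induct) simp_all

context parabolic_group
begin

text \<open>The degree of \<open>moore_det n\<close> is
  \<open>weight T + weight ({..<n} - T)\<close>. So one of its \<open>q - 1 - k\<close> factors
  cancels \<open>weight T\<close> and leaves the weight of the complement; what remains is to count
  products of Dickson polynomials of a given degree.\<close>

lemma card_index_set:
  "card (index_set i j) = (\<Sum>T\<in>{T \<in> Pow {..<n}. card T = j}.
    if (\<Sum>a<n. q ^ a) * (q - 2 - k) + weight ({..<n} - T) \<le> i
    then card (weighted_monomials n (\<lambda>b. q ^ block_end b - q ^ b)
      (i - ((\<Sum>a<n. q ^ a) * (q - 2 - k) + weight ({..<n} - T)))) else 0)"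
proof -
  define N where "N = (\<Sum>a<n. q ^ a)"
  define A where "A T = {\<alpha>. keys \<alpha> \<subseteq> {..<n} \<and> N * (q - 1 - k) + dickson_degree \<alpha> = i + weight T}"
    for T
  have fin: "finite {T \<in> Pow {..<n}. card T = j}" by simp
  have "index_set i j = Sigma {T \<in> Pow {..<n}. card T = j} A"
    by (auto simp: index_set_def A_def N_def)
  moreover have "finite (A T)" if "T \<in> {T \<in> Pow {..<n}. card T = j}" for T
  proof -
    have "(T, \<alpha>) \<in> index_set i j" if "\<alpha> \<in> A T" for \<alpha>
      using that \<open>T \<in> {T \<in> Pow {..<n}. card T = j}\<close> by (simp add: index_set_def A_def N_def)
    then have "A T \<subseteq> snd ` index_set i j" by (intro subsetI image_eqI) auto
    then show ?thesis using finite_index_set finite_subset by blast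
  qed
  ultimately have card_sum: "card (index_set i j) = (\<Sum>T\<in>{T \<in> Pow {..<n}. card T = j}. card (A T))"
    using fin by (simp add: card_SigmaI)
  have card_A: "card (A T) = (if N * (q - 2 - k) + weight ({..<n} - T) \<le> i
      then card (weighted_monomials n (\<lambda>b. q ^ block_end b - q ^ b)
        (i - (N * (q - 2 - k) + weight ({..<n} - T)))) else 0)" if "T \<in> {T \<in> Pow {..<n}. card T =
          j}" for T
  proof -
    have "N = weight T + weight ({..<n} - T)"
      unfolding weight_def N_def using that by (simp add: sum.subset_diff [of T
        "{..<n}"] add.commute)
    moreover have "q - 1 - k = Suc (q - 2 - k)" using k_le k_pos by linarith
    ultimately have "N * (q - 1 - k) = N * (q - 2 - k) + weight ({..<n} - T) + weight T" by simp
    then have "A T = {\<alpha>. keys \<alpha> \<subseteq> {..<n} \<and> N * (q - 2 - k) + weight ({..<n} - T) + dickson_degree \<alpha>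
      = i}"
      by (auto simp: A_def)
    also have "\<dots> = (if N * (q - 2 - k) + weight ({..<n} - T) \<le> i
      then weighted_monomials n (\<lambda>b. q ^ block_end b - q ^ b)
        (i - (N * (q - 2 - k) + weight ({..<n} - T))) else {})"
      by (auto simp: weighted_monomials_def dickson_degree_def)
    finally show ?thesis by simp
  qed
  show ?thesis
    unfolding card_sum by (rule sum.cong [OF refl card_A [unfolded N_def]])
qed

text \<open>In the expansion of the numerator a set \<open>T\<close> of factors contributes
  \<open>hs_s\<close> and its complement the powers of \<open>hs_t\<close>; the resulting term is
  the one that \<open>card_index_set\<close> attaches to \<open>T\<close>.\<close>

theorem hilbert_series_eq:
  "hilbert_series n G k = hs_t ^ ((q - 2 - k) * (\<Sum>a<n. q ^ a)) *
    ((\<Prod>a<n. hs_s + hs_t ^ (q ^ a)) / (\<Prod>b<n. 1 - hs_t ^ (q ^ block_end b - q ^ b)))"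
proof -
  define N where "N = (\<Sum>a<n. q ^ a)"
  define \<delta> where "\<delta> b = q ^ block_end b - q ^ b" for b
  define C :: "rat fps" where "C = Abs_fps (\<lambda>d. of_nat (card (weighted_monomials n \<delta> d)))"
  define D :: "rat fps" where "D = (\<Prod>b<n. 1 - fps_X ^ \<delta> b)"
  have "\<delta> b > 0" if "b < n" for b
    using block_end [OF that] q_ge_2 unfolding \<delta>_def by (simp add: power_strict_increasing)
  then have DC: "D * C = 1" unfolding D_def C_def by (rule weighted_monomials_generating_function)
  have "fps_nth (D * C) 0 = 1" by (simp add: DC)
  then have D0: "fps_nth D 0 \<noteq> 0" by auto
  have den: "(\<Prod>b<n. 1 - hs_t ^ (q ^ block_end b - q ^ b)) = fps_const D"
    unfolding D_def \<delta>_def [symmetric] hs_t_power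
  proof -
    have "1 - fps_const f = fps_const (1 - f)" for f :: "rat fps"
      by (metis fps_const_1_eq_1 fps_const_sub)
    then show "(\<Prod>b<n. 1 - fps_const (fps_X ^ \<delta> b)) = fps_const (\<Prod>b<n. 1 - fps_X ^ \<delta> b :: rat fps)"
      by (simp add: fps_const_prod)
  qed
  define P :: "rat fps fps" where "P = (\<Prod>a<n. hs_s + hs_t ^ (q ^ a))"
  \<comment> \<open>The denominator is a series in t alone with inverse \<open>C\<close> and nonzero
    constant term, so the division of nested series becomes a multiplication.\<close>
  have "P / fps_const D = P / fps_const D * (fps_const D * fps_const C)"
    by (simp add: DC)
  also have "\<dots> = P / fps_const D * fps_const D * fps_const C"
    by (simp only: mult.assoc)
  also have "P / fps_const D * fps_const D = P"
    by (rule fps_fps_divide_mult) (use D0 in simp)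
  finally have quot: "P / fps_const D = P * fps_const C" .
  have P: "P = (\<Sum>T\<in>Pow {..<n}. fps_const (fps_X ^ weight ({..<n} - T)) * fps_X ^ card T)"
  proof -
    have "P = (\<Sum>T\<in>Pow {..<n}. (\<Prod>a\<in>T. hs_s) * (\<Prod>a\<in>{..<n} - T. hs_t ^ (q ^ a)))"
      unfolding P_def by (rule prod_add) simp
    then show ?thesis
      by (simp add: hs_t_power fps_const_prod hs_s_def weight_def power_sum mult.commute)
  qed
  have "hilbert_series n G k = hs_t ^ ((q - 2 - k) * N) * (P * fps_const C)"
  proof (rule fps_ext)
    fix j
    show "fps_nth (hilbert_series n G k) j = fps_nth (hs_t ^ ((q - 2 - k) * N) * (P * fps_const C))
      j"
    proof (rule fps_ext)
      fix i
      have "fps_nth (hs_t ^ ((q - 2 - k) * N) * (P * fps_const C)) j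
          = fps_X ^ ((q - 2 - k) * N) * (fps_nth P j * C)"
        by (simp add: hs_t_power)
      also have "fps_nth P j = (\<Sum>T\<in>{T \<in> Pow {..<n}. card T = j}. fps_X ^ weight ({..<n} - T))"
      proof -
        have "fps_nth P j = (\<Sum>T\<in>Pow {..<n}. if card T = j then fps_X ^ weight ({..<n} - T) else 0)"
          unfolding P fps_sum_nth by (intro sum.cong) (auto simp: fps_X_power_nth)
        then show ?thesis by (subst sum.inter_filter) simp_all
      qed
      also have "fps_X ^ ((q - 2 - k) * N) * ((\<Sum>T\<in>{T \<in> Pow {..<n}. card T
        = j}. fps_X ^ weight ({..<n} - T)) * C)
          = (\<Sum>T\<in>{T \<in> Pow {..<n}. card T = j}. fps_X ^ (N * (q - 2 - k) + weight ({..<n} - T)) * C)"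
        by (simp add: sum_distrib_left sum_distrib_right power_add mult_ac)
      finally have coeff_j: "fps_nth (hs_t ^ ((q - 2 - k) * N) * (P * fps_const C)) j
          = (\<Sum>T\<in>{T \<in> Pow {..<n}. card T = j}. fps_X ^ (N * (q - 2 - k) + weight ({..<n} - T)) *
            C)" .
      have "fps_nth (fps_nth (hs_t ^ ((q - 2 - k) * N) * (P * fps_const C)) j) i
        = (\<Sum>T\<in>{T \<in> Pow {..<n}. card T = j}. if N * (q - 2 - k) + weight ({..<n} - T) \<le> i
            then of_nat (card (weighted_monomials n \<delta> (i - (N * (q - 2 - k) + weight ({..<n} -
              T))))) else 0)"
        unfolding coeff_j fps_sum_nth by (intro sum.cong) (auto simp: fps_X_power_mult_nth C_def)
      also have "\<dots> = of_nat (card (index_set i j))"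
        unfolding card_index_set N_def \<delta>_def of_nat_sum by (intro sum.cong) simp_all
      finally show "fps_nth (fps_nth (hilbert_series n G k) j) i
        = fps_nth (fps_nth (hs_t ^ ((q - 2 - k) * N) * (P * fps_const C)) j) i"
        by (simp add: hilbert_series_def dim_invariants)
    qed
  qed
  then show ?thesis unfolding den P_def [symmetric] quot N_def [symmetric] .
qed

end

theorem theoremB:
  fixes p r q n k :: nat and I :: "nat list"
  assumes "prime p" and "r \<ge> 1" and "q = p ^ r"
    and "card (UNIV :: 'a::{field, finite} set) = q"
    and "n \<ge> 1" and "is_composition I n"
    and "1 \<le> k" and "k \<le> q - 2"
  shows "hilbert_series n (parabolic I :: 'a mat set) k =
    hs_t ^ ((q - 2 - k) * ((q ^ n - 1) div (q - 1))) *
    ((\<Prod>i = 0..n - 1. hs_s + hs_t ^ (q ^ i)) /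
     (\<Prod>i = 1..length I. \<Prod>j = 1..I ! (i - 1).
        1 - hs_t ^ (q ^ partial_sum I i - q ^ (partial_sum I i - j))))"
proof -
  interpret parabolic_group p r q "TYPE('a)" n k "partial_sum I ` {..length I}" "parabolic I"
    by (rule parabolic_group_parabolic) (use assms in auto)
  have "sum_list I = n" using assms(6) by (simp add: is_composition_def)
  \<comment> \<open>Here \<open>block_end b\<close> unfolds to the least boundary beyond
    \<open>b\<close>, which is how \<open>prod_blocks\<close> names the end of the block of
    \<open>b\<close>.\<close>
  then have "(\<Prod>i = 1..length I. \<Prod>j = 1..I ! (i - 1).
        1 - hs_t ^ (q ^ partial_sum I i - q ^ (partial_sum I i - j)))
      = (\<Prod>b<n. 1 - hs_t ^ (q ^ block_end b - q ^ b))"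
    using prod_blocks [of "length I" I "\<lambda>m b. 1 - hs_t ^ (q ^ m - q ^ b)"]
    by (simp add: block_end_def)
  moreover have "{0..n - 1} = {..<n}" using assms(5) by auto
  ultimately show ?thesis
    using hilbert_series_eq geometric_sum_nat [OF q_ge_2, of n] by simp
qed

end
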